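(* Let $\lambda\in(0,\infty)$ and let $\alpha$ be a random variable with values in $(0,1)$ having a probability density function of the form $\psi(x)(1-x)^{\beta}$, $x\in(0,1)$, where $\psi$ is an integrable function on $(0,1)$ having a limit $\lim_{x\uparrow 1}\psi(x)=\psi_1\in(0,\infty)$. Let $(\alpha^{(j)},(X^{(j)}_k)_{k\in\mathbb{Z}_+})$, $j\in\mathbb{N}$, be independent copies of $(\alpha,(X_k)_{k\in\mathbb{Z}_+})$, where $(X_k)_{k\in\mathbb{Z}_+}$ is the randomized INAR(1) process with random thinning parameter $\alpha$ and Poisson innovations with parameter $\lambda$, and for $N,n\in\mathbb{N}$ put $$\widetilde S^{(N,n)}_t:=\sum_{j=1}^N\sum_{k=1}^{\lfloor nt\rfloor}\bigl(X^{(j)}_k-\mathbb{E}(X^{(j)}_k\mid\alpha^{(j)})\bigr),\qquad t\in\mathbb{R}_+ .$$ If $\beta=1$, then $$\mathcal{D}_{\mathrm f}\text{-}\lim_{N\to\infty}\ \mathcal{D}_{\mathrm f}\text{-}\lim_{n\to\infty}\ \frac{1}{\sqrt{nN\log N}}\,\widetilde S^{(N,n)}=\sqrt{\lambda\psi_1}\,B,$$ where $B=(B_t)_{t\in\mathbb{R}_+}$ is a standard Wiener process.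
   Context: $\mathbb{Z}_+$, $\mathbb{N}$, $\mathbb{R}_+$ denote the non-negative integers, the positive integers and the non-negative real numbers. Randomized INAR(1) process: conditionally on $\alpha$, $(X_k)_{k\in\mathbb{Z}_+}$ is a strictly stationary INAR(1) process with thinning parameter $\alpha$, that is, $$X_k=\sum_{i=1}^{X_{k-1}}\xi_{k,i}+\varepsilon_k,\qquad k\in\mathbb{N},$$ where, conditionally on $\alpha$: $(\xi_{k,i})_{k,i\in\mathbb{N}}$ are i.i.d. Bernoulli random variables with mean $\alpha$; $(\varepsilon_k)_{k\in\mathbb{N}}$ are i.i.d. Poisson random variables with parameter $\lambda$; $X_0$ has the unique stationary distribution, namely the Poisson distribution with parameter $\lambda/(1-\alpha)$; and $X_0$, $(\xi_{k,i})_{k,i\in\mathbb{N}}$ and $(\varepsilon_k)_{k\in\mathbb{N}}$ are independent. In particular $\mathbb{E}(X_k\mid\alpha)=\lambda/(1-\alpha)$. The innovations are idiosyncratic: the innovation sequences belonging to different copies $j$ are independent. $\mathcal{D}_{\mathrm f}\text{-}\lim$ denotes weak convergence of the finite-dimensional distributions of stochastic processes indexed by $t\in\mathbb{R}_+$. In the iterated limit, one first takes $n\to\infty$ for fixed $N$ (inner limit), and then lets $N\to\infty$ in the resulting limit process (outer limit). *)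

theory Defs
  imports "HOL-Probability.Probability"
begin

definition sigma_gen :: "'w measure \<Rightarrow> ('w \<Rightarrow> real) \<Rightarrow> 'w measure" where
  "sigma_gen M Y = vimage_algebra (space M) Y borel"

text \<open>The conditional distribution of \<open>Z\<close> given \<open>Y\<close> is \<open>\<kappa> Y\<close>:
  \<open>P(Z \<in> C | Y) = \<kappa> Y C\<close> almost surely, for every measurable \<open>C\<close>.\<close>

definition has_cond_distr ::
  "'w measure \<Rightarrow> ('w \<Rightarrow> real) \<Rightarrow> 's measure \<Rightarrow> ('w \<Rightarrow> 's) \<Rightarrow> (real \<Rightarrow> 's measure) \<Rightarrow> bool" where
  "has_cond_distr M Y L Z \<kappa> \<longleftrightarrow>
     Y \<in> borel_measurable M \<and> Z \<in> M \<rightarrow>\<^sub>M L \<and>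
     (\<forall>C\<in>sets L. AE \<omega> in M.
        real_cond_exp M (sigma_gen M Y) (indicator (Z -` C \<inter> space M)) \<omega> = measure (\<kappa> (Y \<omega>)) C)"

text \<open>The joint law of \<open>(X\<^sub>0, (\<xi>\<^bsub>k,i\<^esub>), (\<epsilon>\<^sub>k))\<close>, \<open>k, i \<ge> 1\<close>, for a deterministic thinning
  parameter \<open>a\<close>. Being a product measure, it encodes that all these variables are independent;
  the initial law is the stationary one. Only \<open>a \<in> (0,1)\<close> is meaningful.\<close>

definition inar_input_law ::
  "real \<Rightarrow> real \<Rightarrow> (nat \<times> (nat \<times> nat \<Rightarrow> nat) \<times> (nat \<Rightarrow> nat)) measure" where
  "inar_input_law lam a =
     measure_pmf (poisson_pmf (lam / (1 - a))) \<Otimes>\<^sub>M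
     ((\<Pi>\<^sub>M ki\<in>{1..} \<times> {1..}. measure_pmf (map_pmf of_bool (bernoulli_pmf a))) \<Otimes>\<^sub>M
      (\<Pi>\<^sub>M k\<in>{1..}. measure_pmf (poisson_pmf lam)))"

definition inar_input_space :: "(nat \<times> (nat \<times> nat \<Rightarrow> nat) \<times> (nat \<Rightarrow> nat)) measure" where
  "inar_input_space =
     count_space UNIV \<Otimes>\<^sub>M
     ((\<Pi>\<^sub>M ki\<in>{1..} \<times> {1..}. count_space UNIV) \<Otimes>\<^sub>M (\<Pi>\<^sub>M k\<in>{1..}. count_space UNIV))"

definition randomized_INAR1 ::
  "'w measure \<Rightarrow> real \<Rightarrow> ('w \<Rightarrow> real) \<Rightarrow> (nat \<Rightarrow> 'w \<Rightarrow> nat) \<Rightarrow> bool" where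
  "randomized_INAR1 M lam \<alpha> X \<longleftrightarrow>
     prob_space M \<and>
     (\<forall>\<omega>\<in>space M. \<alpha> \<omega> \<in> {0<..<1}) \<and>
     (\<exists>(\<xi> :: nat \<Rightarrow> nat \<Rightarrow> 'w \<Rightarrow> nat) (\<epsilon> :: nat \<Rightarrow> 'w \<Rightarrow> nat).
        has_cond_distr M \<alpha> inar_input_space
          (\<lambda>\<omega>. (X 0 \<omega>, \<lambda>(k, i)\<in>{1..} \<times> {1..}. \<xi> k i \<omega>, \<lambda>k\<in>{1..}. \<epsilon> k \<omega>))
          (inar_input_law lam) \<and>
        (\<forall>k\<ge>1. \<forall>\<omega>\<in>space M. X k \<omega> = (\<Sum>i = 1..X (k - 1) \<omega>. \<xi> k i \<omega>) + \<epsilon> k \<omega>))"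

definition has_real_density :: "'w measure \<Rightarrow> ('w \<Rightarrow> real) \<Rightarrow> (real \<Rightarrow> real) \<Rightarrow> bool" where
  "has_real_density M Y f \<longleftrightarrow>
     (AE x in lborel. 0 \<le> f x) \<and> distributed M lborel Y (\<lambda>x. ennreal (f x))"

text \<open>Independent copies \<open>Z j\<close>, \<open>j \<in> J\<close>, living on \<open>M\<close>, of a random element \<open>Z0\<close> living on \<open>M0\<close>.\<close>

definition independent_copies ::
  "'w measure \<Rightarrow> 'j set \<Rightarrow> 's measure \<Rightarrow> ('j \<Rightarrow> 'w \<Rightarrow> 's) \<Rightarrow> 'v measure \<Rightarrow> ('v \<Rightarrow> 's) \<Rightarrow> bool" where
  "independent_copies M J L Z M0 Z0 \<longleftrightarrow>
     prob_space M \<and> prob_space M0 \<and> Z0 \<in> M0 \<rightarrow>\<^sub>M L \<and>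
     prob_space.indep_vars M (\<lambda>_. L) Z J \<and>
     (\<forall>j\<in>J. distr M L (Z j) = distr M0 L Z0)"

definition aggregated_sum ::
  "'w measure \<Rightarrow> (nat \<Rightarrow> 'w \<Rightarrow> real) \<Rightarrow> (nat \<Rightarrow> nat \<Rightarrow> 'w \<Rightarrow> nat) \<Rightarrow>
   nat \<Rightarrow> nat \<Rightarrow> real \<Rightarrow> 'w \<Rightarrow> real" where
  "aggregated_sum M \<alpha> X N n t \<omega> =
     (\<Sum>j = 1..N. \<Sum>k = 1..nat \<lfloor>real n * t\<rfloor>.
        real (X j k \<omega>) - real_cond_exp M (sigma_gen M (\<alpha> j)) (\<lambda>\<omega>'. real (X j k \<omega>')) \<omega>)"

definition real_process :: "'w measure \<Rightarrow> (real \<Rightarrow> 'w \<Rightarrow> real) \<Rightarrow> bool" where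
  "real_process M Y \<longleftrightarrow> prob_space M \<and> (\<forall>t\<ge>0. Y t \<in> borel_measurable M)"

text \<open>Weak convergence of the finite-dimensional distributions of processes indexed by \<open>t \<ge> 0\<close>,
  tested against bounded continuous functions on the spaces \<open>\<real>\<^sup>T\<close>, \<open>T\<close> a finite set of times.
  The processes may live on different probability spaces.\<close>

definition fdd_limit ::
  "(nat \<Rightarrow> 'a measure) \<Rightarrow> (nat \<Rightarrow> real \<Rightarrow> 'a \<Rightarrow> real) \<Rightarrow> 'b measure \<Rightarrow> (real \<Rightarrow> 'b \<Rightarrow> real) \<Rightarrow> bool" where
  "fdd_limit M X M' Y \<longleftrightarrow>
     (\<forall>n. real_process (M n) (X n)) \<and> real_process M' Y \<and>
     (\<forall>(T :: real set) f.
        finite T \<longrightarrow> T \<subseteq> {0..} \<longrightarrow>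
        continuous_map (product_topology (\<lambda>_. euclideanreal) T) euclideanreal f \<longrightarrow>
        bounded (f ` (\<Pi>\<^sub>E t\<in>T. UNIV)) \<longrightarrow>
        (\<lambda>n. \<integral>\<omega>. f (\<lambda>t\<in>T. X n t \<omega>) \<partial>M n) \<longlonglongrightarrow> (\<integral>\<omega>. f (\<lambda>t\<in>T. Y t \<omega>) \<partial>M'))"

definition standard_wiener :: "'w measure \<Rightarrow> (real \<Rightarrow> 'w \<Rightarrow> real) \<Rightarrow> bool" where
  "standard_wiener M B \<longleftrightarrow>
     real_process M B \<and>
     (AE \<omega> in M. B 0 \<omega> = 0) \<and>
     (\<forall>s t. 0 \<le> s \<longrightarrow> s < t \<longrightarrow>
        distributed M lborel (\<lambda>\<omega>. B t \<omega> - B s \<omega>) (\<lambda>x. ennreal (normal_density 0 (sqrt (t - s)) x))) \<and>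
     (\<forall>(m :: nat) (s :: nat \<Rightarrow> real). 0 \<le> s 0 \<longrightarrow> (\<forall>i<m. s i < s (Suc i)) \<longrightarrow>
        prob_space.indep_vars M (\<lambda>_. borel) (\<lambda>i \<omega>. B (s (Suc i)) \<omega> - B (s i) \<omega>) {..<m}) \<and>
     (AE \<omega> in M. continuous_on {0..} (\<lambda>t. B t \<omega>))"

text \<open>Iterated limit: \<open>L N\<close> is the law, on the path space \<open>\<real>\<^bsup>[0,\<infinity>)\<^esup>\<close>, of the inner limit process for
  fixed \<open>N\<close>; that process is realised by the coordinate maps \<open>w \<mapsto> w t\<close>. The inner limit is required
  for \<open>N \<ge> 2\<close> only, so that normalisations such as \<open>1 / \<surd>(N log N)\<close> make sense.\<close>

definition iterated_fdd_limit ::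
  "'a measure \<Rightarrow> (nat \<Rightarrow> nat \<Rightarrow> real \<Rightarrow> 'a \<Rightarrow> real) \<Rightarrow> 'b measure \<Rightarrow> (real \<Rightarrow> 'b \<Rightarrow> real) \<Rightarrow> bool" where
  "iterated_fdd_limit M X M' Y \<longleftrightarrow>
     (\<exists>L :: nat \<Rightarrow> (real \<Rightarrow> real) measure.
        (\<forall>N. sets (L N) = sets (\<Pi>\<^sub>M t\<in>{0..}. borel)) \<and>
        (\<forall>N\<ge>2. fdd_limit (\<lambda>_. M) (\<lambda>n. X N n) (L N) (\<lambda>t w. w t)) \<and>
        fdd_limit L (\<lambda>_ t w. w t) M' Y)"

end

theory Submission
  imports Defs "HOL-Real_Asymp.Real_Asymp"
begin

text \<open>Conditionally on the thinning parameter \<open>a\<close>, the partial sums of the centred INAR(1) process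
satisfy a functional central limit theorem with long-run variance
\<open>\<sigma>\<^sup>2(a) = \<lambda> (1 + a) / (1 - a)\<^sup>2\<close>. Hence, for fixed \<open>N\<close>, the inner limit is a Brownian motion with the
random, independent variance \<open>\<Sum>\<^bsub>j\<le>N\<^esub> \<sigma>\<^sup>2(\<alpha>\<^sup>(\<^sup>j\<^sup>)) / (N log N)\<close>. For \<open>\<beta> = 1\<close> the density of \<open>\<alpha>\<close> is asymptotically
\<open>\<psi>\<^sub>1 (1 - x)\<close> at \<open>1\<close>, so \<open>\<sigma>\<^sup>2(\<alpha>)\<close> has the tail \<open>P(\<sigma>\<^sup>2(\<alpha>) > v) \<sim> \<lambda> \<psi>\<^sub>1 / v\<close>: its mean is infinite, but only
logarithmically so, and the weak law of large numbers with normalisation \<open>N log N\<close> turns the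
random variance into the constant \<open>\<lambda> \<psi>\<^sub>1\<close>.

Everything is proved with characteristic functions. Convergence of the finite-dimensional
distributions follows from convergence of the characteristic functions of all linear
combinations (\<open>fdd_limitI_char\<close>), and for a Wiener process these are \<open>exp (- Q(u) / 2)\<close> with the
quadratic form \<open>Q(u) = \<Sum>\<^bsub>s,t\<^esub> u\<^sub>s u\<^sub>t min s t\<close> (\<open>wiener_char\<close>).

For a deterministic parameter, both thinning and the Poisson innovations act on generating functions in
closed form, and a backward recursion gives the characteristic function of any linear
combination of \<open>X\<^sub>1, \<dots>, X\<^sub>n\<close> exactly (\<open>inar_char_function\<close>). Its logarithm is a sum whose second-order
expansion yields the central limit theorem (\<open>log_cf_limit\<close>) without any mixing or martingale argument.
A disintegration with respect to \<open>\<alpha>\<close> and dominated convergence carry this over to the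
randomized process (\<open>INAR_char_limit\<close>); the same disintegration identifies \<open>E(X\<^sub>k | \<alpha>)\<close> as \<open>\<lambda> / (1 - \<alpha>)\<close>,
which is integrable because \<open>\<psi>\<close> is.

Since the copies are independent, the characteristic function of the inner limit is the \<open>N\<close>-th
power of a Laplace transform, \<open>(E exp (- s\<^sub>N \<sigma>\<^sup>2(\<alpha>)))\<^sup>N\<close> with \<open>s\<^sub>N = Q(u) / (2 N log N)\<close>. The law of large numbers
thus reduces to the estimate \<open>1 - E exp (- s \<sigma>\<^sup>2(\<alpha>)) \<sim> \<lambda> \<psi>\<^sub>1 s log (1 / s)\<close> as \<open>s \<down> 0\<close> (\<open>laplace_asymp\<close>).\<close>

section \<open>Characteristic functions and finite-dimensional convergence\<close>

text \<open>Real trigonometric polynomials in the coordinates \<open>x t\<close>, \<open>t \<in> T\<close>. The frequencies are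
arbitrary, so that expectations of such functions are governed by characteristic functions.\<close>

inductive_set trig_poly :: "'i set \<Rightarrow> (('i \<Rightarrow> real) \<Rightarrow> real) set" for T :: "'i set" where
  cos: "(\<lambda>x. cos ((\<Sum>t\<in>T. u t * x t) + \<phi>)) \<in> trig_poly T"
| scale: "f \<in> trig_poly T \<Longrightarrow> (\<lambda>x. c * f x) \<in> trig_poly T"
| add: "f \<in> trig_poly T \<Longrightarrow> g \<in> trig_poly T \<Longrightarrow> (\<lambda>x. f x + g x) \<in> trig_poly T"

lemma trig_const: "(\<lambda>_. c) \<in> trig_poly T"
  using trig_poly.scale[OF trig_poly.cos[where u = "\<lambda>_. 0" and \<phi> = 0], of c] by simp

lemma trig_mult:
  assumes "f \<in> trig_poly T" "g \<in> trig_poly T"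
  shows "(\<lambda>x. f x * g x) \<in> trig_poly T"
  using assms(1)
proof induction
  case (cos u \<phi>)
  show ?case using assms(2)
  proof induction
    case (cos v \<theta>)
    have "(\<lambda>x. cos ((\<Sum>t\<in>T. u t * x t) + \<phi>) * cos ((\<Sum>t\<in>T. v t * x t) + \<theta>)) =
      (\<lambda>x. (1/2) * cos ((\<Sum>t\<in>T. (u t - v t) * x t) + (\<phi> - \<theta>))
         + (1/2) * cos ((\<Sum>t\<in>T. (u t + v t) * x t) + (\<phi> + \<theta>)))"
      by (simp add: fun_eq_iff cos_times_cos algebra_simps sum.distrib sum_subtractf add_divide_distrib)
    then show ?case by (simp only:) (intro trig_poly.intros)
  next
    case (scale g c)
    from trig_poly.scale[OF scale.IH, of c] show ?case by (simp add: mult.left_commute)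
  next
    case (add g h)
    from trig_poly.add[OF add.IH] show ?case by (simp add: distrib_left)
  qed
next
  case (scale f c)
  from trig_poly.scale[OF scale.IH, of c] show ?case by (simp add: mult.assoc)
next
  case (add f h)
  from trig_poly.add[OF add.IH] show ?case by (simp add: distrib_right)
qed

lemma trig_bounded: "f \<in> trig_poly T \<Longrightarrow> \<exists>B. \<forall>x. \<bar>f x\<bar> \<le> B"
proof (induction rule: trig_poly.induct)
  case (cos u \<phi>)
  then show ?case by (intro exI[of _ 1]) auto
next
  case (scale f c)
  then obtain B where "\<forall>x. \<bar>f x\<bar> \<le> B" by auto
  then show ?case by (intro exI[of _ "\<bar>c\<bar> * B"]) (auto simp: abs_mult intro: mult_left_mono)
next
  case (add f g)
  then obtain B C where B: "\<forall>x. \<bar>f x\<bar> \<le> B" and C: "\<forall>x. \<bar>g x\<bar> \<le> C" by auto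
  then have "\<bar>f x + g x\<bar> \<le> B + C" for x
    using B[rule_format, of x] C[rule_format, of x] by linarith
  then show ?case by blast
qed

lemma trig_measurable:
  assumes "f \<in> trig_poly T" "\<And>t. t \<in> T \<Longrightarrow> X t \<in> borel_measurable M"
  shows "(\<lambda>\<omega>. f (\<lambda>t. X t \<omega>)) \<in> borel_measurable M"
  using assms by (induction rule: trig_poly.induct) auto

lemma trig_sin:
  assumes "finite T" "t \<in> T"
  shows "(\<lambda>x. sin (x t / L)) \<in> trig_poly T"
proof -
  have "(\<Sum>s\<in>T. (if s = t then 1 / L else 0) * x s) = x t / L" for x :: "'a \<Rightarrow> real"
    using assms by (simp add: if_distrib[of "\<lambda>c. c * _"] cong: if_cong)
  then have "(\<lambda>x. sin (x t / L)) = (\<lambda>x. cos ((\<Sum>s\<in>T. (if s = t then 1 / L else 0) * x s) + (- (pi / 2))))"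
    by (simp add: fun_eq_iff cos_diff)
  then show ?thesis by (simp only: trig_poly.cos)
qed

text \<open>Outside \<open>T\<close> all members of the cube take the value \<open>undefined\<close>, so the cube is a full product of
compact sets and Tychonoff's theorem applies.\<close>

lemma compact_PiE_real:
  fixes T :: "'i set"
  assumes "compact K"
  shows "compact (\<Pi>\<^sub>E t\<in>T. K :: real set)"
proof -
  have eq: "(\<Pi>\<^sub>E t\<in>T. K) = (\<Pi>\<^sub>E t\<in>UNIV. if t \<in> T then K else {undefined})"
    by (auto simp: PiE_def Pi_def extensional_def split: if_splits)
  have "compactin (product_topology (\<lambda>_. euclideanreal) UNIV) (\<Pi>\<^sub>E t\<in>UNIV. if t \<in> T then K else {undefined})"
    using assms by (auto simp: compactin_PiE)
  then show ?thesis
    unfolding eq by (metis compactin_euclidean_iff euclidean_product_topology)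
qed

text \<open>An approximation that is uniform on a large cube and, simultaneously, bounded everywhere; the
latter is what makes it usable under an integral. With \<open>y t = sin (x t / L)\<close> the function
\<open>f (L arcsin y)\<close> is continuous on the cube \<open>[-1,1]\<^sup>T\<close> and agrees with \<open>f x\<close> as long as
\<open>\<bar>x t\<bar> \<le> L \<pi> / 2\<close>. By Stone-Weierstrass it is uniformly close to a function in the algebra
generated by the coordinates, and such a function of \<open>sin (x t / L)\<close> is a trigonometric polynomial.\<close>

lemma trig_approximation:
  fixes f :: "('i \<Rightarrow> real) \<Rightarrow> real"
  assumes T: "finite T"
    and f: "continuous_map (product_topology (\<lambda>_. euclideanreal) T) euclideanreal f"
    and B: "\<And>x. x \<in> (\<Pi>\<^sub>E t\<in>T. UNIV) \<Longrightarrow> \<bar>f x\<bar> \<le> B"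
    and L: "0 < L" and e: "0 < e"
  obtains g where "g \<in> trig_poly T" "\<And>x. \<bar>g x\<bar> \<le> B + e"
    "\<And>x. (\<And>t. t \<in> T \<Longrightarrow> \<bar>x t\<bar> \<le> L * (pi / 2)) \<Longrightarrow> \<bar>f (restrict x T) - g x\<bar> \<le> e"
proof -
  \<comment> \<open>Stone-Weierstrass needs a Hausdorff space; functions on \<open>nat\<close> form a metric space, so the
     finitely many coordinates are renumbered by natural numbers.\<close>
  obtain c :: "'i \<Rightarrow> nat" where c: "inj_on c T"
    using countableE[OF countable_finite[OF T]] .
  define d where "d = inv_into T c"
  have cd: "d (c t) = t" if "t \<in> T" for t using that c by (simp add: d_def)
  let ?S = "\<Pi>\<^sub>E i\<in>c ` T. {-1..1::real}"
  define s where "s x = (\<lambda>i\<in>c ` T. sin (x (d i) / L))" for x :: "'i \<Rightarrow> real"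
  define R where "R = {p. continuous_on ?S p \<and> (\<lambda>x. p (s x)) \<in> trig_poly T}"
  define F where "F y = f (\<lambda>t\<in>T. L * arcsin (y (c t)))" for y
  have "function_ring_on R ?S"
  proof
    show "compact ?S" by (rule compact_PiE_real) simp
  next
    fix x y assume xy: "x \<in> ?S" "y \<in> ?S" "x \<noteq> y"
    obtain t where t: "t \<in> T" "x (c t) \<noteq> y (c t)"
      using xy PiE_ext[OF xy(1,2)] by blast
    have "(\<lambda>y. y (c t)) \<in> R"
      using t trig_sin[OF T, of t L] cd by (auto simp: R_def s_def intro: continuous_on_product_coordinates continuous_on_subset)
    then show "\<exists>f\<in>R. f x \<noteq> f y" using t by (intro bexI[of _ "\<lambda>y. y (c t)"]) auto
  qed (auto simp: R_def intro: continuous_intros trig_poly.intros trig_mult trig_const)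
  then interpret function_ring_on R ?S .
  have "continuous_on ?S F"
  proof -
    have "continuous_map (top_of_set ?S) (product_topology (\<lambda>_. euclideanreal) T) (\<lambda>y. \<lambda>t\<in>T. L * arcsin (y (c t)))"
    proof (subst continuous_map_componentwise, safe)
      fix t assume t: "t \<in> T"
      have "continuous_on ?S (\<lambda>y. L * arcsin (y (c t)))"
        using t by (intro continuous_intros continuous_on_subset[OF continuous_on_product_coordinates]) auto
      then show "continuous_map (top_of_set ?S) euclideanreal (\<lambda>y. (\<lambda>t\<in>T. L * arcsin (y (c t))) t)"
        using t by simp
    qed auto
    from continuous_map_compose[OF this f] show ?thesis
      by (simp add: o_def F_def[abs_def])
  qed
  from Stone_Weierstrass_basic[OF this e] obtain p where
    p: "p \<in> R" "\<And>y. y \<in> ?S \<Longrightarrow> \<bar>F y - p y\<bar> < e" by auto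
  have s: "s x \<in> ?S" for x by (auto simp: s_def)
  have 1: "\<bar>p (s x)\<bar> \<le> B + e" for x
    using p(2)[OF s[of x]] B[of "\<lambda>t\<in>T. L * arcsin (s x (c t))"] by (auto simp: F_def abs_if split: if_splits)
  have 2: "\<bar>f (restrict x T) - p (s x)\<bar> \<le> e" if x: "\<And>t. t \<in> T \<Longrightarrow> \<bar>x t\<bar> \<le> L * (pi / 2)" for x
  proof -
    have "L * arcsin (s x (c t)) = x t" if "t \<in> T" for t
    proof -
      have "\<bar>x t / L\<bar> \<le> pi / 2"
        using x[OF that] L by (simp add: field_simps)
      then have "arcsin (sin (x t / L)) = x t / L" by (intro arcsin_sin) (auto simp: abs_if split: if_splits)
      then show ?thesis using that L cd by (simp add: s_def)
    qed
    then have "F (s x) = f (restrict x T)" unfolding F_def by (intro arg_cong[of _ _ f]) (auto simp: restrict_def)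
    with p(2)[OF s[of x]] show ?thesis by simp
  qed
  show thesis
    by (rule that[of "\<lambda>x. p (s x)"]) (use p(1) 1 2 in \<open>auto simp: R_def\<close>)
qed

text \<open>Trigonometric polynomials of the process are measurable, and \<open>f\<close> is their pointwise limit along
growing cubes. This avoids comparing the Borel sets of the product topology with the product
\<open>\<sigma>\<close>-algebra.\<close>

lemma continuous_map_process_measurable:
  fixes f :: "('i \<Rightarrow> real) \<Rightarrow> real"
  assumes T: "finite T"
    and f: "continuous_map (product_topology (\<lambda>_. euclideanreal) T) euclideanreal f"
    and B: "\<And>x. x \<in> (\<Pi>\<^sub>E t\<in>T. UNIV) \<Longrightarrow> \<bar>f x\<bar> \<le> B"
    and X: "\<And>t. t \<in> T \<Longrightarrow> X t \<in> borel_measurable M"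
  shows "(\<lambda>\<omega>. f (\<lambda>t\<in>T. X t \<omega>)) \<in> borel_measurable M"
proof -
  have "\<exists>g. g \<in> trig_poly T \<and> (\<forall>x. (\<forall>t\<in>T. \<bar>x t\<bar> \<le> real (Suc k) * (pi/2)) \<longrightarrow> \<bar>f (restrict x T) - g x\<bar> \<le> 1 / real (Suc k))" for k
    using trig_approximation[OF T f B, of "real (Suc k)" "1 / real (Suc k)"] by (metis of_nat_0_less_iff zero_less_Suc zero_less_divide_1_iff)
  then obtain g where g: "\<And>k. g k \<in> trig_poly T"
    "\<And>k x. (\<And>t. t \<in> T \<Longrightarrow> \<bar>x t\<bar> \<le> real (Suc k) * (pi/2)) \<Longrightarrow> \<bar>f (restrict x T) - g k x\<bar> \<le> 1 / real (Suc k)"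
    by metis
  show ?thesis
  proof (rule borel_measurable_LIMSEQ_real)
    show "(\<lambda>\<omega>. g k (\<lambda>t. X t \<omega>)) \<in> borel_measurable M" for k
      by (rule trig_measurable[OF g(1) X])
    fix \<omega>
    have "\<forall>\<^sub>F k in sequentially. \<bar>X t \<omega>\<bar> \<le> real (Suc k) * (pi/2)" for t
      by real_asymp
    then have "\<forall>\<^sub>F k in sequentially. \<forall>t\<in>T. \<bar>X t \<omega>\<bar> \<le> real (Suc k) * (pi/2)"
      using T by (simp add: eventually_ball_finite_distrib)
    then have "\<forall>\<^sub>F k in sequentially. norm (g k (\<lambda>t. X t \<omega>) - f (\<lambda>t\<in>T. X t \<omega>)) \<le> 1 / real (Suc k)"
      by eventually_elim (subst real_norm_def, subst abs_minus_commute, rule g(2), auto)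
    moreover have "(\<lambda>k. 1 / real (Suc k)) \<longlonglongrightarrow> 0" by real_asymp
    ultimately show "(\<lambda>k. g k (\<lambda>t. X t \<omega>)) \<longlonglongrightarrow> f (\<lambda>t\<in>T. X t \<omega>)"
      by - (rule LIM_zero_cancel, rule Lim_null_comparison)
  qed
qed


lemma integral_cos_eq_Re_iexp:
  fixes Z :: "'i \<Rightarrow> 'a \<Rightarrow> real"
  assumes N: "prob_space N" and Z: "\<And>t. t \<in> T \<Longrightarrow> Z t \<in> borel_measurable N"
  shows "(\<integral>\<omega>. cos ((\<Sum>t\<in>T. u t * Z t \<omega>) + \<phi>) \<partial>N) = Re (iexp \<phi> * (\<integral>\<omega>. iexp (\<Sum>t\<in>T. u t * Z t \<omega>) \<partial>N))"
proof -
  interpret N: prob_space N by fact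
  have [measurable]: "(\<lambda>\<omega>. \<Sum>t\<in>T. u t * Z t \<omega>) \<in> borel_measurable N" using Z by measurable
  have int: "integrable N (\<lambda>\<omega>. iexp (\<Sum>t\<in>T. u t * Z t \<omega>))"
    by (rule N.integrable_const_bound[where B=1], simp del: of_real_sum) measurable
  have "(\<integral>\<omega>. cos ((\<Sum>t\<in>T. u t * Z t \<omega>) + \<phi>) \<partial>N) = (\<integral>\<omega>. Re (iexp \<phi> * iexp (\<Sum>t\<in>T. u t * Z t \<omega>)) \<partial>N)"
    by (intro Bochner_Integration.integral_cong refl) (simp add: cis_conv_exp[symmetric] cos_add algebra_simps del: of_real_sum of_real_mult)
  also have "\<dots> = Re (\<integral>\<omega>. iexp \<phi> * iexp (\<Sum>t\<in>T. u t * Z t \<omega>) \<partial>N)"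
    using int by (intro integral_Re) simp
  finally show ?thesis by simp
qed

lemma trig_integral_tendsto:
  fixes X :: "nat \<Rightarrow> 'i \<Rightarrow> 'a \<Rightarrow> real" and Y :: "'i \<Rightarrow> 'b \<Rightarrow> real"
  assumes M: "\<And>n. prob_space (M n)" "prob_space M'"
    and X: "\<And>n t. t \<in> T \<Longrightarrow> X n t \<in> borel_measurable (M n)"
    and Y: "\<And>t. t \<in> T \<Longrightarrow> Y t \<in> borel_measurable M'"
    and cf: "\<And>u. (\<lambda>n. \<integral>\<omega>. iexp (\<Sum>t\<in>T. u t * X n t \<omega>) \<partial>M n) \<longlonglongrightarrow> (\<integral>\<omega>. iexp (\<Sum>t\<in>T. u t * Y t \<omega>) \<partial>M')"
    and g: "g \<in> trig_poly T"
  shows "(\<lambda>n. \<integral>\<omega>. g (\<lambda>t. X n t \<omega>) \<partial>M n) \<longlonglongrightarrow> (\<integral>\<omega>. g (\<lambda>t. Y t \<omega>) \<partial>M')"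
proof -
  interpret M: prob_space "M n" for n by (rule M)
  interpret M': prob_space M' by (rule M)
  have intX: "integrable (M n) (\<lambda>\<omega>. h (\<lambda>t. X n t \<omega>))" and intY: "integrable M' (\<lambda>\<omega>. h (\<lambda>t. Y t \<omega>))"
    if h: "h \<in> trig_poly T" for h n
  proof -
    obtain B where "\<And>x. \<bar>h x\<bar> \<le> B" using trig_bounded[OF h] by blast
    then show "integrable (M n) (\<lambda>\<omega>. h (\<lambda>t. X n t \<omega>))" "integrable M' (\<lambda>\<omega>. h (\<lambda>t. Y t \<omega>))"
      using trig_measurable[OF h X] trig_measurable[OF h Y]
      by (auto intro!: M.integrable_const_bound[where B=B] M'.integrable_const_bound[where B=B])
  qed
  from g show ?thesis
  proof induction
    case (cos u \<phi>)
    have "(\<integral>\<omega>. cos ((\<Sum>t\<in>T. u t * X n t \<omega>) + \<phi>) \<partial>M n) = Re (iexp \<phi> * (\<integral>\<omega>. iexp (\<Sum>t\<in>T. u t * X n t \<omega>) \<partial>M n))" for n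
      by (rule integral_cos_eq_Re_iexp[OF M(1) X])
    moreover have "(\<integral>\<omega>. cos ((\<Sum>t\<in>T. u t * Y t \<omega>) + \<phi>) \<partial>M') = Re (iexp \<phi> * (\<integral>\<omega>. iexp (\<Sum>t\<in>T. u t * Y t \<omega>) \<partial>M'))"
      by (rule integral_cos_eq_Re_iexp[OF M(2) Y])
    ultimately show ?case
      using tendsto_Re[OF tendsto_mult[OF tendsto_const cf], of "iexp \<phi>" u] by simp
  next
    case (scale g c)
    then show ?case by (simp add: tendsto_mult_left)
  next
    case (add g h)
    then show ?case by (simp add: intX intY tendsto_add)
  qed
qed

text \<open>The one-dimensional Levy continuity theorem, for random variables on varying probability spaces.\<close>

lemma bounded_continuous_integral_tendsto:
  fixes X :: "nat \<Rightarrow> 'a \<Rightarrow> real" and Y :: "'b \<Rightarrow> real" and h :: "real \<Rightarrow> real"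
  assumes M: "\<And>n. prob_space (M n)" "prob_space M'"
    and X: "\<And>n. X n \<in> borel_measurable (M n)" and Y: "Y \<in> borel_measurable M'"
    and cf: "\<And>u. (\<lambda>n. \<integral>\<omega>. iexp (u * X n \<omega>) \<partial>M n) \<longlonglongrightarrow> (\<integral>\<omega>. iexp (u * Y \<omega>) \<partial>M')"
    and h: "\<And>x. isCont h x" "\<And>x. \<bar>h x\<bar> \<le> B"
  shows "(\<lambda>n. \<integral>\<omega>. h (X n \<omega>) \<partial>M n) \<longlonglongrightarrow> (\<integral>\<omega>. h (Y \<omega>) \<partial>M')"
proof -
  have [measurable]: "h \<in> borel_measurable borel"
    using h by (intro borel_measurable_continuous_onI continuous_at_imp_continuous_on) auto
  have rd: "\<And>n. real_distribution (distr (M n) borel (X n))" "real_distribution (distr M' borel Y)"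
    by (simp_all add: prob_space.real_distribution_distr M X Y)
  have "weak_conv_m (\<lambda>n. distr (M n) borel (X n)) (distr M' borel Y)"
    by (intro levy_continuity rd) (use cf in \<open>simp add: char_def integral_distr X Y\<close>)
  from weak_conv_imp_integral_bdd_continuous_conv[OF rd this, of h B]
  show ?thesis using h by (simp add: integral_distr X Y)
qed

text \<open>Here \<open>h\<close> is a smoothed indicator of the complement of an interval, so the sum over \<open>T\<close> bounds
the probability of leaving a cube.\<close>

lemma integral_diff_bound:
  fixes f g :: "('i \<Rightarrow> real) \<Rightarrow> real" and Z :: "'i \<Rightarrow> 'a \<Rightarrow> real"
  assumes N: "prob_space N"
    and T: "finite T"
    and f: "continuous_map (product_topology (\<lambda>_. euclideanreal) T) euclideanreal f"
    and B: "\<And>x. x \<in> (\<Pi>\<^sub>E t\<in>T. UNIV) \<Longrightarrow> \<bar>f x\<bar> \<le> B"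
    and g: "g \<in> trig_poly T" "\<And>x. \<bar>g x\<bar> \<le> B'"
    and h: "\<And>x. isCont h x" "\<And>x. 0 \<le> h x" "\<And>x. h x \<le> 1"
    and le: "\<And>x. \<bar>f (restrict x T) - g x\<bar> \<le> e + C * (\<Sum>t\<in>T. h (x t))"
    and Z: "\<And>t. t \<in> T \<Longrightarrow> Z t \<in> borel_measurable N"
  shows "\<bar>(\<integral>\<omega>. f (\<lambda>t\<in>T. Z t \<omega>) \<partial>N) - (\<integral>\<omega>. g (\<lambda>t. Z t \<omega>) \<partial>N)\<bar> \<le> e + C * (\<Sum>t\<in>T. \<integral>\<omega>. h (Z t \<omega>) \<partial>N)"
proof -
  interpret N: prob_space N by fact
  have [measurable]: "h \<in> borel_measurable borel"
    using h(1) by (intro borel_measurable_continuous_onI continuous_at_imp_continuous_on) auto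
  have 1: "integrable N (\<lambda>\<omega>. f (\<lambda>t\<in>T. Z t \<omega>))"
    using continuous_map_process_measurable[OF T f B Z] B
    by (intro N.integrable_const_bound[where B=B]) auto
  have 2: "integrable N (\<lambda>\<omega>. g (\<lambda>t. Z t \<omega>))"
    using trig_measurable[OF g(1) Z] g(2) by (intro N.integrable_const_bound[where B="B'"]) auto
  have 3: "integrable N (\<lambda>\<omega>. h (Z t \<omega>))" if "t \<in> T" for t
    using Z[OF that] h by (intro N.integrable_const_bound[where B=1]) auto
  have "\<bar>(\<integral>\<omega>. f (\<lambda>t\<in>T. Z t \<omega>) \<partial>N) - (\<integral>\<omega>. g (\<lambda>t. Z t \<omega>) \<partial>N)\<bar> = \<bar>\<integral>\<omega>. f (\<lambda>t\<in>T. Z t \<omega>) - g (\<lambda>t. Z t \<omega>) \<partial>N\<bar>"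
    using 1 2 by simp
  also have "\<dots> \<le> (\<integral>\<omega>. \<bar>f (\<lambda>t\<in>T. Z t \<omega>) - g (\<lambda>t. Z t \<omega>)\<bar> \<partial>N)"
    by (rule integral_abs_bound)
  also have "\<dots> \<le> (\<integral>\<omega>. e + C * (\<Sum>t\<in>T. h (Z t \<omega>)) \<partial>N)"
    using 1 2 3 le[of "\<lambda>t. Z t _"] by (intro integral_mono) auto
  also have "\<dots> = e + C * (\<Sum>t\<in>T. \<integral>\<omega>. h (Z t \<omega>) \<partial>N)"
    using 3 by (simp add: N.prob_space)
  finally show ?thesis .
qed

text \<open>The multidimensional Levy continuity theorem for a known limit law. Expectations of trigonometric
polynomials converge by assumption; a bounded continuous function differs from such a polynomial
by little on a large cube, and the mass outside the cube is controlled uniformly by the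
one-dimensional theorem applied to each coordinate.\<close>

lemma fdd_limitI_char:
  fixes X :: "nat \<Rightarrow> real \<Rightarrow> 'a \<Rightarrow> real" and Y :: "real \<Rightarrow> 'b \<Rightarrow> real"
  assumes X: "\<And>n. real_process (M n) (X n)" and Y: "real_process M' Y"
    and cf: "\<And>T u. finite T \<Longrightarrow> T \<subseteq> {0..} \<Longrightarrow>
      (\<lambda>n. \<integral>\<omega>. iexp (\<Sum>t\<in>T. u t * X n t \<omega>) \<partial>M n) \<longlonglongrightarrow> (\<integral>\<omega>. iexp (\<Sum>t\<in>T. u t * Y t \<omega>) \<partial>M')"
  shows "fdd_limit M X M' Y"
  unfolding fdd_limit_def
proof (intro conjI allI impI X Y)
  fix T :: "real set" and f :: "(real \<Rightarrow> real) \<Rightarrow> real"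
  assume T: "finite T" "T \<subseteq> {0..}"
    and f: "continuous_map (product_topology (\<lambda>_. euclideanreal) T) euclideanreal f"
    and bdd: "bounded (f ` (\<Pi>\<^sub>E t\<in>T. UNIV))"
  from bdd obtain B0 where "\<forall>x\<in>f ` (\<Pi>\<^sub>E t\<in>T. UNIV). norm x \<le> B0"
    unfolding bounded_iff by auto
  then have "\<And>x. x \<in> (\<Pi>\<^sub>E t\<in>T. UNIV) \<Longrightarrow> \<bar>f x\<bar> \<le> B0" by force
  then obtain B where B: "\<And>x. x \<in> (\<Pi>\<^sub>E t\<in>T. UNIV) \<Longrightarrow> \<bar>f x\<bar> \<le> B" and B0: "0 \<le> B"
    by (metis abs_ge_self abs_ge_zero order_trans)
  have PM: "\<And>n. prob_space (M n)" "prob_space M'" using X Y by (auto simp: real_process_def)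
  interpret M: prob_space "M n" for n by (rule PM)
  interpret M': prob_space M' by (rule PM)
  have mX: "\<And>n t. t \<in> T \<Longrightarrow> X n t \<in> borel_measurable (M n)" and mY: "\<And>t. t \<in> T \<Longrightarrow> Y t \<in> borel_measurable M'"
    using X Y T by (auto simp: real_process_def)
  define h where "h R x = max 0 (min 1 (\<bar>x\<bar> - R))" for R x :: real
  have h01: "0 \<le> h R x" "h R x \<le> 1" for R x by (auto simp: h_def)
  have h_cont: "isCont (h R) x" for R x unfolding h_def by (intro continuous_intros)
  have [measurable]: "h R \<in> borel_measurable borel" for R
    using h_cont by (intro borel_measurable_continuous_onI continuous_at_imp_continuous_on) auto
  have h_conv: "(\<lambda>n. \<integral>\<omega>. h R (X n t \<omega>) \<partial>M n) \<longlonglongrightarrow> (\<integral>\<omega>. h R (Y t \<omega>) \<partial>M')" if "t \<in> T" for t R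
  proof (rule bounded_continuous_integral_tendsto[OF PM mX[OF that] mY[OF that] _ h_cont])
    fix u :: real
    show "(\<lambda>n. \<integral>\<omega>. iexp (u * X n t \<omega>) \<partial>M n) \<longlonglongrightarrow> (\<integral>\<omega>. iexp (u * Y t \<omega>) \<partial>M')"
      using cf[of "{t}" "\<lambda>_. u"] that T by auto
    show "\<bar>h R x\<bar> \<le> 1" for x using h01[of R x] by simp
  qed
  have tail: "(\<lambda>k. \<Sum>t\<in>T. \<integral>\<omega>. h (real k) (Y t \<omega>) \<partial>M') \<longlonglongrightarrow> (\<Sum>t\<in>T. 0)"
  proof (rule tendsto_sum)
    fix t assume t: "t \<in> T"
    note [measurable] = mY[OF t]
    have "(\<lambda>k. \<integral>\<omega>. h (real k) (Y t \<omega>) \<partial>M') \<longlonglongrightarrow> (\<integral>\<omega>. 0 \<partial>M')"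
    proof (rule integral_dominated_convergence[where w="\<lambda>_. 1"])
      show "AE \<omega> in M'. (\<lambda>k. h (real k) (Y t \<omega>)) \<longlonglongrightarrow> 0"
      proof (rule AE_I2)
        fix \<omega>
        have "\<forall>\<^sub>F k in sequentially. \<bar>Y t \<omega>\<bar> \<le> real k" by real_asymp
        then have "\<forall>\<^sub>F k in sequentially. h (real k) (Y t \<omega>) = 0"
          by eventually_elim (auto simp: h_def)
        then show "(\<lambda>k. h (real k) (Y t \<omega>)) \<longlonglongrightarrow> 0" by (rule tendsto_eventually)
      qed
    qed (use h01 in auto)
    then show "(\<lambda>k. \<integral>\<omega>. h (real k) (Y t \<omega>) \<partial>M') \<longlonglongrightarrow> 0" by simp
  qed
  have fX: "(\<lambda>\<omega>. f (\<lambda>t\<in>T. X n t \<omega>)) \<in> borel_measurable (M n)" for n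
    by (rule continuous_map_process_measurable[OF T(1) f B mX])
  have fY: "(\<lambda>\<omega>. f (\<lambda>t\<in>T. Y t \<omega>)) \<in> borel_measurable M'"
    by (rule continuous_map_process_measurable[OF T(1) f B mY])
  show "(\<lambda>n. \<integral>\<omega>. f (\<lambda>t\<in>T. X n t \<omega>) \<partial>M n) \<longlonglongrightarrow> (\<integral>\<omega>. f (\<lambda>t\<in>T. Y t \<omega>) \<partial>M')"
  proof (rule tendstoI)
    fix \<epsilon> :: real assume eps: "0 < \<epsilon>"
    define e where "e = min 1 (\<epsilon> / 8)"
    have e: "0 < e" "e \<le> 1" "8 * e \<le> \<epsilon>" using eps by (auto simp: e_def)
    define C where "C = 2 * B + 1"
    have C: "0 < C" using B0 by (simp add: C_def)
    have "\<forall>\<^sub>F k in sequentially. (\<Sum>t\<in>T. \<integral>\<omega>. h (real k) (Y t \<omega>) \<partial>M') < e / C"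
      by (rule order_tendstoD(2)[OF tail]) (use e C in auto)
    then obtain k where k: "(\<Sum>t\<in>T. \<integral>\<omega>. h (real k) (Y t \<omega>) \<partial>M') < e / C"
      by (auto simp: eventually_sequentially)
    define L where "L = real (Suc k)"
    have L: "0 < L" "real k + 1 \<le> L * (pi / 2)"
      using mult_left_mono[of 1 "pi / 2" "real (Suc k)"] pi_ge_two by (auto simp: L_def)
    obtain g where g: "g \<in> trig_poly T" "\<And>x. \<bar>g x\<bar> \<le> B + e"
      "\<And>x. (\<And>t. t \<in> T \<Longrightarrow> \<bar>x t\<bar> \<le> L * (pi / 2)) \<Longrightarrow> \<bar>f (restrict x T) - g x\<bar> \<le> e"
      using trig_approximation[OF T(1) f B L(1) e(1)] by blast
    have le: "\<bar>f (restrict x T) - g x\<bar> \<le> e + C * (\<Sum>t\<in>T. h (real k) (x t))" for x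
    proof (cases "\<forall>t\<in>T. \<bar>x t\<bar> \<le> L * (pi / 2)")
      case True
      then have "\<bar>f (restrict x T) - g x\<bar> \<le> e" using g(3) by blast
      moreover have "0 \<le> C * (\<Sum>t\<in>T. h (real k) (x t))" using C h01 by (intro mult_nonneg_nonneg sum_nonneg) auto
      ultimately show ?thesis by linarith
    next
      case False
      then obtain t where t: "t \<in> T" "\<bar>x t\<bar> > L * (pi / 2)" by auto
      then have "1 = h (real k) (x t)" using L by (auto simp: h_def)
      also have "\<dots> \<le> (\<Sum>t\<in>T. h (real k) (x t))" by (rule member_le_sum) (use t T h01 in auto)
      finally have "C * 1 \<le> C * (\<Sum>t\<in>T. h (real k) (x t))" using C by (intro mult_left_mono) auto
      moreover have "\<bar>f (restrict x T)\<bar> \<le> B" by (rule B) auto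
      ultimately show ?thesis using g(2)[of x] e by (simp add: C_def)
    qed
    have dX: "\<bar>(\<integral>\<omega>. f (\<lambda>t\<in>T. X n t \<omega>) \<partial>M n) - (\<integral>\<omega>. g (\<lambda>t. X n t \<omega>) \<partial>M n)\<bar>
        \<le> e + C * (\<Sum>t\<in>T. \<integral>\<omega>. h (real k) (X n t \<omega>) \<partial>M n)" for n
      by (rule integral_diff_bound[OF PM(1) T(1) f B g(1,2) h_cont h01 le mX])
    have dY: "\<bar>(\<integral>\<omega>. f (\<lambda>t\<in>T. Y t \<omega>) \<partial>M') - (\<integral>\<omega>. g (\<lambda>t. Y t \<omega>) \<partial>M')\<bar>
        \<le> e + C * (\<Sum>t\<in>T. \<integral>\<omega>. h (real k) (Y t \<omega>) \<partial>M')"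
      by (rule integral_diff_bound[OF PM(2) T(1) f B g(1,2) h_cont h01 le mY])
    have "(\<lambda>n. \<integral>\<omega>. g (\<lambda>t. X n t \<omega>) \<partial>M n) \<longlonglongrightarrow> (\<integral>\<omega>. g (\<lambda>t. Y t \<omega>) \<partial>M')"
      by (rule trig_integral_tendsto[OF PM mX mY cf[OF T] g(1)])
    from tendstoD[OF this e(1)]
    have ev1: "\<forall>\<^sub>F n in sequentially. \<bar>(\<integral>\<omega>. g (\<lambda>t. X n t \<omega>) \<partial>M n) - (\<integral>\<omega>. g (\<lambda>t. Y t \<omega>) \<partial>M')\<bar> < e"
      by (simp add: dist_real_def)
    have "(\<lambda>n. \<Sum>t\<in>T. \<integral>\<omega>. h (real k) (X n t \<omega>) \<partial>M n) \<longlonglongrightarrow> (\<Sum>t\<in>T. \<integral>\<omega>. h (real k) (Y t \<omega>) \<partial>M')"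
      by (intro tendsto_sum h_conv)
    from order_tendstoD(2)[OF this k]
    have ev2: "\<forall>\<^sub>F n in sequentially. (\<Sum>t\<in>T. \<integral>\<omega>. h (real k) (X n t \<omega>) \<partial>M n) < e / C" .
    from ev1 ev2 show "\<forall>\<^sub>F n in sequentially. dist (\<integral>\<omega>. f (\<lambda>t\<in>T. X n t \<omega>) \<partial>M n) (\<integral>\<omega>. f (\<lambda>t\<in>T. Y t \<omega>) \<partial>M') < \<epsilon>"
    proof eventually_elim
      case (elim n)
      have "C * (\<Sum>t\<in>T. \<integral>\<omega>. h (real k) (X n t \<omega>) \<partial>M n) < e" "C * (\<Sum>t\<in>T. \<integral>\<omega>. h (real k) (Y t \<omega>) \<partial>M') < e"
        using elim(2) k C by (simp_all add: field_simps)
      then show ?case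
        using dX[of n] dY elim(1) e unfolding dist_real_def by linarith
    qed
  qed
qed

section \<open>Joint characteristic functions of the Wiener process\<close>

text \<open>The quadratic form of the covariance \<open>min s t\<close> of Brownian motion.\<close>

definition quad_min :: "real set \<Rightarrow> (real \<Rightarrow> real) \<Rightarrow> real" where
  "quad_min T u = (\<Sum>s\<in>T. \<Sum>t\<in>T. u s * u t * min s t)"

lemma sum_lessThan_if_less:
  fixes f :: "nat \<Rightarrow> 'a::comm_monoid_add"
  shows "j \<le> m \<Longrightarrow> (\<Sum>i<m. if i < j then f i else 0) = (\<Sum>i<j. f i)"
  by (subst sum.inter_filter[symmetric]) (auto intro!: sum.cong)

text \<open>Both \<open>s j\<close> and \<open>min (s j) (s l)\<close> are sums of the same increments; exchanging the sums completes the
square for each increment.\<close>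

lemma quad_min_increments:
  fixes s :: "nat \<Rightarrow> real"
  assumes s: "s 0 = 0" "\<And>i j. i \<le> j \<Longrightarrow> j \<le> m \<Longrightarrow> s i \<le> s j" "inj_on s {..m}"
  shows "quad_min (s ` {..m}) u = (\<Sum>i<m. (\<Sum>j\<in>{i<..m}. u (s j))\<^sup>2 * (s (Suc i) - s i))"
proof -
  let ?\<Delta> = "\<lambda>i. s (Suc i) - s i"
  have tel: "s j = (\<Sum>i<j. ?\<Delta> i)" for j
    by (simp add: sum_lessThan_telescope s)
  have mn: "min (s j) (s l) = (\<Sum>i<m. of_bool (i < j) * of_bool (i < l) * ?\<Delta> i)" if "j \<le> m" "l \<le> m" for j l
  proof -
    have "min (s j) (s l) = s (min j l)"
      using s(2)[of j l] s(2)[of l j] that by (auto simp: min_def)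
    also have "\<dots> = (\<Sum>i<m. if i < min j l then ?\<Delta> i else 0)"
      using that tel[of "min j l"] sum_lessThan_if_less[of "min j l" m ?\<Delta>] by (simp del: min_less_iff_conj)
    also have "\<dots> = (\<Sum>i<m. of_bool (i < j) * of_bool (i < l) * ?\<Delta> i)"
      by (intro sum.cong) auto
    finally show ?thesis .
  qed
  have "quad_min (s ` {..m}) u = (\<Sum>j\<le>m. \<Sum>l\<le>m. u (s j) * u (s l) * min (s j) (s l))"
    unfolding quad_min_def using s(3) by (simp add: sum.reindex)
  also have "\<dots> = (\<Sum>j\<le>m. \<Sum>l\<le>m. \<Sum>i<m. (u (s j) * of_bool (i < j)) * (u (s l) * of_bool (i < l)) * ?\<Delta> i)"
    by (intro sum.cong refl, subst mn) (simp_all only: sum_distrib_left mult_ac atMost_iff)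
  also have "\<dots> = (\<Sum>j\<le>m. \<Sum>i<m. \<Sum>l\<le>m. (u (s j) * of_bool (i < j)) * (u (s l) * of_bool (i < l)) * ?\<Delta> i)"
    by (rule sum.cong[OF refl], rule sum.swap)
  also have "\<dots> = (\<Sum>i<m. \<Sum>j\<le>m. \<Sum>l\<le>m. (u (s j) * of_bool (i < j)) * (u (s l) * of_bool (i < l)) * ?\<Delta> i)"
    by (rule sum.swap)
  also have "\<dots> = (\<Sum>i<m. (\<Sum>j\<le>m. u (s j) * of_bool (i < j))\<^sup>2 * ?\<Delta> i)"
    by (rule sum.cong[OF refl], subst power2_eq_square, subst sum_product) (simp only: sum_distrib_right)
  also have "\<dots> = (\<Sum>i<m. (\<Sum>j\<in>{i<..m}. u (s j))\<^sup>2 * ?\<Delta> i)"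
  proof -
    have "(\<Sum>j\<le>m. u (s j) * of_bool (i < j)) = (\<Sum>j\<in>{i<..m}. u (s j))" for i
      by (rule sum.mono_neutral_cong_right) auto
    then show ?thesis by (simp only:)
  qed
  finally show ?thesis .
qed

lemma char_normal_increment:
  assumes M: "prob_space M" and D: "distributed M lborel X (\<lambda>x. ennreal (normal_density 0 \<sigma> x))" and \<sigma>: "0 < \<sigma>"
  shows "(\<integral>\<omega>. iexp (c * X \<omega>) \<partial>M) = complex_of_real (exp (- (c\<^sup>2 * \<sigma>\<^sup>2 / 2)))"
proof -
  interpret prob_space M by fact
  have X[measurable]: "X \<in> borel_measurable M" using distributed_measurable[OF D] by simp
  have "distributed M lborel (\<lambda>x. (X x - 0) / \<sigma>) (\<lambda>x. ennreal (std_normal_density x))"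
    using normal_standard_normal_convert[OF \<sigma>, of X 0] D by simp
  then have S: "distr M borel (\<lambda>x. X x / \<sigma>) = std_normal_distribution"
    by (auto simp: distributed_def cong: distr_cong)
  have "(\<integral>\<omega>. iexp (c * X \<omega>) \<partial>M) = (\<integral>\<omega>. iexp ((c * \<sigma>) * (X \<omega> / \<sigma>)) \<partial>M)"
    using \<sigma> by (intro Bochner_Integration.integral_cong refl) simp
  also have "\<dots> = char (distr M borel (\<lambda>x. X x / \<sigma>)) (c * \<sigma>)"
    by (simp add: char_def integral_distr del: of_real_mult)
  also have "\<dots> = complex_of_real (exp (- (c\<^sup>2 * \<sigma>\<^sup>2 / 2)))"
    unfolding S by (simp add: char_std_normal_distribution power_mult_distrib)
  finally show ?thesis .
qed

text \<open>A linear combination of values is a linear combination of the independent Gaussian increments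
between consecutive times, whose characteristic functions multiply.\<close>

lemma wiener_char:
  assumes B: "standard_wiener M B" and T: "finite T" "T \<subseteq> {0..}"
  shows "(\<integral>\<omega>. iexp (\<Sum>t\<in>T. u t * B t \<omega>) \<partial>M) = complex_of_real (exp (- quad_min T u / 2))"
proof -
  have PM: "prob_space M" and mB: "\<And>t. 0 \<le> t \<Longrightarrow> B t \<in> borel_measurable M"
    and B0: "AE \<omega> in M. B 0 \<omega> = 0"
    and inc: "\<And>s t. 0 \<le> s \<Longrightarrow> s < t \<Longrightarrow> distributed M lborel (\<lambda>\<omega>. B t \<omega> - B s \<omega>) (\<lambda>x. ennreal (normal_density 0 (sqrt (t - s)) x))"
    and ind: "\<And>(m :: nat) (s :: nat \<Rightarrow> real). 0 \<le> s 0 \<Longrightarrow> (\<forall>i<m. s i < s (Suc i)) \<Longrightarrow>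
        prob_space.indep_vars M (\<lambda>_. borel) (\<lambda>i \<omega>. B (s (Suc i)) \<omega> - B (s i) \<omega>) {..<m}"
    using B unfolding standard_wiener_def real_process_def by auto
  interpret prob_space M by fact
  \<comment> \<open>With time \<open>0\<close> included, every value \<open>B t\<close> is a sum of increments.\<close>
  define T' where "T' = insert 0 T"
  define v where "v t = (if t \<in> T then u t else 0)" for t
  define m where "m = card T' - 1"
  have T': "finite T'" "0 \<in> T'" "T' \<subseteq> {0..}" using T by (auto simp: T'_def)
  then have cm: "card T' = Suc m" unfolding m_def by (metis Suc_pred' card_gt_0_iff empty_iff)
  define s where "s i = sorted_list_of_set T' ! i" for i
  have sT: "s ` {..m} = T'"
  proof -
    have "T' = set (sorted_list_of_set T')" using T' by simp
    also have "\<dots> = s ` {..<card T'}" unfolding set_conv_nth s_def by auto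
    finally show ?thesis unfolding cm lessThan_Suc_atMost by simp
  qed
  have smono: "s i < s j" if "i < j" "j \<le> m" for i j
    unfolding s_def using that cm T'
    by (intro sorted_wrt_nth_less[OF strict_sorted_list_of_set]) auto
  have sle: "s i \<le> s j" if "i \<le> j" "j \<le> m" for i j
    using smono[of i j] that by (cases "i = j") auto
  have sinj: "inj_on s {..m}"
    by (rule linorder_inj_onI) (use smono in \<open>force+\<close>)
  have s0: "s 0 = 0"
  proof -
    obtain j where j: "j \<le> m" "s j = 0" using sT T'(2) by (metis atMost_iff imageE)
    have "s 0 \<in> T'" using sT by blast
    then have "0 \<le> s 0" using T'(3) by auto
    then show ?thesis using sle[of 0 j] j by auto
  qed
  define U where "U i = (\<Sum>j\<in>{i<..m}. v (s j))" for i
  \<comment> \<open>The coefficient of an increment collects all later times.\<close>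
  have sum_eq: "(\<Sum>t\<in>T. u t * B t \<omega>) = (\<Sum>i<m. U i * (B (s (Suc i)) \<omega> - B (s i) \<omega>))" if "B 0 \<omega> = 0" for \<omega>
  proof -
    have tel: "B (s j) \<omega> = (\<Sum>i<m. if i < j then B (s (Suc i)) \<omega> - B (s i) \<omega> else 0)" if "j \<le> m" for j
    proof -
      have "B (s j) \<omega> = (\<Sum>i<j. B (s (Suc i)) \<omega> - B (s i) \<omega>)"
        using \<open>B 0 \<omega> = 0\<close> by (subst sum_lessThan_telescope) (simp add: s0)
      also have "\<dots> = (\<Sum>i<m. if i < j then B (s (Suc i)) \<omega> - B (s i) \<omega> else 0)"
        using that by (simp add: sum_lessThan_if_less)
      finally show ?thesis .
    qed
    have "(\<Sum>t\<in>T. u t * B t \<omega>) = (\<Sum>t\<in>T'. v t * B t \<omega>)"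
      using T unfolding T'_def by (intro sum.mono_neutral_cong_left) (auto simp: v_def)
    also have "\<dots> = (\<Sum>j\<le>m. v (s j) * B (s j) \<omega>)"
      unfolding sT[symmetric] using sinj by (simp add: sum.reindex)
    also have "\<dots> = (\<Sum>j\<le>m. \<Sum>i<m. (if i < j then v (s j) * (B (s (Suc i)) \<omega> - B (s i) \<omega>) else 0))"
      by (intro sum.cong refl, subst tel) (auto simp: sum_distrib_left intro!: sum.cong)
    also have "\<dots> = (\<Sum>i<m. \<Sum>j\<le>m. (if i < j then v (s j) * (B (s (Suc i)) \<omega> - B (s i) \<omega>) else 0))"
      by (rule sum.swap)
    also have "\<dots> = (\<Sum>i<m. \<Sum>j\<in>{i<..m}. v (s j) * (B (s (Suc i)) \<omega> - B (s i) \<omega>))"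
      by (intro sum.cong refl sum.mono_neutral_cong_right) auto
    also have "\<dots> = (\<Sum>i<m. U i * (B (s (Suc i)) \<omega> - B (s i) \<omega>))"
      by (simp add: U_def sum_distrib_right)
    finally show ?thesis .
  qed
  have s_nn: "0 \<le> s i" if "i \<le> m" for i using sle[of 0 i] that s0 by simp
  have mBs: "B (s i) \<in> borel_measurable M" if "i \<le> m" for i using mB s_nn that by blast
  let ?D = "\<lambda>i \<omega>. B (s (Suc i)) \<omega> - B (s i) \<omega>"
  have "(\<integral>\<omega>. iexp (\<Sum>t\<in>T. u t * B t \<omega>) \<partial>M) = (\<integral>\<omega>. (\<Prod>i<m. iexp (U i * ?D i \<omega>)) \<partial>M)"
  proof (rule integral_cong_AE)
    show "(\<lambda>\<omega>. iexp (\<Sum>t\<in>T. u t * B t \<omega>)) \<in> borel_measurable M"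
    proof -
      have [measurable]: "(\<lambda>\<omega>. \<Sum>t\<in>T. u t * B t \<omega>) \<in> borel_measurable M"
        using mB T by (intro borel_measurable_sum borel_measurable_times) auto
      show ?thesis by measurable
    qed
    show "(\<lambda>\<omega>. \<Prod>i<m. iexp (U i * ?D i \<omega>)) \<in> borel_measurable M"
    proof (rule borel_measurable_prod)
      fix i assume "i \<in> {..<m}"
      then have [measurable]: "B (s i) \<in> borel_measurable M" "B (s (Suc i)) \<in> borel_measurable M"
        using mBs by auto
      show "(\<lambda>\<omega>. iexp (U i * ?D i \<omega>)) \<in> borel_measurable M" by measurable
    qed
    show "AE \<omega> in M. iexp (\<Sum>t\<in>T. u t * B t \<omega>) = (\<Prod>i<m. iexp (U i * ?D i \<omega>))"
      using B0 by eventually_elim (simp add: sum_eq sum_distrib_left exp_sum del: of_real_mult)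
  qed
  also have "\<dots> = (\<Prod>i<m. \<integral>\<omega>. iexp (U i * ?D i \<omega>) \<partial>M)"
  proof (rule indep_vars_lebesgue_integral)
    have "indep_vars (\<lambda>_. borel) ?D {..<m}" by (rule ind) (use s0 smono in auto)
    then show "indep_vars (\<lambda>_. borel) (\<lambda>i \<omega>. iexp (U i * ?D i \<omega>)) {..<m}"
      by (rule indep_vars_compose2) measurable
    show "integrable M (\<lambda>\<omega>. iexp (U i * ?D i \<omega>))" if "i \<in> {..<m}" for i
      using mBs[of i] mBs[of "Suc i"] that by (intro integrable_const_bound[where B=1]) auto
  qed simp
  also have "\<dots> = (\<Prod>i<m. complex_of_real (exp (- ((U i)\<^sup>2 * (s (Suc i) - s i) / 2))))"
  proof (rule prod.cong)
    fix i assume i: "i \<in> {..<m}"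
    then have lt: "s i < s (Suc i)" "0 \<le> s i" using smono s_nn by auto
    show "(\<integral>\<omega>. iexp (U i * ?D i \<omega>) \<partial>M) = complex_of_real (exp (- ((U i)\<^sup>2 * (s (Suc i) - s i) / 2)))"
      using char_normal_increment[OF PM inc[OF lt(2,1)], of "U i"] lt by simp
  qed simp
  also have "\<dots> = complex_of_real (exp (- (\<Sum>i<m. (U i)\<^sup>2 * (s (Suc i) - s i)) / 2))"
    by (simp add: exp_sum sum_divide_distrib flip: of_real_prod sum_negf)
  also have "(\<Sum>i<m. (U i)\<^sup>2 * (s (Suc i) - s i)) = quad_min T' v"
    unfolding U_def sT[symmetric] by (rule quad_min_increments[OF s0 sle sinj, symmetric])
  also have "quad_min T' v = quad_min T u"
    using T unfolding quad_min_def T'_def v_def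
    by (intro sum.mono_neutral_cong_right) (auto intro!: sum.mono_neutral_cong_right sum.neutral)
  finally show ?thesis .
qed

section \<open>Characteristic exponent of INAR(1) partial sums\<close>

text \<open>If individual survival has probability \<open>a\<close> and time runs backwards through the weights \<open>w\<close>, then
\<open>1 + cf_rec a w m\<close> is the expected value of \<open>exp (\<i> \<cdot> (weights collected))\<close> over the life of a single
individual present with \<open>m\<close> time steps left. Subtracting \<open>1\<close> makes the recursion start at \<open>0\<close> and keeps
the quantity small.\<close>

primrec cf_rec :: "real \<Rightarrow> (nat \<Rightarrow> real) \<Rightarrow> nat \<Rightarrow> complex" where
  "cf_rec a w 0 = 0"
| "cf_rec a w (Suc m) = iexp (w m) * (1 + a * cf_rec a w m) - 1"

text \<open>The first-order part of \<open>cf_rec\<close>: the mean weight collected by an individual.\<close>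

primrec lin_rec :: "real \<Rightarrow> (nat \<Rightarrow> real) \<Rightarrow> nat \<Rightarrow> real" where
  "lin_rec a w 0 = 0"
| "lin_rec a w (Suc m) = w m + a * lin_rec a w m"

text \<open>Up to the factor \<open>\<lambda> / (1 - a)\<close>, this is the logarithm of the characteristic function of the centred linear
combination of \<open>X\<^sub>1, \<dots>, X\<^sub>L\<close> with weights \<open>w (L - k)\<close>.\<close>

definition log_cf :: "real \<Rightarrow> (nat \<Rightarrow> real) \<Rightarrow> nat \<Rightarrow> complex" where
  "log_cf a w L = (\<Sum>m<L. (iexp (w m) - 1) * (1 + a * cf_rec a w m) - \<i> * w m)"

text \<open>\<open>1 + a z\<close> is a convex combination of \<open>1\<close> and \<open>1 + z\<close>.\<close>

lemma norm_one_plus_thinned_le_1: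
  fixes z :: complex
  assumes "0 \<le> a" "a \<le> 1" "norm (1 + z) \<le> 1"
  shows "norm (1 + complex_of_real a * z) \<le> 1"
proof -
  have "1 + complex_of_real a * z = complex_of_real (1 - a) + complex_of_real a * (1 + z)"
    by (simp add: algebra_simps)
  also have "norm \<dots> \<le> (1 - a) + a * 1"
    using assms by (intro norm_triangle_le add_mono) (auto simp: norm_mult intro: mult_left_le simp del: of_real_diff)
  finally show ?thesis by simp
qed

lemma norm_one_plus_cf_rec_le_1:
  assumes "0 \<le> a" "a \<le> 1"
  shows "norm (1 + cf_rec a w m) \<le> 1"
proof (induction m)
  case (Suc m)
  then show ?case using norm_one_plus_thinned_le_1[OF assms Suc] by (simp add: norm_mult)
qed simp

lemma iexp_bounds:
  "norm (iexp x - 1) \<le> \<bar>x\<bar>" "norm (iexp x - 1 - \<i> * x) \<le> x\<^sup>2 / 2"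
  "norm (iexp x - 1 - \<i> * x + complex_of_real (x\<^sup>2 / 2)) \<le> \<bar>x\<bar> ^ 3 / 6"
proof -
  show "norm (iexp x - 1) \<le> \<bar>x\<bar>"
    using iexp_approx1[of x 0] by simp
  show "norm (iexp x - 1 - \<i> * x) \<le> x\<^sup>2 / 2"
    using iexp_approx1[of x 1] by (simp add: numeral_2_eq_2 algebra_simps)
  have "(\<Sum>k\<le>2. (\<i> * complex_of_real x) ^ k / fact k) = 1 + \<i> * x - x\<^sup>2 / 2"
    by (simp add: numeral_2_eq_2 power2_eq_square algebra_simps)
  then show "norm (iexp x - 1 - \<i> * x + complex_of_real (x\<^sup>2 / 2)) \<le> \<bar>x\<bar> ^ 3 / 6"
    using iexp_approx1[of x 2] by (simp add: algebra_simps eval_nat_numeral)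
qed

text \<open>For weights bounded by \<open>b\<close>, the recursions give \<open>cf_rec = O(b)\<close> and \<open>cf_rec = \<i> lin_rec + O(b\<^sup>2)\<close>, so
each summand of \<open>log_cf\<close> equals \<open>- w\<^sup>2 / 2 - a w \<cdot> lin_rec\<close> up to \<open>O(b\<^sup>3)\<close>. The identity
\<open>(1 - a) lin_rec m = w m - (lin_rec (m + 1) - lin_rec m)\<close> then separates the long-run variance from a
remainder made of increments, which telescope wherever the weights are constant.\<close>

lemma log_cf_expansion:
  assumes a: "0 < a" "a < 1" and b: "\<And>m. \<bar>w m\<bar> \<le> b"
  shows "norm (log_cf a w L - complex_of_real (- ((1 + a) / (1 - a)) * (\<Sum>m<L. (w m)\<^sup>2) / 2
      + a / (1 - a) * (\<Sum>m<L. w m * (lin_rec a w (Suc m) - lin_rec a w m))))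
    \<le> real L * (b ^ 3 * (3 / (1 - a)\<^sup>2))"
proof -
  let ?D = "cf_rec a w" and ?E = "lin_rec a w"
  have b0: "0 \<le> b" using b[of 0] by linarith
  have q: "0 < 1 - a" using a by simp
  have q1: "1 \<le> 1 / (1 - a)" using a by simp
  have D: "norm (?D m) \<le> b / (1 - a)" for m
  proof (induction m)
    case (Suc m)
    have "?D (Suc m) = (iexp (w m) - 1) * (1 + a * ?D m) + a * ?D m" by (simp add: algebra_simps)
    also have "norm \<dots> \<le> b * 1 + a * (b / (1 - a))"
    proof (intro norm_triangle_le add_mono)
      show "norm ((iexp (w m) - 1) * (1 + a * ?D m)) \<le> b * 1"
        unfolding norm_mult
        using a b0 order_trans[OF iexp_bounds(1) b] norm_one_plus_thinned_le_1[OF _ _ norm_one_plus_cf_rec_le_1]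
        by (intro mult_mono) auto
      show "norm (a * ?D m) \<le> a * (b / (1 - a))"
        using a Suc unfolding norm_mult by (intro mult_mono) auto
    qed
    also have "\<dots> = b / (1 - a)" using q by (simp add: field_simps)
    finally show ?case .
  qed (use b0 q in auto)
  have w2: "(w m)\<^sup>2 \<le> b\<^sup>2" for m using b by (simp add: abs_le_square_iff[symmetric] b0)
  have w3: "\<bar>w m\<bar> ^ 3 \<le> b ^ 3" for m using b by (intro power_mono) auto
  have DE: "norm (?D m - \<i> * ?E m) \<le> 2 * b\<^sup>2 / (1 - a)\<^sup>2" for m
  proof (induction m)
    case (Suc m)
    have "?D (Suc m) - \<i> * ?E (Suc m) = (iexp (w m) - 1 - \<i> * w m) + (a * ((iexp (w m) - 1) * ?D m) + a * (?D m - \<i> * ?E m))"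
      by (simp add: algebra_simps)
    also have "norm \<dots> \<le> b\<^sup>2 / 2 + (a * (b * (b / (1 - a))) + a * (2 * b\<^sup>2 / (1 - a)\<^sup>2))"
    proof (intro norm_triangle_le add_mono)
      show "norm (iexp (w m) - 1 - \<i> * w m) \<le> b\<^sup>2 / 2"
        using iexp_bounds(2)[of "w m"] w2[of m] by linarith
      show "norm (a * ((iexp (w m) - 1) * ?D m)) \<le> a * (b * (b / (1 - a)))"
        unfolding norm_mult using a b0 order_trans[OF iexp_bounds(1) b] D
        by (intro mult_mono) auto
      show "norm (a * (?D m - \<i> * ?E m)) \<le> a * (2 * b\<^sup>2 / (1 - a)\<^sup>2)"
        unfolding norm_mult using a Suc by (intro mult_mono) auto
    qed
    also have "\<dots> \<le> 2 * b\<^sup>2 / (1 - a)\<^sup>2"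
    proof -
      have "b\<^sup>2 * ((1 - a)\<^sup>2 + 2 * a * (1 - a) + 4 * a) \<le> b\<^sup>2 * 4"
        using mult_nonneg_nonneg[of "1 - a" "3 - a"] a by (intro mult_left_mono) (auto simp: power2_eq_square algebra_simps)
      then have "b\<^sup>2 * ((1 - a)\<^sup>2 + 2 * a * (1 - a) + 4 * a) / (2 * (1 - a)\<^sup>2) \<le> b\<^sup>2 * 4 / (2 * (1 - a)\<^sup>2)"
        by (intro divide_right_mono) auto
      moreover have "b\<^sup>2 / 2 + (a * (b * (b / x)) + a * (2 * b\<^sup>2 / x\<^sup>2)) = b\<^sup>2 * (x\<^sup>2 + 2 * a * x + 4 * a) / (2 * x\<^sup>2)" if "x \<noteq> 0" for x :: real
        using that by (simp add: field_simps power2_eq_square)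
      ultimately show ?thesis using q by simp
    qed
    finally show ?case .
  qed simp
  have lin: "w m * ?E m = ((w m)\<^sup>2 - w m * (?E (Suc m) - ?E m)) / (1 - a)" for m
    using q by (simp add: field_simps power2_eq_square)
  have "- ((1 + a) / (1 - a)) * (\<Sum>m<L. (w m)\<^sup>2) / 2 + a / (1 - a) * (\<Sum>m<L. w m * (?E (Suc m) - ?E m))
     = (\<Sum>m<L. - (w m)\<^sup>2 / 2 - a * (w m * ?E m))"
  proof -
    have "- (w m)\<^sup>2 / 2 - a * (w m * ?E m) = - ((1 + a) / (1 - a)) * (w m)\<^sup>2 / 2 + a / (1 - a) * (w m * (?E (Suc m) - ?E m))" for m
    proof -
      have "- X / 2 - a * ((X - d) / (1 - a)) = - ((1 + a) / (1 - a)) * X / 2 + a / (1 - a) * d" for X d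
      proof -
        have "- X / 2 - (1 - x) * ((X - d) / x) = - ((2 - x) / x) * X / 2 + (1 - x) / x * d" if "x \<noteq> 0" for x
          using that by (simp add: field_simps)
        from this[of "1 - a"] show ?thesis using q by simp
      qed
      then show ?thesis unfolding lin .
    qed
    then show ?thesis by (simp add: sum.distrib sum_distrib_left sum_divide_distrib sum_subtractf sum_negf del: lin_rec.simps)
  qed
  then have "log_cf a w L - complex_of_real (- ((1 + a) / (1 - a)) * (\<Sum>m<L. (w m)\<^sup>2) / 2
      + a / (1 - a) * (\<Sum>m<L. w m * (?E (Suc m) - ?E m)))
    = (\<Sum>m<L. ((iexp (w m) - 1) * (1 + a * ?D m) - \<i> * w m) - complex_of_real (- (w m)\<^sup>2 / 2 - a * (w m * ?E m)))"
    by (simp only: log_cf_def) (simp only: of_real_sum sum_subtractf[symmetric])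
  also have "norm \<dots> \<le> (\<Sum>m<L. b ^ 3 * (3 / (1 - a)\<^sup>2))"
  proof (rule sum_norm_le)
    fix m
    have "((iexp (w m) - 1) * (1 + a * ?D m) - \<i> * w m) - complex_of_real (- (w m)\<^sup>2 / 2 - a * (w m * ?E m))
      = (iexp (w m) - 1 - \<i> * w m + complex_of_real ((w m)\<^sup>2 / 2)) + (a * ((iexp (w m) - 1 - \<i> * w m) * ?D m) + a * (\<i> * w m * (?D m - \<i> * ?E m)))"
      by (simp add: algebra_simps)
    also have "norm \<dots> \<le> b ^ 3 / 6 + (1 * (b\<^sup>2 / 2 * (b / (1 - a))) + 1 * (b * (2 * b\<^sup>2 / (1 - a)\<^sup>2)))"
    proof (rule order_trans[OF norm_triangle_ineq add_mono[OF _ order_trans[OF norm_triangle_ineq add_mono]]])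
      show "norm (iexp (w m) - 1 - \<i> * w m + complex_of_real ((w m)\<^sup>2 / 2)) \<le> b ^ 3 / 6"
        using iexp_bounds(3)[of "w m"] w3[of m] by linarith
      show "norm (a * ((iexp (w m) - 1 - \<i> * w m) * ?D m)) \<le> 1 * (b\<^sup>2 / 2 * (b / (1 - a)))"
        unfolding norm_mult using a b0 order_trans[OF iexp_bounds(2)[of "w m"] divide_right_mono[OF w2]] D
        by (intro mult_mono) auto
      show "norm (a * (\<i> * w m * (?D m - \<i> * ?E m))) \<le> 1 * (b * (2 * b\<^sup>2 / (1 - a)\<^sup>2))"
        unfolding norm_mult using a b0 b DE
        by (intro mult_mono) auto
    qed
    also have "\<dots> = b ^ 3 * (1 / 6 + 1 / 2 * (1 / (1 - a)) + 2 * (1 / (1 - a))\<^sup>2)"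
      by (simp add: power2_eq_square power3_eq_cube algebra_simps)
    also have "\<dots> \<le> b ^ 3 * (3 * (1 / (1 - a))\<^sup>2)"
    proof (intro mult_left_mono)
      define x where "x = 1 / (1 - a)"
      have x: "1 \<le> x" using q1 by (simp add: x_def)
      then have "x \<le> x\<^sup>2" by (simp add: power2_eq_square)
      then show "1 / 6 + 1 / 2 * (1 / (1 - a)) + 2 * (1 / (1 - a))\<^sup>2 \<le> 3 * (1 / (1 - a))\<^sup>2"
        unfolding x_def[symmetric] using x by linarith
    qed (use b0 in auto)
    also have "\<dots> = b ^ 3 * (3 / (1 - a)\<^sup>2)" by (simp add: power_divide)
    finally show "norm (((iexp (w m) - 1) * (1 + a * ?D m) - \<i> * w m) - complex_of_real (- (w m)\<^sup>2 / 2 - a * (w m * ?E m)))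
      \<le> b ^ 3 * (3 / (1 - a)\<^sup>2)" .
  qed
  also have "\<dots> = real L * (b ^ 3 * (3 / (1 - a)\<^sup>2))" by simp
  finally show ?thesis .
qed

lemma lin_rec_bound:
  assumes a: "0 < a" "a < 1" and b: "\<And>m. \<bar>w m\<bar> \<le> b"
  shows "\<bar>lin_rec a w m\<bar> \<le> b / (1 - a)"
proof (induction m)
  case 0
  show ?case using b[of 0] a by auto
next
  case (Suc m)
  have "\<bar>lin_rec a w (Suc m)\<bar> \<le> \<bar>w m\<bar> + \<bar>a * lin_rec a w m\<bar>" by simp
  also have "\<dots> \<le> b + a * (b / (1 - a))"
    using a Suc b unfolding abs_mult by (intro add_mono mult_mono) auto
  also have "\<dots> = b / (1 - a)" using a by (simp add: field_simps)
  finally show ?case .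
qed

text \<open>The weight of \<open>X\<^sub>k\<close> in a linear combination, with coefficients \<open>u t\<close>, of the partial sums up to \<open>p t\<close>.\<close>

definition step_weight :: "real set \<Rightarrow> (real \<Rightarrow> real) \<Rightarrow> (real \<Rightarrow> nat) \<Rightarrow> nat \<Rightarrow> real" where
  "step_weight T u p k = (\<Sum>t\<in>T. u t * of_bool (k \<le> p t))"

lemma step_weight_bound: "\<bar>step_weight T u p k\<bar> \<le> (\<Sum>t\<in>T. \<bar>u t\<bar>)"
  unfolding step_weight_def by (rule order_trans[OF sum_abs]) (auto intro!: sum_mono simp: abs_mult)

lemma sum_step_weight_sq:
  assumes "\<And>t. t \<in> T \<Longrightarrow> p t \<le> L"
  shows "(\<Sum>m<L. (step_weight T u p (L - m))\<^sup>2) = (\<Sum>s\<in>T. \<Sum>t\<in>T. u s * u t * real (min (p s) (p t)))"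
proof -
  have "(\<Sum>m<L. (step_weight T u p (L - m))\<^sup>2) = (\<Sum>k=1..L. (step_weight T u p k)\<^sup>2)"
    by (rule sum.reindex_bij_witness[of _ "\<lambda>k. L - k" "\<lambda>m. L - m"]) auto
  also have "\<dots> = (\<Sum>k=1..L. \<Sum>s\<in>T. \<Sum>t\<in>T. u s * u t * of_bool (k \<le> min (p s) (p t)))"
    unfolding step_weight_def power2_eq_square sum_product by (intro sum.cong refl) auto
  also have "\<dots> = (\<Sum>s\<in>T. \<Sum>k=1..L. \<Sum>t\<in>T. u s * u t * of_bool (k \<le> min (p s) (p t)))"
    by (rule sum.swap)
  also have "\<dots> = (\<Sum>s\<in>T. \<Sum>t\<in>T. \<Sum>k=1..L. u s * u t * of_bool (k \<le> min (p s) (p t)))"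
    by (rule sum.cong[OF refl], rule sum.swap)
  also have "\<dots> = (\<Sum>s\<in>T. \<Sum>t\<in>T. u s * u t * real (min (p s) (p t)))"
  proof (intro sum.cong refl)
    fix s t assume "s \<in> T" "t \<in> T"
    then have "{1..L} \<inter> {k. k \<le> min (p s) (p t)} = {1..min (p s) (p t)}" using assms[of s] by auto
    then have "(\<Sum>k=1..L. of_bool (k \<le> min (p s) (p t)) :: real) = real (min (p s) (p t))"
      by (simp only: sum_of_bool_eq finite_atLeastAtMost) simp
    then show "(\<Sum>k=1..L. u s * u t * of_bool (k \<le> min (p s) (p t))) = u s * u t * real (min (p s) (p t))"
      by (simp only: sum_distrib_left[symmetric])
  qed
  finally show ?thesis .
qed

text \<open>Reversed in time, step weights are combinations of indicators of final segments, over which the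
increments of \<open>E\<close> telescope; the bound does not grow with the length \<open>L\<close>.\<close>

lemma sum_step_weight_increments:
  fixes E :: "nat \<Rightarrow> real"
  assumes p: "\<And>t. t \<in> T \<Longrightarrow> p t \<le> L" and E: "\<And>m. \<bar>E m\<bar> \<le> C"
  shows "\<bar>\<Sum>m<L. step_weight T u p (L - m) * (E (Suc m) - E m)\<bar> \<le> (\<Sum>t\<in>T. \<bar>u t\<bar>) * (2 * C)"
proof -
  have "(\<Sum>m<L. step_weight T u p (L - m) * (E (Suc m) - E m)) = (\<Sum>m<L. \<Sum>t\<in>T. u t * (of_bool (L - m \<le> p t) * (E (Suc m) - E m)))"
    by (simp only: step_weight_def sum_distrib_right mult.assoc)
  also have "\<dots> = (\<Sum>t\<in>T. \<Sum>m<L. u t * (of_bool (L - m \<le> p t) * (E (Suc m) - E m)))"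
    by (rule sum.swap)
  also have "\<dots> = (\<Sum>t\<in>T. u t * (\<Sum>m<L. of_bool (L - m \<le> p t) * (E (Suc m) - E m)))"
    by (simp only: sum_distrib_left)
  also have "\<dots> = (\<Sum>t\<in>T. u t * (E L - E (L - p t)))"
  proof (intro sum.cong refl arg_cong2[where f="(*)"])
    fix t assume t: "t \<in> T"
    have "(\<Sum>m<L. of_bool (L - m \<le> p t) * (E (Suc m) - E m)) = (\<Sum>m\<in>{L - p t..<L}. E (Suc m) - E m)"
      using p[OF t] by (intro sum.mono_neutral_cong_right) auto
    also have "\<dots> = E L - E (L - p t)" by (rule sum_Suc_diff') simp
    finally show "(\<Sum>m<L. of_bool (L - m \<le> p t) * (E (Suc m) - E m)) = E L - E (L - p t)" .
  qed
  also have "\<bar>\<dots>\<bar> \<le> (\<Sum>t\<in>T. \<bar>u t\<bar> * (2 * C))"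
  proof (rule order_trans[OF sum_abs], rule sum_mono)
    fix t
    have "\<bar>E L - E (L - p t)\<bar> \<le> 2 * C" using E[of L] E[of "L - p t"] by linarith
    then show "\<bar>u t * (E L - E (L - p t))\<bar> \<le> \<bar>u t\<bar> * (2 * C)"
      unfolding abs_mult by (intro mult_left_mono) auto
  qed
  finally show ?thesis by (simp only: sum_distrib_right)
qed

text \<open>With weights of order \<open>1 / \<surd>n\<close> over \<open>n R\<close> steps, the error of the expansion is \<open>O(1 / \<surd>n)\<close>, the telescoping
part is \<open>O(1 / n)\<close>, and the sum of squares converges to the covariance form because
\<open>\<lfloor>n t\<rfloor> / n \<rightarrow> t\<close>. Any \<open>R\<close> that bounds the times in \<open>T\<close> makes the \<open>n R\<close> steps cover all partial sums.\<close>

lemma log_cf_limit: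
  fixes R :: nat
  assumes a: "0 < a" "a < 1" and T: "finite T" "T \<subseteq> {0..}" and R: "\<And>t. t \<in> T \<Longrightarrow> t \<le> real R"
  shows "(\<lambda>n. log_cf a (\<lambda>m. \<theta> / sqrt (real n) * step_weight T u (\<lambda>t. nat \<lfloor>real n * t\<rfloor>) (n * R - m)) (n * R))
    \<longlonglongrightarrow> complex_of_real (- ((1 + a) / (1 - a)) * (\<theta>\<^sup>2 * quad_min T u) / 2)"
proof -
  define p where "p n t = nat \<lfloor>real n * t\<rfloor>" for n and t :: real
  define sw where "sw n m = step_weight T u (p n) (n * R - m)" for n m
  define w where "w n m = \<theta> / sqrt (real n) * sw n m" for n m
  define U where "U = (\<Sum>t\<in>T. \<bar>u t\<bar>)"
  define b where "b n = \<bar>\<theta>\<bar> / sqrt (real n) * U" for n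
  have p: "p n t \<le> n * R" if "t \<in> T" for n t
  proof -
    have "real n * t \<le> real n * real R" using R[OF that] by (intro mult_left_mono) auto
    then show ?thesis unfolding p_def by (metis floor_mono floor_of_nat nat_int nat_mono of_nat_mult)
  qed
  have b: "\<bar>w n m\<bar> \<le> b n" for n m
    unfolding w_def b_def abs_mult U_def sw_def using step_weight_bound by (intro mult_mono) auto
  have U0: "0 \<le> U" unfolding U_def by (intro sum_nonneg) auto
  define main where "main n = - ((1 + a) / (1 - a)) * (\<Sum>m<n * R. (w n m)\<^sup>2) / 2
      + a / (1 - a) * (\<Sum>m<n * R. w n m * (lin_rec a (w n) (Suc m) - lin_rec a (w n) m))" for n
  have "(\<lambda>n. log_cf a (w n) (n * R) - complex_of_real (main n)) \<longlonglongrightarrow> 0"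
  proof (rule Lim_null_comparison)
    show "\<forall>\<^sub>F n in sequentially. norm (log_cf a (w n) (n * R) - complex_of_real (main n)) \<le> real (n * R) * ((b n) ^ 3 * (3 / (1 - a)\<^sup>2))"
      unfolding main_def by (intro always_eventually allI log_cf_expansion a b)
    have "(\<lambda>n. real n * (K / sqrt (real n) * U) ^ 3 * C) \<longlonglongrightarrow> 0" for K C :: real
    proof -
      have "(\<lambda>n. real n / sqrt (real n) ^ 3) \<longlonglongrightarrow> 0" by real_asymp
      then have "(\<lambda>n. ((K * U) ^ 3 * C) * (real n / sqrt (real n) ^ 3)) \<longlonglongrightarrow> ((K * U) ^ 3 * C) * 0"
        by (intro tendsto_intros)
      then show ?thesis by (simp add: power_mult_distrib power_divide mult_ac)
    qed
    from this[of "\<bar>\<theta>\<bar>" "real R * (3 / (1 - a)\<^sup>2)"]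
    show "(\<lambda>n. real (n * R) * ((b n) ^ 3 * (3 / (1 - a)\<^sup>2))) \<longlonglongrightarrow> 0"
      unfolding b_def by (simp add: mult_ac)
  qed
  moreover have "main \<longlonglongrightarrow> - ((1 + a) / (1 - a)) * (\<theta>\<^sup>2 * quad_min T u) / 2 + a / (1 - a) * 0"
    unfolding main_def
  proof (intro tendsto_intros)
    have "(\<lambda>n. \<theta>\<^sup>2 * (\<Sum>s\<in>T. \<Sum>t\<in>T. u s * u t * (real (min (p n s) (p n t)) / real n))) \<longlonglongrightarrow> \<theta>\<^sup>2 * quad_min T u"
      unfolding quad_min_def
    proof (intro tendsto_intros)
      fix s t assume st: "s \<in> T" "t \<in> T"
      have lim: "(\<lambda>n. real (p n t) / real n) \<longlonglongrightarrow> t" if "t \<in> T" for t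
      proof -
        have t0: "0 \<le> t" using that T by auto
        have "(\<lambda>n. of_int \<lfloor>real n * t\<rfloor> / real n) \<longlonglongrightarrow> t" by real_asymp
        moreover have "real (p n t) = of_int \<lfloor>real n * t\<rfloor>" for n using t0 by (simp add: p_def)
        ultimately show ?thesis by simp
      qed
      have "real (min (p n s) (p n t)) / real n = min (real (p n s) / real n) (real (p n t) / real n)" for n
        by (simp add: of_nat_min min_divide_distrib_right)
      then show "(\<lambda>n. real (min (p n s) (p n t)) / real n) \<longlonglongrightarrow> min s t"
        using tendsto_min[OF lim[OF st(1)] lim[OF st(2)]] by simp
    qed
    moreover have "(\<Sum>m<n * R. (w n m)\<^sup>2) = \<theta>\<^sup>2 * (\<Sum>s\<in>T. \<Sum>t\<in>T. u s * u t * (real (min (p n s) (p n t)) / real n))" for n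
    proof -
      have "(\<Sum>m<n * R. (w n m)\<^sup>2) = \<theta>\<^sup>2 / real n * (\<Sum>m<n * R. (sw n m)\<^sup>2)"
        by (simp add: w_def power_mult_distrib power_divide sum_distrib_left)
      also have "\<dots> = \<theta>\<^sup>2 / real n * (\<Sum>s\<in>T. \<Sum>t\<in>T. u s * u t * real (min (p n s) (p n t)))"
        unfolding sw_def using sum_step_weight_sq[OF p] by simp
      finally show ?thesis by (simp add: sum_distrib_left mult_ac)
    qed
    ultimately show "(\<lambda>n. \<Sum>m<n * R. (w n m)\<^sup>2) \<longlonglongrightarrow> \<theta>\<^sup>2 * quad_min T u" by simp
    show "(\<lambda>n. \<Sum>m<n * R. w n m * (lin_rec a (w n) (Suc m) - lin_rec a (w n) m)) \<longlonglongrightarrow> 0"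
    proof (rule Lim_null_comparison)
      show "\<forall>\<^sub>F n in sequentially. norm (\<Sum>m<n * R. w n m * (lin_rec a (w n) (Suc m) - lin_rec a (w n) m))
         \<le> \<bar>\<theta>\<bar> / sqrt (real n) * (U * (2 * (b n / (1 - a))))"
      proof (intro always_eventually allI)
        fix n
        have "(\<Sum>m<n * R. w n m * (lin_rec a (w n) (Suc m) - lin_rec a (w n) m))
          = \<theta> / sqrt (real n) * (\<Sum>m<n * R. step_weight T u (p n) (n * R - m) * (lin_rec a (w n) (Suc m) - lin_rec a (w n) m))"
          by (simp only: w_def sw_def sum_distrib_left mult.assoc)
        also have "norm \<dots> \<le> \<bar>\<theta>\<bar> / sqrt (real n) * (U * (2 * (b n / (1 - a))))"
          unfolding real_norm_def abs_mult U_def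
          by (intro mult_mono sum_step_weight_increments p lin_rec_bound a b) auto
        finally show "norm (\<Sum>m<n * R. w n m * (lin_rec a (w n) (Suc m) - lin_rec a (w n) m))
         \<le> \<bar>\<theta>\<bar> / sqrt (real n) * (U * (2 * (b n / (1 - a))))" .
      qed
      have "(\<lambda>n. K / sqrt (real n) * (U * (2 * (K / sqrt (real n) * U / C)))) \<longlonglongrightarrow> 0" for K C :: real
      proof -
        have "(\<lambda>n. 1 / sqrt (real n)) \<longlonglongrightarrow> 0" by real_asymp
        from tendsto_mult[OF this this]
        have "(\<lambda>n. (K * U * 2 * K * U / C) * (1 / sqrt (real n) * (1 / sqrt (real n)))) \<longlonglongrightarrow> (K * U * 2 * K * U / C) * (0 * 0)"
          by (intro tendsto_mult_left)
        then show ?thesis by (simp add: mult_ac)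
      qed
      then show "(\<lambda>n. \<bar>\<theta>\<bar> / sqrt (real n) * (U * (2 * (b n / (1 - a))))) \<longlonglongrightarrow> 0"
        unfolding b_def .
    qed
  qed simp
  ultimately have "(\<lambda>n. (log_cf a (w n) (n * R) - complex_of_real (main n)) + complex_of_real (main n))
    \<longlonglongrightarrow> 0 + complex_of_real (- ((1 + a) / (1 - a)) * (\<theta>\<^sup>2 * quad_min T u) / 2 + a / (1 - a) * 0)"
    by (intro tendsto_add tendsto_of_real)
  then show ?thesis by (simp add: w_def[abs_def] sw_def[abs_def] p_def[abs_def])
qed

section \<open>The INAR(1) process with a deterministic thinning parameter\<close>

text \<open>The whole input \<open>(X\<^sub>0, \<xi>, \<epsilon>)\<close> as one array of natural numbers: entry \<open>(0, 0)\<close> is \<open>X\<^sub>0\<close>, column \<open>0\<close> of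
row \<open>k \<ge> 1\<close> is the innovation \<open>\<epsilon>\<^sub>k\<close>, and the remaining entries of row \<open>k\<close> are the thinning variables
\<open>\<xi>\<^bsub>k,i\<^esub>\<close>. Independence of the three groups becomes independence of one family.\<close>

definition inar_coord :: "nat \<times> (nat \<times> nat \<Rightarrow> nat) \<times> (nat \<Rightarrow> nat) \<Rightarrow> nat \<times> nat \<Rightarrow> nat" where
  "inar_coord z = (\<lambda>(k, i). if k = 0 then fst z else if i = 0 then snd (snd z) k else fst (snd z) (k, i))"

definition inar_idx :: "(nat \<times> nat) set" where
  "inar_idx = insert (0, 0) ({1..} \<times> UNIV)"

definition inar_marginal :: "real \<Rightarrow> real \<Rightarrow> nat \<times> nat \<Rightarrow> nat pmf" where
  "inar_marginal lam a = (\<lambda>(k, i). if k = 0 then poisson_pmf (lam / (1 - a))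
     else if i = 0 then poisson_pmf lam else map_pmf of_bool (bernoulli_pmf a))"

abbreviation nat_product :: "'i set \<Rightarrow> ('i \<Rightarrow> nat) measure" where
  "nat_product I \<equiv> \<Pi>\<^sub>M i\<in>I. count_space UNIV"

abbreviation inar_coords :: "nat \<times> (nat \<times> nat \<Rightarrow> nat) \<times> (nat \<Rightarrow> nat) \<Rightarrow> nat \<times> nat \<Rightarrow> nat" where
  "inar_coords \<equiv> \<lambda>z. \<lambda>ki\<in>inar_idx. inar_coord z ki"

primrec inar_path :: "(nat \<times> nat \<Rightarrow> nat) \<Rightarrow> nat \<Rightarrow> nat" where
  "inar_path c 0 = c (0, 0)"
| "inar_path c (Suc k) = (\<Sum>i = 1..inar_path c k. c (Suc k, i)) + c (Suc k, 0)"

lemma measurable_count_space_binop: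
  fixes f g :: "'a \<Rightarrow> nat"
  assumes f: "f \<in> M \<rightarrow>\<^sub>M count_space UNIV" and g: "g \<in> M \<rightarrow>\<^sub>M count_space UNIV"
  shows "(\<lambda>x. h (f x) (g x)) \<in> M \<rightarrow>\<^sub>M count_space UNIV"
  by (rule measurable_compose_countable[where f="\<lambda>i x. h i (g x)", OF _ f]) (rule measurable_compose[OF g], simp)

lemma inar_path_cong:
  assumes "\<And>j i. j \<le> k \<Longrightarrow> (j, i) \<in> inar_idx \<Longrightarrow> c (j, i) = d (j, i)"
  shows "inar_path c k = inar_path d k"
  using assms
proof (induction k)
  case 0
  then show ?case by (simp add: inar_idx_def)
next
  case (Suc k)
  then have "inar_path c k = inar_path d k" by simp
  moreover have "c (Suc k, i) = d (Suc k, i)" for i using Suc.prems by (simp add: inar_idx_def)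
  ultimately show ?case by simp
qed

lemma inar_path_measurable:
  assumes "A \<subseteq> inar_idx" "\<And>j i. j \<le> k \<Longrightarrow> (j, i) \<in> inar_idx \<Longrightarrow> (j, i) \<in> A"
  shows "(\<lambda>c. inar_path c k) \<in> (nat_product A) \<rightarrow>\<^sub>M count_space UNIV"
  using assms(2)
proof (induction k)
  case 0
  then have "(0, 0) \<in> A" by (simp add: inar_idx_def)
  then show ?case by simp
next
  case (Suc k)
  have *: "(\<lambda>c. c (Suc k, i)) \<in> (nat_product A) \<rightarrow>\<^sub>M count_space (UNIV :: nat set)" for i
    using Suc.prems by (intro measurable_component_singleton) (simp add: inar_idx_def)
  have "(\<lambda>c. (\<lambda>m c. (\<Sum>i = 1..m. c (Suc k, i)) + c (Suc k, 0)) (inar_path c k) c) \<in> (nat_product A) \<rightarrow>\<^sub>M count_space UNIV"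
  proof (rule measurable_compose_countable[where f="\<lambda>m c. (\<Sum>i = 1..m. c (Suc k, i)) + c (Suc k, 0)"])
    show "(\<lambda>c. inar_path c k) \<in> (nat_product A) \<rightarrow>\<^sub>M count_space UNIV" using Suc by simp
    show "(\<lambda>c. (\<Sum>i = 1..m. c (Suc k, i)) + c (Suc k, 0) :: nat) \<in> (nat_product A) \<rightarrow>\<^sub>M count_space UNIV" for m
    proof -
      have add: "(\<lambda>c. f c + g c) \<in> (nat_product A) \<rightarrow>\<^sub>M count_space UNIV"
        if "f \<in> (nat_product A) \<rightarrow>\<^sub>M count_space UNIV" "g \<in> (nat_product A) \<rightarrow>\<^sub>M count_space UNIV"
        for f g :: "(nat \<times> nat \<Rightarrow> nat) \<Rightarrow> nat"
        using measurable_count_space_binop[OF that, of "(+)"] .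
      have "(\<lambda>c. \<Sum>i = 1..m. c (Suc k, i) :: nat) \<in> (nat_product A) \<rightarrow>\<^sub>M count_space UNIV"
      proof (induction m)
        case (Suc m)
        from add[OF Suc *[of "Suc m"]] show ?case by simp
      qed simp
      from add[OF this *] show ?thesis .
    qed
  qed
  then show ?case by simp
qed

lemma sets_inar_input_law: "sets (inar_input_law lam a) = sets inar_input_space"
  unfolding inar_input_law_def inar_input_space_def
  by (intro sets_pair_measure_cong sets_PiM_cong) auto

lemma prob_space_inar_input_law: "prob_space (inar_input_law lam a)"
  unfolding inar_input_law_def
  by (intro prob_space_pair prob_space_PiM prob_space_measure_pmf)

lemma inar_coord_measurable:
  assumes "ki \<in> inar_idx"
  shows "(\<lambda>z. inar_coord z ki) \<in> inar_input_space \<rightarrow>\<^sub>M count_space UNIV"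
proof -
  obtain k i where ki: "ki = (k, i)" by force
  consider "k = 0" | "k \<ge> 1" "i = 0" | "k \<ge> 1" "i \<ge> 1" by linarith
  then show ?thesis
  proof cases
    case 1
    then show ?thesis unfolding ki inar_coord_def inar_input_space_def by simp
  next
    case 2
    then have "(\<lambda>e. e k) \<in> (\<Pi>\<^sub>M k\<in>{1..}. count_space UNIV) \<rightarrow>\<^sub>M count_space (UNIV :: nat set)"
      by (intro measurable_component_singleton) simp
    then have "(\<lambda>z. snd (snd z) k) \<in> inar_input_space \<rightarrow>\<^sub>M count_space UNIV"
      unfolding inar_input_space_def
      by (rule measurable_compose[OF measurable_compose[OF measurable_snd measurable_snd]])
    then show ?thesis using 2 by (simp add: ki inar_coord_def)
  next
    case 3
    then have "(\<lambda>\<xi>. \<xi> (k, i)) \<in> (\<Pi>\<^sub>M ki\<in>{1..} \<times> {1..}. count_space UNIV) \<rightarrow>\<^sub>M count_space (UNIV :: nat set)"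
      by (intro measurable_component_singleton) simp
    then have "(\<lambda>z. fst (snd z) (k, i)) \<in> inar_input_space \<rightarrow>\<^sub>M count_space UNIV"
      unfolding inar_input_space_def
      by (rule measurable_compose[OF measurable_compose[OF measurable_snd measurable_fst]])
    then show ?thesis using 3 by (simp add: ki inar_coord_def)
  qed
qed

lemma inar_coord_measurable_law:
  "ki \<in> inar_idx \<Longrightarrow> (\<lambda>z. inar_coord z ki) \<in> inar_input_law lam a \<rightarrow>\<^sub>M count_space UNIV"
  using inar_coord_measurable measurable_cong_sets[OF sets_inar_input_law refl] by blast

lemma inar_coords_measurable_law:
  "inar_coords \<in> inar_input_law lam a \<rightarrow>\<^sub>M (nat_product inar_idx)"
  by (intro measurable_restrict inar_coord_measurable_law)

text \<open>Cylinder sets of the array are products of cylinder sets in the three components, so the two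
measures agree on a generator.\<close>

lemma inar_coord_joint_law:
  "distr (inar_input_law lam a) (nat_product inar_idx) inar_coords
    = (\<Pi>\<^sub>M ki\<in>inar_idx. measure_pmf (inar_marginal lam a ki))"
proof -
  interpret product_prob_space "\<lambda>ki. measure_pmf (inar_marginal lam a ki)" inar_idx
    by unfold_locales
  note m = inar_coords_measurable_law[of lam a]
  show ?thesis
  proof (rule PiM_eq)
    show "sets (distr (inar_input_law lam a) (nat_product inar_idx) inar_coords)
      = sets (\<Pi>\<^sub>M ki\<in>inar_idx. measure_pmf (inar_marginal lam a ki))"
      by (simp, intro sets_PiM_cong) auto
  next
    fix J :: "(nat \<times> nat) set" and F :: "nat \<times> nat \<Rightarrow> nat set"
    assume J: "finite J" "J \<subseteq> inar_idx"
    let ?PX = "measure_pmf (poisson_pmf (lam / (1 - a)))"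
    let ?PB = "measure_pmf (map_pmf of_bool (bernoulli_pmf a) :: nat pmf)"
    let ?PE = "measure_pmf (poisson_pmf lam)"
    define J1 where "J1 = J \<inter> {1..} \<times> {1..}"
    define J2 where "J2 = {k. 1 \<le> k \<and> (k, 0) \<in> J}"
    define J0 where "J0 = J \<inter> {(0, 0)}"
    have Jeq: "J = J0 \<union> (J1 \<union> (\<lambda>k. (k, 0)) ` J2)"
    proof (rule set_eqI)
      fix x :: "nat \<times> nat"
      obtain k i where "x = (k, i)" by force
      then show "x \<in> J \<longleftrightarrow> x \<in> J0 \<union> (J1 \<union> (\<lambda>k. (k, 0)) ` J2)"
        using J(2) by (cases "i = 0") (auto simp: J0_def J1_def J2_def inar_idx_def)
    qed
    have fin: "finite J0" "finite J1" "finite J2"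
    proof -
      show "finite J0" "finite J1" using J by (auto simp: J0_def J1_def)
      have "J2 \<subseteq> fst ` J" by (force simp: J2_def)
      then show "finite J2" using J finite_surj by blast
    qed
    define A0 where "A0 = (if (0, 0) \<in> J then F (0, 0) else UNIV)"
    define A1 where "A1 = prod_emb ({1..} \<times> {1..}) (\<lambda>_. ?PB) J1 (\<Pi>\<^sub>E j\<in>J1. F j)"
    define A2 where "A2 = prod_emb {1..} (\<lambda>_. ?PE) J2 (\<Pi>\<^sub>E k\<in>J2. F (k, 0))"
    have pre: "inar_coords -` prod_emb inar_idx (\<lambda>ki. measure_pmf (inar_marginal lam a ki)) J (\<Pi>\<^sub>E j\<in>J. F j)
       \<inter> space (inar_input_law lam a) = A0 \<times> (A1 \<times> A2)" (is "?l = ?r")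
    proof (rule set_eqI)
      fix z :: "nat \<times> (nat \<times> nat \<Rightarrow> nat) \<times> (nat \<Rightarrow> nat)"
      obtain x \<xi> e where z: "z = (x, \<xi>, e)" by (cases z) auto
      have sp: "z \<in> space (inar_input_law lam a) \<longleftrightarrow> \<xi> \<in> extensional ({1..} \<times> {1..}) \<and> e \<in> extensional {1..}"
        by (simp add: z inar_input_law_def space_pair_measure space_PiM PiE_def)
      have 1: "z \<in> ?l \<longleftrightarrow> z \<in> space (inar_input_law lam a) \<and> (\<forall>j\<in>J. inar_coord z j \<in> F j)"
        using J(2) by (auto simp: prod_emb_def PiE_def Pi_def)
      have "(\<forall>j\<in>J. inar_coord z j \<in> F j) \<longleftrightarrow> x \<in> A0 \<and> (\<forall>j\<in>J1. \<xi> j \<in> F j) \<and> (\<forall>k\<in>J2. e k \<in> F (k, 0))"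
      proof -
        have "(\<forall>j\<in>J. inar_coord z j \<in> F j) \<longleftrightarrow> (\<forall>j\<in>J0. inar_coord z j \<in> F j) \<and> (\<forall>j\<in>J1. inar_coord z j \<in> F j) \<and> (\<forall>k\<in>J2. inar_coord z (k, 0) \<in> F (k, 0))"
          using Jeq by blast
        moreover have "(\<forall>j\<in>J0. inar_coord z j \<in> F j) \<longleftrightarrow> x \<in> A0"
          by (auto simp: J0_def A0_def inar_coord_def z)
        moreover have "inar_coord z j = \<xi> j" if "j \<in> J1" for j
          using that by (cases j) (auto simp: J1_def inar_coord_def z)
        moreover have "inar_coord z (k, 0) = e k" if "k \<in> J2" for k
          using that by (auto simp: J2_def inar_coord_def z)
        ultimately show ?thesis by simp
      qed
      moreover have "\<xi> \<in> A1 \<longleftrightarrow> \<xi> \<in> extensional ({1..} \<times> {1..}) \<and> (\<forall>j\<in>J1. \<xi> j \<in> F j)"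
        by (auto simp: A1_def prod_emb_def PiE_def Pi_def J1_def)
      moreover have "e \<in> A2 \<longleftrightarrow> e \<in> extensional {1..} \<and> (\<forall>k\<in>J2. e k \<in> F (k, 0))"
        by (auto simp: A2_def prod_emb_def PiE_def Pi_def J2_def)
      ultimately show "z \<in> ?l \<longleftrightarrow> z \<in> ?r" unfolding 1 sp by (auto simp: z)
    qed
    interpret X: prob_space ?PX by (rule prob_space_measure_pmf)
    interpret B: prob_space "\<Pi>\<^sub>M ki\<in>{1..} \<times> {1..}. ?PB" by (intro prob_space_PiM prob_space_measure_pmf)
    interpret E: prob_space "\<Pi>\<^sub>M k\<in>{1..}. ?PE" by (intro prob_space_PiM prob_space_measure_pmf)
    interpret BE: prob_space "(\<Pi>\<^sub>M ki\<in>{1..} \<times> {1..}. ?PB) \<Otimes>\<^sub>M (\<Pi>\<^sub>M k\<in>{1..}. ?PE)"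
      by (intro prob_space_pair B.prob_space_axioms E.prob_space_axioms)
    have A1: "A1 \<in> sets (\<Pi>\<^sub>M ki\<in>{1..} \<times> {1..}. ?PB)" unfolding A1_def
      by (rule sets_PiM_I) (use fin in \<open>auto simp: J1_def\<close>)
    have A2: "A2 \<in> sets (\<Pi>\<^sub>M k\<in>{1..}. ?PE)" unfolding A2_def
      by (rule sets_PiM_I) (use fin in \<open>auto simp: J2_def\<close>)
    have "emeasure (distr (inar_input_law lam a) (nat_product inar_idx) inar_coords)
        (prod_emb inar_idx (\<lambda>ki. measure_pmf (inar_marginal lam a ki)) J (\<Pi>\<^sub>E j\<in>J. F j))
      = emeasure (inar_input_law lam a) (A0 \<times> (A1 \<times> A2))"
    proof (subst emeasure_distr[OF m])
      have "prod_emb inar_idx (\<lambda>ki. measure_pmf (inar_marginal lam a ki)) J (\<Pi>\<^sub>E j\<in>J. F j) \<in> sets (\<Pi>\<^sub>M ki\<in>inar_idx. measure_pmf (inar_marginal lam a ki))"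
        by (rule sets_PiM_I) (use J in auto)
      also have "sets (\<Pi>\<^sub>M ki\<in>inar_idx. measure_pmf (inar_marginal lam a ki)) = sets (nat_product inar_idx)"
        by (intro sets_PiM_cong) auto
      finally show "prod_emb inar_idx (\<lambda>ki. measure_pmf (inar_marginal lam a ki)) J (\<Pi>\<^sub>E j\<in>J. F j) \<in> sets (nat_product inar_idx)" .
    qed (simp only: pre)
    also have "\<dots> = emeasure ?PX A0 * (emeasure (\<Pi>\<^sub>M ki\<in>{1..} \<times> {1..}. ?PB) A1 * emeasure (\<Pi>\<^sub>M k\<in>{1..}. ?PE) A2)"
      unfolding inar_input_law_def using A1 A2
      by (simp only: BE.emeasure_pair_measure_Times[OF _ pair_measureI[OF A1 A2]] E.emeasure_pair_measure_Times[OF A1 A2] sets_measure_pmf UNIV_I Pow_UNIV sets_count_space)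
    also have "emeasure ?PX A0 = (\<Prod>j\<in>J0. emeasure (inar_marginal lam a j) (F j))"
      by (cases "(0, 0) \<in> J") (auto simp: A0_def J0_def inar_marginal_def measure_pmf.emeasure_space_1[simplified])
    also have "emeasure (\<Pi>\<^sub>M ki\<in>{1..} \<times> {1..}. ?PB) A1 = (\<Prod>j\<in>J1. emeasure (inar_marginal lam a j) (F j))"
      unfolding A1_def
      by (subst Infinite_Product_Measure.emeasure_PiM_emb)
         (use fin in \<open>auto simp: J1_def inar_marginal_def prob_space_measure_pmf intro!: prod.cong\<close>)
    also have "emeasure (\<Pi>\<^sub>M k\<in>{1..}. ?PE) A2 = (\<Prod>k\<in>J2. emeasure (inar_marginal lam a (k, 0)) (F (k, 0)))"
      unfolding A2_def
      by (subst Infinite_Product_Measure.emeasure_PiM_emb)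
         (use fin in \<open>auto simp: J2_def inar_marginal_def prob_space_measure_pmf intro!: prod.cong\<close>)
    also have "\<dots> = (\<Prod>j\<in>(\<lambda>k. (k, 0)) ` J2. emeasure (inar_marginal lam a j) (F j))"
      by (subst prod.reindex) (auto simp: inj_on_def)
    also have "(\<Prod>j\<in>J0. emeasure (inar_marginal lam a j) (F j)) * ((\<Prod>j\<in>J1. emeasure (inar_marginal lam a j) (F j)) *
        (\<Prod>j\<in>(\<lambda>k. (k, 0)) ` J2. emeasure (inar_marginal lam a j) (F j))) = (\<Prod>j\<in>J. emeasure (inar_marginal lam a j) (F j))"
    proof -
      have "J1 \<inter> (\<lambda>k. (k, 0)) ` J2 = {}" "J0 \<inter> (J1 \<union> (\<lambda>k. (k, 0)) ` J2) = {}"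
        by (auto simp: J0_def J1_def J2_def)
      then have "(\<Prod>j\<in>J0. emeasure (inar_marginal lam a j) (F j)) * ((\<Prod>j\<in>J1. emeasure (inar_marginal lam a j) (F j)) *
        (\<Prod>j\<in>(\<lambda>k. (k, 0)) ` J2. emeasure (inar_marginal lam a j) (F j)))
        = (\<Prod>j\<in>J0 \<union> (J1 \<union> (\<lambda>k. (k, 0)) ` J2). emeasure (inar_marginal lam a j) (F j))"
        using fin by (simp add: prod.union_disjoint)
      then show ?thesis by (simp only: Jeq[symmetric])
    qed
    finally show "emeasure (distr (inar_input_law lam a) (nat_product inar_idx) inar_coords)
        (prod_emb inar_idx (\<lambda>ki. measure_pmf (inar_marginal lam a ki)) J (\<Pi>\<^sub>E j\<in>J. F j))
      = (\<Prod>j\<in>J. emeasure (inar_marginal lam a j) (F j))" .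
  qed
qed

lemma inar_coord_law:
  assumes ki: "ki \<in> inar_idx"
  shows "distr (inar_input_law lam a) (count_space UNIV) (\<lambda>z. inar_coord z ki) = measure_pmf (inar_marginal lam a ki)"
proof -
  note m = inar_coords_measurable_law[of lam a]
  have "distr (inar_input_law lam a) (count_space UNIV) (\<lambda>z. inar_coord z ki)
    = distr (distr (inar_input_law lam a) (nat_product inar_idx) inar_coords) (count_space UNIV) (\<lambda>c. c ki)"
    using ki by (subst distr_distr[OF _ m]) (auto simp: o_def intro: measurable_component_singleton)
  also have "\<dots> = distr (\<Pi>\<^sub>M ki\<in>inar_idx. measure_pmf (inar_marginal lam a ki)) (measure_pmf (inar_marginal lam a ki)) (\<lambda>c. c ki)"
    unfolding inar_coord_joint_law by (rule distr_cong) auto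
  also have "\<dots> = measure_pmf (inar_marginal lam a ki)"
    by (rule distr_PiM_component[OF prob_space_measure_pmf ki])
  finally show ?thesis .
qed

lemma inar_coord_indep:
  "prob_space.indep_vars (inar_input_law lam a) (\<lambda>_. count_space UNIV) (\<lambda>ki z. inar_coord z ki) inar_idx"
proof -
  interpret prob_space "inar_input_law lam a" by (rule prob_space_inar_input_law)
  have ne: "inar_idx \<noteq> {}" by (simp add: inar_idx_def)
  have rv: "random_variable (count_space UNIV) (\<lambda>z. inar_coord z ki)" if "ki \<in> inar_idx" for ki
    using inar_coord_measurable_law[OF that] .
  show ?thesis
    by (subst indep_vars_iff_distr_eq_PiM'[OF ne rv], assumption, subst inar_coord_joint_law, rule PiM_cong)
       (auto simp: inar_coord_law)
qed


lemma integral_poisson_power: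
  fixes u :: complex
  assumes rpos: "0 < r" and u: "norm u \<le> 1"
  shows "(\<integral>x. u ^ x \<partial>measure_pmf (poisson_pmf r)) = exp (r * (u - 1))"
proof -
  let ?p = "poisson_pmf r"
  have int: "integrable (measure_pmf ?p) (\<lambda>x. u ^ x)"
    by (rule measure_pmf.integrable_const_bound[where B=1]) (auto simp: norm_power u power_le_one)
  have eq: "measure_pmf ?p = density (count_space UNIV) (\<lambda>x. ennreal (pmf ?p x))"
    by (rule measure_pmf_eq_density)
  have "integrable (count_space UNIV) (\<lambda>x. pmf ?p x *\<^sub>R u ^ x)"
    using int unfolding eq by (subst (asm) integrable_density) auto
  from sums_integral_count_space_nat[OF this]
  have "(\<lambda>x. pmf ?p x *\<^sub>R u ^ x) sums (\<integral>x. pmf ?p x *\<^sub>R u ^ x \<partial>count_space UNIV)" .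
  also have "(\<integral>x. pmf ?p x *\<^sub>R u ^ x \<partial>count_space UNIV) = (\<integral>x. u ^ x \<partial>measure_pmf ?p)"
    unfolding eq by (subst integral_density) auto
  finally have 1: "(\<lambda>x. pmf ?p x *\<^sub>R u ^ x) sums (\<integral>x. u ^ x \<partial>measure_pmf ?p)" .
  have "(\<lambda>x. (r * u) ^ x /\<^sub>R fact x * exp (- complex_of_real r)) sums (exp (r * u) * exp (- complex_of_real r))"
    by (intro sums_mult2 exp_converges)
  moreover have "(r * u) ^ x /\<^sub>R fact x * exp (- complex_of_real r) = pmf ?p x *\<^sub>R u ^ x" for x
    using rpos by (simp add: scaleR_conv_of_real power_mult_distrib exp_of_real field_simps flip: of_real_minus)
  moreover have "exp (r * u) * exp (- complex_of_real r) = exp (r * (u - 1))"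
    by (simp add: exp_add[symmetric] algebra_simps)
  ultimately have "(\<lambda>x. pmf ?p x *\<^sub>R u ^ x) sums exp (r * (u - 1))" by simp
  with 1 show ?thesis by (rule sums_unique2)
qed


lemma integral_inar_marginal_power:
  fixes u :: complex
  assumes lam: "0 < lam" and a: "0 < a" "a < 1" and u: "norm u \<le> 1"
  shows "(\<integral>x. u ^ x \<partial>measure_pmf (inar_marginal lam a (0, i))) = exp (complex_of_real (lam / (1 - a)) * (u - 1))"
    and "0 < k \<Longrightarrow> (\<integral>x. u ^ x \<partial>measure_pmf (inar_marginal lam a (k, 0))) = exp (lam * (u - 1))"
    and "0 < k \<Longrightarrow> 0 < i \<Longrightarrow> (\<integral>x. u ^ x \<partial>measure_pmf (inar_marginal lam a (k, i))) = 1 + a * (u - 1)"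
proof -
  show "(\<integral>x. u ^ x \<partial>measure_pmf (inar_marginal lam a (0, i))) = exp (complex_of_real (lam / (1 - a)) * (u - 1))"
    using integral_poisson_power[OF _ u, of "lam / (1 - a)"] lam a by (simp add: inar_marginal_def)
  show "0 < k \<Longrightarrow> (\<integral>x. u ^ x \<partial>measure_pmf (inar_marginal lam a (k, 0))) = exp (lam * (u - 1))"
    using integral_poisson_power[OF lam u] by (simp add: inar_marginal_def)
  show "0 < k \<Longrightarrow> 0 < i \<Longrightarrow> (\<integral>x. u ^ x \<partial>measure_pmf (inar_marginal lam a (k, i))) = 1 + a * (u - 1)"
    using a by (simp add: inar_marginal_def integral_measure_pmf[of UNIV] UNIV_bool scaleR_conv_of_real algebra_simps)
qed

lemma inar_path_measurable_law:
  "(\<lambda>z. inar_path (inar_coord z) k) \<in> inar_input_law lam a \<rightarrow>\<^sub>M count_space UNIV"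
proof -
  have "(\<lambda>z. inar_path (\<lambda>ki\<in>inar_idx. inar_coord z ki) k) \<in> inar_input_law lam a \<rightarrow>\<^sub>M count_space UNIV"
    by (rule measurable_compose[OF inar_coords_measurable_law inar_path_measurable]) auto
  also have "(\<lambda>z. inar_path (\<lambda>ki\<in>inar_idx. inar_coord z ki) k) = (\<lambda>z. inar_path (inar_coord z) k)"
    by (intro ext inar_path_cong) simp
  finally show ?thesis .
qed

text \<open>Allows an integral identity to be verified separately on each event \<open>X = x\<close>.\<close>

lemma integral_eq_by_countable_partition:
  fixes f g :: "'a \<Rightarrow> 'b::{banach, second_countable_topology}" and X :: "'a \<Rightarrow> nat"
  assumes X: "X \<in> M \<rightarrow>\<^sub>M count_space UNIV" and int: "integrable M f" "integrable M g"
    and eq: "\<And>x. (\<integral>\<omega>. indicator {x} (X \<omega>) *\<^sub>R f \<omega> \<partial>M) = (\<integral>\<omega>. indicator {x} (X \<omega>) *\<^sub>R g \<omega> \<partial>M)"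
  shows "integral\<^sup>L M f = integral\<^sup>L M g"
proof -
  define A where "A x = X -` {x} \<inter> space M" for x
  have A: "A x \<in> sets M" for x unfolding A_def using X by (rule measurable_sets) simp
  have disj: "A x \<inter> A y = {}" if "x \<noteq> y" for x y using that by (auto simp: A_def)
  have un: "(\<Union>x. A x) = space M" by (auto simp: A_def)
  have "integral\<^sup>L M h = (\<Sum>x. \<integral>\<omega>. indicator {x} (X \<omega>) *\<^sub>R h \<omega> \<partial>M)" if h: "integrable M h" for h :: "'a \<Rightarrow> 'b"
  proof -
    have "integral\<^sup>L M h = (LINT \<omega>:(\<Union>x. A x)|M. h \<omega>)"
      unfolding un set_lebesgue_integral_def by (intro Bochner_Integration.integral_cong) auto
    also have "\<dots> = (\<Sum>x. LINT \<omega>:A x|M. h \<omega>)"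
    proof (rule lebesgue_integral_countable_add[OF A disj])
      show "set_integrable M (\<Union>x. A x) h"
        unfolding un set_integrable_def using h by (subst Bochner_Integration.integrable_cong[where g=h]) auto
    qed
    also have "\<dots> = (\<Sum>x. \<integral>\<omega>. indicator {x} (X \<omega>) *\<^sub>R h \<omega> \<partial>M)"
      unfolding set_lebesgue_integral_def
      by (intro suminf_cong Bochner_Integration.integral_cong) (auto simp: A_def indicator_def)
    finally show ?thesis .
  qed
  then show ?thesis using int eq by simp
qed

text \<open>One step of the process: given the past, \<open>u\<close> to the power \<open>X\<^sub>k\<^sub>+\<^sub>1\<close> has conditional expectation
\<open>(1 - a + a u)\<close> to the power \<open>X\<^sub>k\<close>, times \<open>exp (\<lambda> (u - 1))\<close>. On the event \<open>X\<^sub>k = x\<close> the exponent is the sum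
of the first \<open>x + 1\<close> entries of row \<open>k + 1\<close>, which are independent of the rows before.\<close>

lemma inar_step:
  fixes u :: complex and g :: "nat \<Rightarrow> nat \<Rightarrow> complex"
  assumes lam: "0 < lam" and a: "0 < a" "a < 1" and u: "norm u \<le> 1" and g: "\<And>j x. norm (g j x) \<le> 1"
  defines "X \<equiv> \<lambda>k z. inar_path (inar_coord z) k"
  shows "(\<integral>z. (\<Prod>j=1..k. g j (X j z)) * u ^ X (Suc k) z \<partial>inar_input_law lam a)
    = (\<integral>z. (\<Prod>j=1..k. g j (X j z)) * (1 + a * (u - 1)) ^ X k z \<partial>inar_input_law lam a) * exp (lam * (u - 1))"
proof -
  interpret prob_space "inar_input_law lam a" by (rule prob_space_inar_input_law)
  let ?P = "inar_input_law lam a"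
  let ?q = "1 + a * (u - 1)"
  let ?Y = "\<lambda>z. \<Prod>j=1..k. g j (X j z)"
  have X[measurable]: "X j \<in> ?P \<rightarrow>\<^sub>M count_space UNIV" for j
    unfolding X_def by (rule inar_path_measurable_law)
  have q: "norm ?q \<le> 1" using norm_one_plus_thinned_le_1[of a "u - 1"] a u by simp
  have Y1: "norm (?Y z) \<le> 1" for z using g by (auto intro!: prod_le_1 simp: prod_norm[symmetric])
  have bint: "integrable ?P (\<lambda>z. ?Y z * v ^ X i z)" if "norm v \<le> 1" for v i
  proof (rule integrable_const_bound[where B=1])
    show "AE z in ?P. norm (?Y z * v ^ X i z) \<le> 1"
      using Y1 that by (auto simp: norm_mult norm_power intro!: mult_le_one power_le_one)
  qed measurable
  have "(\<integral>z. ?Y z * u ^ X (Suc k) z \<partial>?P) = (\<integral>z. (?Y z * ?q ^ X k z) * exp (lam * (u - 1)) \<partial>?P)"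
  proof (rule integral_eq_by_countable_partition[OF X[of k]])
    show "integrable ?P (\<lambda>z. ?Y z * u ^ X (Suc k) z)" by (rule bint[OF u])
    show "integrable ?P (\<lambda>z. (?Y z * ?q ^ X k z) * exp (lam * (u - 1)))" by (intro integrable_mult_left bint[OF q])
    fix x :: nat
    \<comment> \<open>\<open>A\<close> is the past and \<open>B\<close> the row that produces \<open>X\<^sub>k\<^sub>+\<^sub>1\<close>.\<close>
    define A where "A = {(j, i). (j, i) \<in> inar_idx \<and> j \<le> k}"
    define B where "B = {Suc k} \<times> (UNIV :: nat set)"
    define F where "F c = (\<Prod>j=1..k. g j (inar_path c j)) * of_bool (inar_path c k = x)" for c
    define G where "G c = (\<Prod>i\<in>{0..x}. u ^ c (Suc k, i))" for c
    have AB: "A \<inter> B = {}" "A \<subseteq> inar_idx" "B \<subseteq> inar_idx" by (auto simp: A_def B_def inar_idx_def)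
    have ind: "indep_var (nat_product A) (\<lambda>z. restrict (inar_coord z) A) (nat_product B) (\<lambda>z. restrict (inar_coord z) B)"
      using indep_var_restrict[OF inar_coord_indep AB] by simp
    have Fm: "F \<in> (nat_product A) \<rightarrow>\<^sub>M borel"
    proof -
      have im: "(\<lambda>c. inar_path c j) \<in> (nat_product A) \<rightarrow>\<^sub>M count_space UNIV" if "j \<le> k" for j
        by (rule inar_path_measurable[OF AB(2)]) (use that in \<open>auto simp: A_def\<close>)
      have comp: "(\<lambda>c. f (inar_path c j)) \<in> borel_measurable (nat_product A)" if "j \<le> k" for j and f :: "nat \<Rightarrow> complex"
        by (rule measurable_compose[OF im[OF that]]) simp
      show ?thesis unfolding F_def
      proof (rule borel_measurable_times)
        show "(\<lambda>c. \<Prod>j=1..k. g j (inar_path c j)) \<in> borel_measurable (nat_product A)"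
          by (rule borel_measurable_prod) (use comp in auto)
        show "(\<lambda>c. of_bool (inar_path c k = x) :: complex) \<in> borel_measurable (nat_product A)"
          by (rule comp) simp
      qed
    qed
    have comp: "(\<lambda>c. u ^ c (Suc k, i)) \<in> borel_measurable (nat_product B)" for i
    proof -
      have "(\<lambda>c. c (Suc k, i)) \<in> (nat_product B) \<rightarrow>\<^sub>M count_space (UNIV :: nat set)"
        by (rule measurable_component_singleton) (simp add: B_def)
      then show ?thesis by (rule measurable_compose) simp
    qed
    have Gm: "G \<in> (nat_product B) \<rightarrow>\<^sub>M borel"
      unfolding G_def by (intro borel_measurable_prod comp)
    have ind2: "indep_var borel (\<lambda>z. F (restrict (inar_coord z) A)) borel (\<lambda>z. G (restrict (inar_coord z) B))"
      using indep_var_compose[OF ind Fm Gm] by (simp add: o_def)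
    have FX: "F (restrict (inar_coord z) A) = ?Y z * of_bool (X k z = x)" for z
    proof -
      have "inar_path (restrict (inar_coord z) A) j = X j z" if "j \<le> k" for j
        unfolding X_def using that by (intro inar_path_cong) (auto simp: A_def)
      then show ?thesis unfolding F_def by simp
    qed
    have GX: "G (restrict (inar_coord z) B) = (\<Prod>i\<in>{0..x}. u ^ inar_coord z (Suc k, i))" for z
      unfolding G_def by (intro prod.cong) (auto simp: B_def)
    have intF: "integrable ?P (\<lambda>z. F (restrict (inar_coord z) A))"
      unfolding FX
    proof (rule integrable_const_bound[where B=1])
      show "AE z in ?P. norm (?Y z * of_bool (X k z = x)) \<le> 1"
        using Y1 by (auto simp: norm_mult)
    qed measurable
    have cm: "(\<lambda>z. u ^ inar_coord z (Suc k, i)) \<in> borel_measurable ?P" for i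
      by (rule measurable_compose[OF inar_coord_measurable_law]) (auto simp: inar_idx_def)
    have cint: "integrable ?P (\<lambda>z. u ^ inar_coord z (Suc k, i))" for i
      by (rule integrable_const_bound[where B=1]) (use u cm in \<open>auto simp: norm_power intro!: power_le_one\<close>)
    have indB: "indep_vars (\<lambda>_. borel) (\<lambda>ki z. u ^ inar_coord z ki) ({Suc k} \<times> {0..x})"
    proof (rule indep_vars_compose2[where Y="\<lambda>_ m. u ^ m" and M'="\<lambda>_. count_space UNIV"])
      show "indep_vars (\<lambda>_. count_space UNIV) (\<lambda>ki z. inar_coord z ki) ({Suc k} \<times> {0..x})"
        by (rule indep_vars_subset[OF inar_coord_indep]) (auto simp: inar_idx_def)
    qed simp
    have prod_idx: "(\<Prod>i\<in>{0..x}. h (Suc k, i)) = (\<Prod>ki\<in>{Suc k} \<times> {0..x}. h ki)" for h :: "nat \<times> nat \<Rightarrow> complex"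
      by (rule prod.reindex_bij_witness[of _ snd "\<lambda>i. (Suc k, i)"]) auto
    have mean: "(\<integral>z. u ^ inar_coord z (Suc k, i) \<partial>?P) = (if i = 0 then exp (lam * (u - 1)) else ?q)" for i
    proof -
      have "(\<integral>z. u ^ inar_coord z (Suc k, i) \<partial>?P) = (\<integral>m. u ^ m \<partial>distr ?P (count_space UNIV) (\<lambda>z. inar_coord z (Suc k, i)))"
        by (rule integral_distr[symmetric]) (auto intro: inar_coord_measurable_law simp: inar_idx_def)
      also have "\<dots> = (\<integral>m. u ^ m \<partial>measure_pmf (inar_marginal lam a (Suc k, i)))"
        by (subst inar_coord_law) (auto simp: inar_idx_def)
      finally show ?thesis
        using integral_inar_marginal_power(2,3)[OF lam a u, of "Suc k"] by auto
    qed
    have EG: "(\<integral>z. G (restrict (inar_coord z) B) \<partial>?P) = exp (lam * (u - 1)) * ?q ^ x"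
    proof -
      have "(\<integral>z. G (restrict (inar_coord z) B) \<partial>?P) = (\<integral>z. (\<Prod>ki\<in>{Suc k} \<times> {0..x}. u ^ inar_coord z ki) \<partial>?P)"
        unfolding GX by (intro Bochner_Integration.integral_cong refl prod_idx)
      also have "\<dots> = (\<Prod>ki\<in>{Suc k} \<times> {0..x}. \<integral>z. u ^ inar_coord z ki \<partial>?P)"
        by (rule indep_vars_lebesgue_integral[OF _ indB]) (auto intro: cint)
      also have "\<dots> = (\<Prod>i\<in>{0..x}. \<integral>z. u ^ inar_coord z (Suc k, i) \<partial>?P)"
        by (rule prod_idx[symmetric])
      also have "\<dots> = exp (lam * (u - 1)) * ?q ^ x"
        unfolding mean by (simp add: prod.atLeast_Suc_atMost)
      finally show ?thesis .
    qed
    have intG: "integrable ?P (\<lambda>z. G (restrict (inar_coord z) B))"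
    proof -
      have "G (restrict (inar_coord z) B) = (\<Prod>ki\<in>{Suc k} \<times> {0..x}. u ^ inar_coord z ki)" for z
        unfolding GX by (rule prod_idx)
      then show ?thesis using indep_vars_integrable[OF _ indB] cint by auto
    qed
    have "(\<integral>z. indicator {x} (X k z) *\<^sub>R (?Y z * u ^ X (Suc k) z) \<partial>?P)
      = (\<integral>z. F (restrict (inar_coord z) A) * G (restrict (inar_coord z) B) \<partial>?P)"
    proof (rule Bochner_Integration.integral_cong[OF refl])
      fix z
      have "u ^ X (Suc k) z = (\<Prod>i\<in>{0..x}. u ^ inar_coord z (Suc k, i))" if "X k z = x"
        using that unfolding X_def
        by (simp add: power_add power_sum prod.atLeast_Suc_atMost mult.commute)
      then show "indicator {x} (X k z) *\<^sub>R (?Y z * u ^ X (Suc k) z) = F (restrict (inar_coord z) A) * G (restrict (inar_coord z) B)"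
        unfolding FX GX by (auto simp: indicator_def)
    qed
    also have "\<dots> = (\<integral>z. F (restrict (inar_coord z) A) \<partial>?P) * (exp (lam * (u - 1)) * ?q ^ x)"
      by (subst indep_var_lebesgue_integral[OF ind2 intF intG]) (simp only: EG)
    also have "\<dots> = (\<integral>z. F (restrict (inar_coord z) A) * (exp (lam * (u - 1)) * ?q ^ x) \<partial>?P)"
      using intF by simp
    also have "\<dots> = (\<integral>z. indicator {x} (X k z) *\<^sub>R ((?Y z * ?q ^ X k z) * exp (lam * (u - 1))) \<partial>?P)"
      unfolding FX by (intro Bochner_Integration.integral_cong refl) (auto simp: indicator_def)
    finally show "(\<integral>z. indicator {x} (X k z) *\<^sub>R (?Y z * u ^ X (Suc k) z) \<partial>?P)
      = (\<integral>z. indicator {x} (X k z) *\<^sub>R ((?Y z * ?q ^ X k z) * exp (lam * (u - 1))) \<partial>?P)" .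
  qed
  then show ?thesis by simp
qed


lemma inar_pgf_initial:
  fixes u :: complex
  assumes lam: "0 < lam" and a: "0 < a" "a < 1" and u: "norm u \<le> 1"
  shows "(\<integral>z. u ^ inar_path (inar_coord z) 0 \<partial>inar_input_law lam a) = exp (complex_of_real (lam / (1 - a)) * (u - 1))"
proof -
  have "(\<integral>z. u ^ inar_path (inar_coord z) 0 \<partial>inar_input_law lam a)
    = (\<integral>m. u ^ m \<partial>distr (inar_input_law lam a) (count_space UNIV) (\<lambda>z. inar_coord z (0, 0)))"
    by (subst integral_distr) (auto intro: inar_coord_measurable_law simp: inar_idx_def)
  also have "\<dots> = (\<integral>m. u ^ m \<partial>measure_pmf (inar_marginal lam a (0, 0)))"
    by (subst inar_coord_law) (auto simp: inar_idx_def)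
  finally show ?thesis using integral_inar_marginal_power(1)[OF lam a u, of 0] by simp
qed

text \<open>Stationarity: the Poisson law with parameter \<open>\<lambda> / (1 - a)\<close> is preserved, since
\<open>a \<lambda> / (1 - a) + \<lambda> = \<lambda> / (1 - a)\<close>.\<close>

lemma inar_pgf:
  fixes u :: complex
  assumes lam: "0 < lam" and a: "0 < a" "a < 1" and u: "norm u \<le> 1"
  shows "(\<integral>z. u ^ inar_path (inar_coord z) k \<partial>inar_input_law lam a) = exp (complex_of_real (lam / (1 - a)) * (u - 1))"
  using u
proof (induction k arbitrary: u)
  case 0
  then show ?case by (rule inar_pgf_initial[OF lam a])
next
  case (Suc k)
  have q: "norm (1 + a * (u - 1)) \<le> 1" using norm_one_plus_thinned_le_1[of a "u - 1"] a Suc.prems by simp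
  have "(\<integral>z. u ^ inar_path (inar_coord z) (Suc k) \<partial>inar_input_law lam a)
     = exp (complex_of_real (lam / (1 - a)) * (1 + a * (u - 1) - 1)) * exp (lam * (u - 1))"
    using inar_step[OF lam a Suc.prems, of "\<lambda>_ _. 1" k] by (simp add: Suc.IH[OF q])
  also have "\<dots> = exp (complex_of_real (lam / (1 - a)) * (u - 1))"
  proof -
    have "complex_of_real (lam / (1 - a)) * (1 + a * (u - 1) - 1) + lam * (u - 1) = complex_of_real (lam / (1 - a) * a + lam) * (u - 1)"
      by (simp add: algebra_simps)
    also have "lam / (1 - a) * a + lam = lam / (1 - a)" using a by (simp add: field_simps)
    finally show ?thesis by (simp only: exp_add[symmetric])
  qed
  finally show ?case .
qed

text \<open>Repeated use of \<open>inar_step\<close> removes \<open>X\<^sub>n, X\<^sub>n\<^sub>-\<^sub>1, \<dots>\<close> one after the other; each removal updates the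
base of the remaining power by \<open>cf_rec\<close> and leaves a factor from the innovation. Combining these
factors with the one from the stationary initial law collapses the exponent to \<open>log_cf\<close>.\<close>

lemma inar_char_function:
  assumes lam: "0 < lam" and a: "0 < a" "a < 1"
  defines "X \<equiv> \<lambda>k z. inar_path (inar_coord z) k"
  shows "(\<integral>z. iexp (\<Sum>k=1..n. v k * (real (X k z) - lam / (1 - a))) \<partial>inar_input_law lam a)
    = exp (complex_of_real (lam / (1 - a)) * log_cf a (\<lambda>m. v (n - m)) n)"
proof -
  let ?P = "inar_input_law lam a" and ?D = "cf_rec a (\<lambda>m. v (n - m))"
  let ?\<mu> = "lam / (1 - a)"
  have D1: "norm (1 + ?D m) \<le> 1" for m by (rule norm_one_plus_cf_rec_le_1) (use a in auto)
  have rec: "(\<integral>z. (\<Prod>k=1..n. iexp (v k * real (X k z))) \<partial>?P)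
     = (\<integral>z. (\<Prod>k=1..n - m. iexp (v k * real (X k z))) * (1 + a * ?D m) ^ X (n - m) z \<partial>?P) * exp (lam * (\<Sum>j=1..m. ?D j))"
    if "m \<le> n" for m
    using that
  proof (induction m)
    case 0
    then show ?case by simp
  next
    case (Suc m)
    define k where "k = n - Suc m"
    have k: "n - m = Suc k" using Suc.prems by (simp add: k_def)
    have "(\<Prod>k=1..n - m. iexp (v k * real (X k z))) * (1 + a * ?D m) ^ X (n - m) z
      = (\<Prod>j=1..k. iexp (v j * real (X j z))) * (1 + ?D (Suc m)) ^ X (Suc k) z" for z
    proof -
      have "iexp (v (Suc k) * real (X (Suc k) z)) = iexp (v (Suc k)) ^ X (Suc k) z"
        by (simp add: exp_of_nat_mult[symmetric] mult_ac)
      then show ?thesis unfolding k by (simp add: k power_mult_distrib)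
    qed
    then have "(\<integral>z. (\<Prod>k=1..n - m. iexp (v k * real (X k z))) * (1 + a * ?D m) ^ X (n - m) z \<partial>?P)
      = (\<integral>z. (\<Prod>j=1..k. iexp (v j * real (X j z))) * (1 + ?D (Suc m)) ^ X (Suc k) z \<partial>?P)"
      by simp
    also have "\<dots> = (\<integral>z. (\<Prod>j=1..k. iexp (v j * real (X j z))) * (1 + a * ?D (Suc m)) ^ X k z \<partial>?P) * exp (lam * ?D (Suc m))"
      using inar_step[OF lam a D1, of "\<lambda>j x. iexp (v j * real x)" k "Suc m"] unfolding X_def by simp
    finally have "(\<integral>z. (\<Prod>k=1..n. iexp (v k * real (X k z))) \<partial>?P)
      = (\<integral>z. (\<Prod>j=1..k. iexp (v j * real (X j z))) * (1 + a * ?D (Suc m)) ^ X k z \<partial>?P)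
        * (exp (lam * ?D (Suc m)) * exp (lam * (\<Sum>j=1..m. ?D j)))"
      using Suc by simp
    also have "exp (lam * ?D (Suc m)) * exp (lam * (\<Sum>j=1..m. ?D j)) = exp (lam * (\<Sum>j=1..Suc m. ?D j))"
      by (simp add: exp_add[symmetric] algebra_simps)
    finally show ?case by (simp only: k_def)
  qed
  have q: "norm (1 + complex_of_real a * ?D n) \<le> 1" by (rule norm_one_plus_thinned_le_1[OF _ _ D1]) (use a in auto)
  have "(\<integral>z. (\<Prod>k=1..n. iexp (v k * real (X k z))) \<partial>?P) = exp (?\<mu> * (a * ?D n)) * exp (lam * (\<Sum>j=1..n. ?D j))"
    using rec[of n] inar_pgf_initial[OF lam a q] by (simp add: X_def)
  also have "\<dots> = exp (?\<mu> * (a * ?D n + (1 - a) * (\<Sum>j=1..n. ?D j)))"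
  proof -
    have "lam = ?\<mu> * (1 - a)" using a by simp
    then have "complex_of_real lam = complex_of_real ?\<mu> * (1 - complex_of_real a)"
      by (metis of_real_1 of_real_diff of_real_mult)
    then have "?\<mu> * (a * ?D n) + lam * (\<Sum>j=1..n. ?D j) = ?\<mu> * (a * ?D n + (1 - a) * (\<Sum>j=1..n. ?D j))"
      by (simp only: distrib_left mult.assoc of_real_diff of_real_1)
    then show ?thesis by (simp only: exp_add[symmetric])
  qed
  also have "a * ?D n + (1 - a) * (\<Sum>j=1..n. ?D j) = (\<Sum>m<n. (iexp (v (n - m)) - 1) * (1 + a * ?D m))"
  proof -
    have "a * ?D l + (1 - a) * (\<Sum>j=1..l. ?D j) = (\<Sum>m<l. (iexp (v (n - m)) - 1) * (1 + a * ?D m))" for l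
      by (induction l) (simp_all add: algebra_simps)
    then show ?thesis .
  qed
  finally have 1: "(\<integral>z. (\<Prod>k=1..n. iexp (v k * real (X k z))) \<partial>?P)
     = exp (?\<mu> * (\<Sum>m<n. (iexp (v (n - m)) - 1) * (1 + a * ?D m)))" .
  have sumv: "(\<Sum>k=1..n. v k) = (\<Sum>m<n. v (n - m))"
    by (rule sum.reindex_bij_witness[of _ "\<lambda>m. n - m" "\<lambda>k. n - k"]) auto
  have "iexp (\<Sum>k=1..n. v k * (real (X k z) - ?\<mu>)) = (\<Prod>k=1..n. iexp (v k * real (X k z))) * exp (- (\<i> * ?\<mu> * (\<Sum>m<n. v (n - m))))" for z
  proof -
    have "(\<Sum>k=1..n. v k * (real (X k z) - ?\<mu>)) = (\<Sum>k=1..n. v k * real (X k z)) - ?\<mu> * (\<Sum>m<n. v (n - m))"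
      unfolding sumv[symmetric] by (simp only: right_diff_distrib sum_subtractf sum_distrib_right[symmetric] mult.commute[of ?\<mu>])
    then have "iexp (\<Sum>k=1..n. v k * (real (X k z) - ?\<mu>)) = exp ((\<Sum>k=1..n. \<i> * complex_of_real (v k * real (X k z))) + (- (\<i> * ?\<mu> * (\<Sum>m<n. v (n - m)))))"
      by (simp add: sum_distrib_left right_diff_distrib mult.assoc del: of_real_mult) simp
    then show ?thesis by (simp only: exp_add exp_sum[OF finite_atLeastAtMost])
  qed
  then have "(\<integral>z. iexp (\<Sum>k=1..n. v k * (real (X k z) - ?\<mu>)) \<partial>?P)
    = (\<integral>z. (\<Prod>k=1..n. iexp (v k * real (X k z))) \<partial>?P) * exp (- (\<i> * ?\<mu> * (\<Sum>m<n. v (n - m))))"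
    by (simp only: integral_mult_left_zero)
  also have "\<dots> = exp (?\<mu> * log_cf a (\<lambda>m. v (n - m)) n)"
    unfolding 1 exp_add[symmetric] log_cf_def sum_subtractf
    by (simp add: sum_distrib_left sum_divide_distrib algebra_simps)
  finally show ?thesis .
qed

section \<open>Mixing over the random thinning parameter\<close>

text \<open>The mean is obtained from the generating function: \<open>(1 - u ^ X) / (1 - u)\<close> is the partial geometric
sum \<open>\<Sum>i<X. u ^ i\<close>, which increases to \<open>X\<close> as \<open>u \<up> 1\<close>.\<close>

lemma inar_mean:
  assumes lam: "0 < lam" and a: "0 < a" "a < 1"
  shows "(\<integral>\<^sup>+z. ennreal (real (inar_path (inar_coord z) k)) \<partial>inar_input_law lam a) = ennreal (lam / (1 - a))"
proof -
  interpret prob_space "inar_input_law lam a" by (rule prob_space_inar_input_law)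
  let ?P = "inar_input_law lam a" and ?\<mu> = "lam / (1 - a)"
  define X where "X z = inar_path (inar_coord z) k" for z
  have X[measurable]: "X \<in> ?P \<rightarrow>\<^sub>M count_space UNIV"
    unfolding X_def by (rule inar_path_measurable_law)
  define u where "u m = 1 - 1 / real (m + 2)" for m :: nat
  have u: "0 < u m" "u m < 1" for m by (auto simp: u_def field_simps)
  define f where "f m z = (\<Sum>i<X z. u m ^ i)" for m z
  have f_eq: "f m z = (1 - u m ^ X z) / (1 - u m)" for m z
    unfolding f_def using u[of m] by (simp add: sum_gp_strict)
  have mf: "f m \<in> borel_measurable ?P" for m
    unfolding f_eq[abs_def] by measurable
  have fnn: "0 \<le> f m z" for m z unfolding f_def using u[of m] by (intro sum_nonneg) auto
  have mono: "mono (\<lambda>m z. ennreal (f m z))"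
  proof (intro monoI le_funI ennreal_leI)
    fix m l :: nat and z assume "m \<le> l"
    then have "u m \<le> u l" by (simp add: u_def frac_le)
    then show "f m z \<le> f l z" unfolding f_def using u[of m] by (intro sum_mono power_mono) auto
  qed
  have lim: "(\<lambda>m. ennreal (f m z)) \<longlonglongrightarrow> ennreal (real (X z))" for z
  proof (rule tendsto_ennrealI)
    have "u \<longlonglongrightarrow> 1" unfolding u_def[abs_def] by real_asymp
    then have "(\<lambda>m. f m z) \<longlonglongrightarrow> (\<Sum>i<X z. 1 ^ i)" unfolding f_def by (intro tendsto_intros)
    then show "(\<lambda>m. f m z) \<longlonglongrightarrow> real (X z)" by simp
  qed
  have 1: "(\<lambda>m. \<integral>\<^sup>+z. ennreal (f m z) \<partial>?P) \<longlonglongrightarrow> (\<integral>\<^sup>+z. ennreal (real (X z)) \<partial>?P)"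
    using mono mf by (intro nn_integral_LIMSEQ lim) auto
  have int: "(\<integral>z. u m ^ X z \<partial>?P) = exp (- ?\<mu> * (1 - u m))" for m
  proof -
    have "complex_of_real (\<integral>z. u m ^ X z \<partial>?P) = (\<integral>z. complex_of_real (u m) ^ X z \<partial>?P)"
      by (simp flip: integral_complex_of_real)
    also have "\<dots> = exp (complex_of_real ?\<mu> * (complex_of_real (u m) - 1))"
      unfolding X_def by (rule inar_pgf[OF lam a]) (use u[of m] in auto)
    also have "\<dots> = complex_of_real (exp (- ?\<mu> * (1 - u m)))"
    proof -
      have "- ?\<mu> * (1 - u m) = ?\<mu> * (u m - 1)" by (metis minus_diff_eq minus_mult_commute)
      then show ?thesis by (simp only: exp_of_real[symmetric] of_real_mult of_real_diff of_real_1)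
    qed
    finally show ?thesis by (simp only: of_real_eq_iff)
  qed
  have powint: "integrable ?P (\<lambda>z. u m ^ X z)" for m
    by (rule integrable_const_bound[where B=1]) (use u[of m] in \<open>auto simp: power_le_one\<close>)
  have "(\<integral>\<^sup>+z. ennreal (f m z) \<partial>?P) = ennreal ((1 - exp (- ?\<mu> * (1 - u m))) / (1 - u m))" for m
  proof -
    have "(\<integral>\<^sup>+z. ennreal (f m z) \<partial>?P) = ennreal (\<integral>z. f m z \<partial>?P)"
      using powint fnn by (intro nn_integral_eq_integral) (auto simp: f_eq)
    also have "(\<integral>z. f m z \<partial>?P) = (1 - exp (- ?\<mu> * (1 - u m))) / (1 - u m)"
      unfolding f_eq using powint by (simp add: int prob_space)
    finally show ?thesis .
  qed
  moreover have "(\<lambda>m. (1 - exp (- ?\<mu> * (1 - u m))) / (1 - u m)) \<longlonglongrightarrow> ?\<mu>"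
  proof -
    have "0 < ?\<mu>" using lam a by simp
    then have "(\<lambda>m. (1 - exp (- c * (1 / real (m + 2)))) / (1 / real (m + 2))) \<longlonglongrightarrow> c" if "c = ?\<mu>" for c
      using that by real_asymp
    then show ?thesis by (simp add: u_def)
  qed
  ultimately have 2: "(\<lambda>m. \<integral>\<^sup>+z. ennreal (f m z) \<partial>?P) \<longlonglongrightarrow> ennreal ?\<mu>"
    by (simp only: tendsto_ennrealI)
  from LIMSEQ_unique[OF 1 2] show ?thesis by (simp add: X_def)
qed

lemma measurable_pmf_kernel:
  fixes p :: "'a \<Rightarrow> nat pmf"
  assumes "\<And>n. (\<lambda>a. pmf (p a) n) \<in> borel_measurable M"
  shows "(\<lambda>a. measure_pmf (p a)) \<in> M \<rightarrow>\<^sub>M prob_algebra (count_space UNIV)"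
proof (rule measurable_prob_algebraI)
  show "prob_space (measure_pmf (p a))" for a by (rule prob_space_measure_pmf)
  show "(\<lambda>a. measure_pmf (p a)) \<in> M \<rightarrow>\<^sub>M subprob_algebra (count_space UNIV)"
  proof (rule measurable_subprob_algebra)
    show "subprob_space (measure_pmf (p a))" for a by (rule measure_pmf.subprob_space_axioms)
    fix A :: "nat set"
    have "emeasure (measure_pmf (p a)) A = (\<Sum>n. ennreal (pmf (p a) n) * indicator A n)" for a
      by (subst nn_integral_pmf[symmetric]) (simp add: nn_integral_count_space_indicator nn_integral_count_space_nat)
    then show "(\<lambda>a. emeasure (measure_pmf (p a)) A) \<in> borel_measurable M"
      using assms by simp
  qed simp
qed

lemma measurable_PiM_kernel:
  assumes K: "K \<in> M \<rightarrow>\<^sub>M prob_algebra N"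
  shows "(\<lambda>a. \<Pi>\<^sub>M i\<in>I. K a) \<in> M \<rightarrow>\<^sub>M prob_algebra (\<Pi>\<^sub>M i\<in>I. N)"
proof (rule measurable_prob_algebra_generated[OF sets_PiM Int_stable_prod_algebra])
  have KP: "prob_space (K a)" "sets (K a) = sets N" if "a \<in> space M" for a
    using measurable_space[OF K that] by (auto simp: space_prob_algebra)
  show "prod_algebra I (\<lambda>_. N) \<subseteq> Pow (\<Pi>\<^sub>E i\<in>I. space N)" by (rule prod_algebra_sets_into_space)
  fix a assume a: "a \<in> space M"
  show "prob_space (\<Pi>\<^sub>M i\<in>I. K a)" by (intro prob_space_PiM KP a)
  show "sets (\<Pi>\<^sub>M i\<in>I. K a) = sets (\<Pi>\<^sub>M i\<in>I. N)" by (intro sets_PiM_cong KP a refl)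
next
  have KP: "prob_space (K a)" "sets (K a) = sets N" if "a \<in> space M" for a
    using measurable_space[OF K that] by (auto simp: space_prob_algebra)
  fix A assume "A \<in> prod_algebra I (\<lambda>_. N)"
  then obtain J E where A: "A = prod_emb I (\<lambda>_. N) J (\<Pi>\<^sub>E j\<in>J. E j)" and J: "finite J" "J \<subseteq> I"
    and E: "\<And>i. i \<in> J \<Longrightarrow> E i \<in> sets N" by (rule prod_algebraE) auto
  have "emeasure (\<Pi>\<^sub>M i\<in>I. K a) A = (\<Prod>j\<in>J. emeasure (K a) (E j))" if a: "a \<in> space M" for a
  proof -
    have "A = prod_emb I (\<lambda>_. K a) J (\<Pi>\<^sub>E j\<in>J. E j)"
      unfolding A prod_emb_def using sets_eq_imp_space_eq[OF KP(2)[OF a]] by simp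
    then show ?thesis using J E KP[OF a] by (simp add: emeasure_PiM_emb)
  qed
  moreover have "(\<lambda>a. \<Prod>j\<in>J. emeasure (K a) (E j)) \<in> borel_measurable M"
    using E by (intro borel_measurable_prod_ennreal measurable_compose[OF measurable_prob_algebraD[OF K] measurable_emeasure_subprob_algebra])
  ultimately show "(\<lambda>a. emeasure (\<Pi>\<^sub>M i\<in>I. K a) A) \<in> borel_measurable M"
    by (simp cong: measurable_cong)
qed

text \<open>Only parameters in \<open>(0,1)\<close> are relevant; the arbitrary value \<open>1 / 2\<close> elsewhere makes this a probability
kernel on the whole real line.\<close>

definition inar_kernel :: "real \<Rightarrow> real \<Rightarrow> (nat \<times> (nat \<times> nat \<Rightarrow> nat) \<times> (nat \<Rightarrow> nat)) measure" where
  "inar_kernel lam a = inar_input_law lam (if 0 < a \<and> a < 1 then a else 1 / 2)"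

lemma measurable_inar_kernel:
  assumes lam: "0 < lam"
  shows "inar_kernel lam \<in> borel \<rightarrow>\<^sub>M prob_algebra inar_input_space"
proof -
  define b where "b a = (if 0 < a \<and> a < 1 then a else 1 / 2 :: real)" for a
  have b: "0 < b a" "b a < 1" for a by (auto simp: b_def)
  have [measurable]: "b \<in> borel_measurable borel" unfolding b_def by measurable
  have 1: "(\<lambda>a. measure_pmf (poisson_pmf (lam / (1 - b a)))) \<in> borel \<rightarrow>\<^sub>M prob_algebra (count_space UNIV)"
    using lam b by (intro measurable_pmf_kernel) simp
  have 2: "(\<lambda>a. measure_pmf (map_pmf of_bool (bernoulli_pmf (b a)) :: nat pmf)) \<in> borel \<rightarrow>\<^sub>M prob_algebra (count_space UNIV)"
  proof (rule measurable_pmf_kernel)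
    fix n :: nat
    have "pmf (map_pmf of_bool (bernoulli_pmf (b a))) n = (if n = 0 then 1 - b a else if n = 1 then b a else 0)" for a
    proof -
      have "pmf (map_pmf of_bool (bernoulli_pmf (b a))) n = measure (measure_pmf (bernoulli_pmf (b a))) (of_bool -` {n})"
        by (simp add: pmf_map)
      also have "of_bool -` {n} = (if n = 0 then {False} else if n = 1 then {True} else {})"
      proof (rule set_eqI)
        fix x :: bool
        show "x \<in> of_bool -` {n} \<longleftrightarrow> x \<in> (if n = 0 then {False} else if n = 1 then {True} else {})"
          by (cases x) auto
      qed
      finally show ?thesis using b[of a] by (simp add: measure_pmf_single)
    qed
    then show "(\<lambda>a. pmf (map_pmf of_bool (bernoulli_pmf (b a))) n) \<in> borel_measurable borel" by simp
  qed
  have 3: "(\<lambda>a. measure_pmf (poisson_pmf lam)) \<in> borel \<rightarrow>\<^sub>M prob_algebra (count_space UNIV)"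
    by (intro measurable_pmf_kernel) simp
  have "(\<lambda>a. inar_input_law lam (b a)) \<in> borel \<rightarrow>\<^sub>M prob_algebra inar_input_space"
    unfolding inar_input_law_def inar_input_space_def
    by (rule measurable_pair_prob[OF 1 measurable_pair_prob[OF measurable_PiM_kernel[OF 2] measurable_PiM_kernel[OF 3]]])
  moreover have "inar_kernel lam = (\<lambda>a. inar_input_law lam (b a))"
    by (rule ext) (simp only: inar_kernel_def b_def)
  ultimately show ?thesis by (simp only:)
qed

text \<open>A conditional distribution given through conditional expectations of indicators determines the
joint law: on rectangles \<open>S \<times> C\<close> both sides are \<open>E[1\<^sub>S(Y) \<kappa>(Y)(C)]\<close>, by the defining property of the
conditional expectation.\<close>

lemma joint_law_eq_bind:
  assumes M: "prob_space M" and cd: "has_cond_distr M Y L Z \<kappa>"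
    and K: "K \<in> borel \<rightarrow>\<^sub>M prob_algebra L" and eq: "\<And>\<omega>. \<omega> \<in> space M \<Longrightarrow> \<kappa> (Y \<omega>) = K (Y \<omega>)"
  shows "distr M (borel \<Otimes>\<^sub>M L) (\<lambda>\<omega>. (Y \<omega>, Z \<omega>)) = M \<bind> (\<lambda>\<omega>. distr (K (Y \<omega>)) (borel \<Otimes>\<^sub>M L) (\<lambda>z. (Y \<omega>, z)))"
    and "(\<lambda>\<omega>. distr (K (Y \<omega>)) (borel \<Otimes>\<^sub>M L) (\<lambda>z. (Y \<omega>, z))) \<in> M \<rightarrow>\<^sub>M prob_algebra (borel \<Otimes>\<^sub>M L)"
proof -
  interpret prob_space M by fact
  have Y[measurable]: "Y \<in> borel_measurable M" and Z[measurable]: "Z \<in> M \<rightarrow>\<^sub>M L"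
    and c: "\<And>C. C \<in> sets L \<Longrightarrow> AE \<omega> in M. real_cond_exp M (sigma_gen M Y) (indicator (Z -` C \<inter> space M)) \<omega> = measure (\<kappa> (Y \<omega>)) C"
    using cd by (auto simp: has_cond_distr_def)
  let ?N = "\<lambda>\<omega>. distr (K (Y \<omega>)) (borel \<Otimes>\<^sub>M L) (\<lambda>z. (Y \<omega>, z))"
  have KY: "(\<lambda>\<omega>. K (Y \<omega>)) \<in> M \<rightarrow>\<^sub>M prob_algebra L" by (rule measurable_compose[OF Y K])
  show N: "?N \<in> M \<rightarrow>\<^sub>M prob_algebra (borel \<Otimes>\<^sub>M L)"
    by (rule measurable_distr_prob_space2[OF KY]) simp
  have ne: "space M \<noteq> {}" by (rule not_empty)
  have KP: "prob_space (K (Y \<omega>))" "sets (K (Y \<omega>)) = sets L" if "\<omega> \<in> space M" for \<omega>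
    using measurable_space[OF KY that] by (auto simp: space_prob_algebra)
  have subalg: "subalgebra M (sigma_gen M Y)"
    unfolding subalgebra_def sigma_gen_def using Y by (auto simp: sets_vimage_algebra2 dest: measurable_sets)
  have YF: "Y \<in> borel_measurable (sigma_gen M Y)"
    unfolding sigma_gen_def by (rule measurable_vimage_algebra1) auto
  interpret F: finite_measure_subalgebra M "sigma_gen M Y"
    by unfold_locales (rule subalg)
  have rect: "emeasure (distr M (borel \<Otimes>\<^sub>M L) (\<lambda>\<omega>. (Y \<omega>, Z \<omega>))) (S \<times> C) = emeasure (M \<bind> ?N) (S \<times> C)"
    if S[measurable]: "S \<in> sets borel" and C[measurable]: "C \<in> sets L" for S C
  proof -
    have SC: "S \<times> C \<in> sets (borel \<Otimes>\<^sub>M L)" using S C by (rule pair_measureI)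
    have "emeasure (distr M (borel \<Otimes>\<^sub>M L) (\<lambda>\<omega>. (Y \<omega>, Z \<omega>))) (S \<times> C) = emeasure M ((Y -` S \<inter> space M) \<inter> (Z -` C \<inter> space M))"
      by (subst emeasure_distr[OF _ SC]) (auto intro!: arg_cong[of _ _ "emeasure M"])
    also have "\<dots> = ennreal (\<integral>\<omega>. indicator S (Y \<omega>) * indicator (Z -` C \<inter> space M) \<omega> \<partial>M)"
    proof -
      have "emeasure M ((Y -` S \<inter> space M) \<inter> (Z -` C \<inter> space M)) = ennreal (\<integral>\<omega>. indicator ((Y -` S \<inter> space M) \<inter> (Z -` C \<inter> space M)) \<omega> \<partial>M)"
        by (simp add: emeasure_eq_measure Int_ac)
      also have "(\<integral>\<omega>. indicator ((Y -` S \<inter> space M) \<inter> (Z -` C \<inter> space M)) \<omega> \<partial>M) = (\<integral>\<omega>. indicator S (Y \<omega>) * indicator (Z -` C \<inter> space M) \<omega> \<partial>M :: real)"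
        by (intro Bochner_Integration.integral_cong) (auto simp: indicator_def)
      finally show ?thesis .
    qed
    also have "(\<integral>\<omega>. indicator S (Y \<omega>) * indicator (Z -` C \<inter> space M) \<omega> \<partial>M :: real)
      = (\<integral>\<omega>. indicator S (Y \<omega>) * real_cond_exp M (sigma_gen M Y) (indicator (Z -` C \<inter> space M)) \<omega> \<partial>M)"
    proof (rule F.real_cond_exp_intg(2)[symmetric])
      show "(\<lambda>\<omega>. indicat_real S (Y \<omega>)) \<in> borel_measurable (sigma_gen M Y)"
        using YF by measurable
      show "(indicator (Z -` C \<inter> space M) :: _ \<Rightarrow> real) \<in> borel_measurable M" by measurable
      show "integrable M (\<lambda>\<omega>. indicat_real S (Y \<omega>) * indicator (Z -` C \<inter> space M) \<omega>)"
        by (rule integrable_const_bound[where B=1]) (auto simp: indicator_def)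
    qed
    also have "\<dots> = (\<integral>\<omega>. indicator S (Y \<omega>) * measure (K (Y \<omega>)) C \<partial>M)"
    proof (rule integral_cong_AE)
      show "(\<lambda>\<omega>. indicator S (Y \<omega>) * real_cond_exp M (sigma_gen M Y) (indicator (Z -` C \<inter> space M)) \<omega>) \<in> borel_measurable M"
        by measurable
      show "(\<lambda>\<omega>. indicator S (Y \<omega>) * measure (K (Y \<omega>)) C) \<in> borel_measurable M"
        using measurable_compose[OF KY measurable_measure_prob_algebra[OF C]] by measurable
      show "AE \<omega> in M. indicat_real S (Y \<omega>) * real_cond_exp M (sigma_gen M Y) (indicator (Z -` C \<inter> space M)) \<omega> = indicator S (Y \<omega>) * measure (K (Y \<omega>)) C"
        using c[OF C] AE_space by eventually_elim (simp add: eq)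
    qed
    also have "ennreal \<dots> = (\<integral>\<^sup>+\<omega>. ennreal (indicator S (Y \<omega>) * measure (K (Y \<omega>)) C) \<partial>M)"
    proof (rule nn_integral_eq_integral[symmetric])
      have m: "(\<lambda>\<omega>. measure (K (Y \<omega>)) C) \<in> borel_measurable M"
        by (rule measurable_compose[OF KY measurable_measure_prob_algebra[OF C]])
      have "AE \<omega> in M. norm (indicator S (Y \<omega>) * measure (K (Y \<omega>)) C) \<le> 1"
        using AE_space by eventually_elim (auto simp: indicator_def prob_space.prob_le_1[OF KP(1)])
      then show "integrable M (\<lambda>\<omega>. indicator S (Y \<omega>) * measure (K (Y \<omega>)) C)"
        using m by (intro integrable_const_bound[where B=1]) auto
    qed auto
    also have "\<dots> = (\<integral>\<^sup>+\<omega>. emeasure (?N \<omega>) (S \<times> C) \<partial>M)"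
    proof (rule nn_integral_cong)
      fix \<omega> assume \<omega>: "\<omega> \<in> space M"
      interpret K: prob_space "K (Y \<omega>)" by (rule KP[OF \<omega>])
      have "(\<lambda>z. (Y \<omega>, z)) \<in> K (Y \<omega>) \<rightarrow>\<^sub>M borel \<Otimes>\<^sub>M L"
        by (subst measurable_cong_sets[OF KP(2)[OF \<omega>] refl]) simp
      then have "emeasure (?N \<omega>) (S \<times> C) = emeasure (K (Y \<omega>)) ((\<lambda>z. (Y \<omega>, z)) -` (S \<times> C) \<inter> space (K (Y \<omega>)))"
        by (rule emeasure_distr[OF _ SC])
      also have "(\<lambda>z. (Y \<omega>, z)) -` (S \<times> C) \<inter> space (K (Y \<omega>)) = (if Y \<omega> \<in> S then C else {})"
        using sets.sets_into_space[OF C] sets_eq_imp_space_eq[OF KP(2)[OF \<omega>]] by auto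
      also have "emeasure (K (Y \<omega>)) (if Y \<omega> \<in> S then C else {}) = ennreal (indicator S (Y \<omega>) * measure (K (Y \<omega>)) C)"
        by (simp add: K.emeasure_eq_measure)
      finally show "ennreal (indicator S (Y \<omega>) * measure (K (Y \<omega>)) C) = emeasure (?N \<omega>) (S \<times> C)" by simp
    qed
    also have "\<dots> = emeasure (M \<bind> ?N) (S \<times> C)"
      by (rule emeasure_bind[OF ne measurable_prob_algebraD[OF N] SC, symmetric])
    finally show ?thesis .
  qed
  have sb: "sets (M \<bind> ?N) = sets (borel \<Otimes>\<^sub>M L)"
    by (rule sets_bind[OF _ ne]) simp
  show "distr M (borel \<Otimes>\<^sub>M L) (\<lambda>\<omega>. (Y \<omega>, Z \<omega>)) = M \<bind> ?N"
  proof (rule measure_eqI_generator_eq[where E="{A \<times> B | A B. A \<in> sets borel \<and> B \<in> sets L}" and \<Omega>="space (borel :: real measure) \<times> space L" and A="\<lambda>_. space borel \<times> space L"])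
    show "Int_stable {A \<times> B | A B. A \<in> sets (borel :: real measure) \<and> B \<in> sets L}" by (rule Int_stable_pair_measure_generator)
    show "{A \<times> B | A B. A \<in> sets borel \<and> B \<in> sets L} \<subseteq> Pow (space (borel :: real measure) \<times> space L)" by (rule pair_measure_closed)
    show "emeasure (distr M (borel \<Otimes>\<^sub>M L) (\<lambda>\<omega>. (Y \<omega>, Z \<omega>))) X = emeasure (M \<bind> ?N) X"
      if "X \<in> {A \<times> B | A B. A \<in> sets borel \<and> B \<in> sets L}" for X using that rect by auto
    show "sets (distr M (borel \<Otimes>\<^sub>M L) (\<lambda>\<omega>. (Y \<omega>, Z \<omega>))) = sigma_sets (space borel \<times> space L) {A \<times> B | A B. A \<in> sets borel \<and> B \<in> sets L}"
      by (simp add: sets_pair_measure)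
    show "sets (M \<bind> ?N) = sigma_sets (space borel \<times> space L) {A \<times> B | A B. A \<in> sets borel \<and> B \<in> sets L}"
      unfolding sb by (rule sets_pair_measure)
    interpret J: prob_space "distr M (borel \<Otimes>\<^sub>M L) (\<lambda>\<omega>. (Y \<omega>, Z \<omega>))" by (rule prob_space_distr) simp
    show "emeasure (distr M (borel \<Otimes>\<^sub>M L) (\<lambda>\<omega>. (Y \<omega>, Z \<omega>))) (space borel \<times> space L) \<noteq> \<infinity>" by simp
    have "space (borel :: real measure) \<times> space L \<in> {A \<times> B | A B. A \<in> sets borel \<and> B \<in> sets L}"
      using sets.top by blast
    then show "range (\<lambda>_. space (borel :: real measure) \<times> space L) \<subseteq> {A \<times> B | A B. A \<in> sets borel \<and> B \<in> sets L}"
      by auto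
  qed auto
qed


lemma
  fixes f :: "real \<times> 's \<Rightarrow> ennreal" and g :: "real \<times> 's \<Rightarrow> real" and B :: real
  assumes M: "prob_space M" and cd: "has_cond_distr M Y L Z \<kappa>"
    and K: "K \<in> borel \<rightarrow>\<^sub>M prob_algebra L" and eq: "\<And>\<omega>. \<omega> \<in> space M \<Longrightarrow> \<kappa> (Y \<omega>) = K (Y \<omega>)"
  shows nn_integral_disintegrate:
      "f \<in> borel_measurable (borel \<Otimes>\<^sub>M L) \<Longrightarrow> (\<integral>\<^sup>+\<omega>. f (Y \<omega>, Z \<omega>) \<partial>M) = (\<integral>\<^sup>+\<omega>. \<integral>\<^sup>+z. f (Y \<omega>, z) \<partial>\<kappa> (Y \<omega>) \<partial>M)"
    and integral_disintegrate_real: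
      "g \<in> borel_measurable (borel \<Otimes>\<^sub>M L) \<Longrightarrow> (\<And>x. \<bar>g x\<bar> \<le> B) \<Longrightarrow>
        (\<integral>\<omega>. g (Y \<omega>, Z \<omega>) \<partial>M) = (\<integral>\<omega>. \<integral>z. g (Y \<omega>, z) \<partial>\<kappa> (Y \<omega>) \<partial>M)"
proof -
  interpret prob_space M by fact
  have Y[measurable]: "Y \<in> borel_measurable M" and Z[measurable]: "Z \<in> M \<rightarrow>\<^sub>M L"
    using cd by (auto simp: has_cond_distr_def)
  let ?N = "\<lambda>\<omega>. distr (K (Y \<omega>)) (borel \<Otimes>\<^sub>M L) (\<lambda>z. (Y \<omega>, z))"
  have J: "distr M (borel \<Otimes>\<^sub>M L) (\<lambda>\<omega>. (Y \<omega>, Z \<omega>)) = M \<bind> ?N" "?N \<in> M \<rightarrow>\<^sub>M prob_algebra (borel \<Otimes>\<^sub>M L)"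
    by (rule joint_law_eq_bind[OF assms]; assumption)+
  have N: "?N \<in> M \<rightarrow>\<^sub>M subprob_algebra (borel \<Otimes>\<^sub>M L)" by (rule measurable_prob_algebraD[OF J(2)])
  have NP: "prob_space (?N \<omega>)" if "\<omega> \<in> space M" for \<omega>
    using measurable_space[OF J(2) that] by (simp add: space_prob_algebra)
  have pm: "(\<lambda>z. (Y \<omega>, z)) \<in> K (Y \<omega>) \<rightarrow>\<^sub>M borel \<Otimes>\<^sub>M L" for \<omega>
  proof -
    have "sets (K (Y \<omega>)) = sets L" using measurable_space[OF K, of "Y \<omega>"] by (simp add: space_prob_algebra)
    then show ?thesis by (subst measurable_cong_sets[OF _ refl]) (auto intro: measurable_Pair1')
  qed
  show "(\<integral>\<^sup>+\<omega>. f (Y \<omega>, Z \<omega>) \<partial>M) = (\<integral>\<^sup>+\<omega>. \<integral>\<^sup>+z. f (Y \<omega>, z) \<partial>\<kappa> (Y \<omega>) \<partial>M)"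
    if f: "f \<in> borel_measurable (borel \<Otimes>\<^sub>M L)"
  proof -
    have "(\<integral>\<^sup>+\<omega>. f (Y \<omega>, Z \<omega>) \<partial>M) = (\<integral>\<^sup>+x. f x \<partial>distr M (borel \<Otimes>\<^sub>M L) (\<lambda>\<omega>. (Y \<omega>, Z \<omega>)))"
      using f by (subst nn_integral_distr) auto
    also have "\<dots> = (\<integral>\<^sup>+\<omega>. \<integral>\<^sup>+x. f x \<partial>?N \<omega> \<partial>M)"
      by (subst J(1), rule nn_integral_bind[OF f N])
    also have "\<dots> = (\<integral>\<^sup>+\<omega>. \<integral>\<^sup>+z. f (Y \<omega>, z) \<partial>\<kappa> (Y \<omega>) \<partial>M)"
      using f pm by (intro nn_integral_cong) (simp add: eq nn_integral_distr)
    finally show ?thesis .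
  qed
  show "(\<integral>\<omega>. g (Y \<omega>, Z \<omega>) \<partial>M) = (\<integral>\<omega>. \<integral>z. g (Y \<omega>, z) \<partial>\<kappa> (Y \<omega>) \<partial>M)"
    if g: "g \<in> borel_measurable (borel \<Otimes>\<^sub>M L)" and B: "\<And>x. \<bar>g x\<bar> \<le> B"
  proof -
    have "(\<integral>\<omega>. g (Y \<omega>, Z \<omega>) \<partial>M) = (\<integral>x. g x \<partial>distr M (borel \<Otimes>\<^sub>M L) (\<lambda>\<omega>. (Y \<omega>, Z \<omega>)))"
      by (rule integral_distr[OF _ g, symmetric]) simp
    also have "\<dots> = (\<integral>\<omega>. \<integral>x. g x \<partial>?N \<omega> \<partial>M)"
    proof (subst J(1), rule integral_bind[OF g B N finite_measure_axioms])
      show "AE \<omega> in M. emeasure (?N \<omega>) (space (?N \<omega>)) \<le> ennreal 1"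
        using AE_space by eventually_elim (subst prob_space.emeasure_space_1[OF NP], auto)
    qed
    also have "\<dots> = (\<integral>\<omega>. \<integral>z. g (Y \<omega>, z) \<partial>\<kappa> (Y \<omega>) \<partial>M)"
      using g pm by (intro Bochner_Integration.integral_cong refl) (simp add: eq integral_distr)
    finally show ?thesis .
  qed
qed

lemma integral_disintegrate_complex:
  fixes g :: "real \<times> 's \<Rightarrow> complex"
  assumes M: "prob_space M" and cd: "has_cond_distr M Y L Z \<kappa>"
    and K: "K \<in> borel \<rightarrow>\<^sub>M prob_algebra L" and eq: "\<And>\<omega>. \<omega> \<in> space M \<Longrightarrow> \<kappa> (Y \<omega>) = K (Y \<omega>)"
    and g[measurable]: "g \<in> borel_measurable (borel \<Otimes>\<^sub>M L)" and B: "\<And>x. norm (g x) \<le> B"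
  shows "(\<integral>\<omega>. g (Y \<omega>, Z \<omega>) \<partial>M) = (\<integral>\<omega>. \<integral>z. g (Y \<omega>, z) \<partial>\<kappa> (Y \<omega>) \<partial>M)"
    and "(\<lambda>\<omega>. \<integral>z. g (Y \<omega>, z) \<partial>\<kappa> (Y \<omega>)) \<in> borel_measurable M"
proof -
  interpret prob_space M by fact
  have Y[measurable]: "Y \<in> borel_measurable M" and Z[measurable]: "Z \<in> M \<rightarrow>\<^sub>M L"
    using cd by (auto simp: has_cond_distr_def)
  have KP: "prob_space (K a)" "sets (K a) = sets L" for a
    using measurable_space[OF K, of a] by (auto simp: space_prob_algebra)
  have B0: "0 \<le> B" using B order_trans norm_ge_zero by blast
  have gm: "(\<lambda>z. g (a, z)) \<in> borel_measurable (K a)" for a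
    by (subst measurable_cong_sets[OF KP(2) refl]) simp
  have gint: "integrable (K a) (\<lambda>z. g (a, z))" for a
  proof -
    interpret K: prob_space "K a" by (rule KP)
    show ?thesis using gm B by (intro K.integrable_const_bound[where B=B]) auto
  qed
  have inner_le: "norm (\<integral>z. g (a, z) \<partial>K a) \<le> B" for a
  proof -
    interpret K: prob_space "K a" by (rule KP)
    have "norm (\<integral>z. g (a, z) \<partial>K a) \<le> (\<integral>z. norm (g (a, z)) \<partial>K a)" by (rule integral_norm_bound)
    also have "\<dots> \<le> (\<integral>z. B \<partial>K a)" using gint[of a] B by (intro integral_mono) auto
    finally show ?thesis by (simp add: K.prob_space)
  qed
  have mK: "(\<lambda>a. \<integral>z. h (a, z) \<partial>K a) \<in> borel_measurable borel" if h: "h \<in> borel_measurable (borel \<Otimes>\<^sub>M L)" for h :: "real \<times> 's \<Rightarrow> real"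
  proof -
    have N: "(\<lambda>a. distr (K a) (borel \<Otimes>\<^sub>M L) (\<lambda>z. (a, z))) \<in> borel \<rightarrow>\<^sub>M prob_algebra (borel \<Otimes>\<^sub>M L)"
      by (rule measurable_distr_prob_space2[OF K]) simp
    have "(\<lambda>a. \<integral>x. h x \<partial>distr (K a) (borel \<Otimes>\<^sub>M L) (\<lambda>z. (a, z))) \<in> borel_measurable borel"
      by (rule measurable_compose[OF measurable_prob_algebraD[OF N] integral_measurable_subprob_algebra[OF h]])
    moreover have "(\<integral>x. h x \<partial>distr (K a) (borel \<Otimes>\<^sub>M L) (\<lambda>z. (a, z))) = (\<integral>z. h (a, z) \<partial>K a)" for a
      by (rule integral_distr[OF _ h]) (subst measurable_cong_sets[OF KP(2) refl], simp)
    ultimately show ?thesis by simp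
  qed
  have Re: "Re (\<integral>z. g (a, z) \<partial>K a) = (\<integral>z. Re (g (a, z)) \<partial>K a)" and Im: "Im (\<integral>z. g (a, z) \<partial>K a) = (\<integral>z. Im (g (a, z)) \<partial>K a)" for a
    using gint[of a] by simp_all
  have mK2: "(\<lambda>a. \<integral>z. g (a, z) \<partial>K a) \<in> borel_measurable borel"
    unfolding borel_measurable_complex_iff Re Im by (auto intro!: mK[of "\<lambda>x. Re (g x)"] mK[of "\<lambda>x. Im (g x)"])
  have "(\<lambda>\<omega>. \<integral>z. g (Y \<omega>, z) \<partial>K (Y \<omega>)) \<in> borel_measurable M"
    by (rule measurable_compose[OF Y mK2])
  then show m: "(\<lambda>\<omega>. \<integral>z. g (Y \<omega>, z) \<partial>\<kappa> (Y \<omega>)) \<in> borel_measurable M"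
    by (simp add: eq cong: measurable_cong)
  have int1: "integrable M (\<lambda>\<omega>. g (Y \<omega>, Z \<omega>))"
    using B by (intro integrable_const_bound[where B=B]) auto
  have int2: "integrable M (\<lambda>\<omega>. \<integral>z. g (Y \<omega>, z) \<partial>\<kappa> (Y \<omega>))"
  proof (rule integrable_const_bound[OF _ m, where B=B])
    show "AE \<omega> in M. norm (\<integral>z. g (Y \<omega>, z) \<partial>\<kappa> (Y \<omega>)) \<le> B"
      using AE_space by eventually_elim (simp add: eq inner_le)
  qed
  have absRe: "\<bar>Re (g x)\<bar> \<le> B" "\<bar>Im (g x)\<bar> \<le> B" for x
    using B[of x] abs_Re_le_cmod[of "g x"] abs_Im_le_cmod[of "g x"] by linarith+
  show "(\<integral>\<omega>. g (Y \<omega>, Z \<omega>) \<partial>M) = (\<integral>\<omega>. \<integral>z. g (Y \<omega>, z) \<partial>\<kappa> (Y \<omega>) \<partial>M)"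
  proof (rule complex_eqI)
    have "Re (\<integral>\<omega>. g (Y \<omega>, Z \<omega>) \<partial>M) = (\<integral>\<omega>. Re (g (Y \<omega>, Z \<omega>)) \<partial>M)" using int1 by simp
    also have "\<dots> = (\<integral>\<omega>. \<integral>z. Re (g (Y \<omega>, z)) \<partial>\<kappa> (Y \<omega>) \<partial>M)"
      by (rule integral_disintegrate_real[OF M cd K eq, where g="\<lambda>x. Re (g x)" and B=B]) (auto intro: absRe)
    also have "\<dots> = (\<integral>\<omega>. Re (\<integral>z. g (Y \<omega>, z) \<partial>\<kappa> (Y \<omega>)) \<partial>M)"
      by (intro Bochner_Integration.integral_cong refl) (simp add: eq Re)
    finally show "Re (\<integral>\<omega>. g (Y \<omega>, Z \<omega>) \<partial>M) = Re (\<integral>\<omega>. \<integral>z. g (Y \<omega>, z) \<partial>\<kappa> (Y \<omega>) \<partial>M)"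
      using int2 by simp
    have "Im (\<integral>\<omega>. g (Y \<omega>, Z \<omega>) \<partial>M) = (\<integral>\<omega>. Im (g (Y \<omega>, Z \<omega>)) \<partial>M)" using int1 by simp
    also have "\<dots> = (\<integral>\<omega>. \<integral>z. Im (g (Y \<omega>, z)) \<partial>\<kappa> (Y \<omega>) \<partial>M)"
      by (rule integral_disintegrate_real[OF M cd K eq, where g="\<lambda>x. Im (g x)" and B=B]) (auto intro: absRe)
    also have "\<dots> = (\<integral>\<omega>. Im (\<integral>z. g (Y \<omega>, z) \<partial>\<kappa> (Y \<omega>)) \<partial>M)"
      by (intro Bochner_Integration.integral_cong refl) (simp add: eq Im)
    finally show "Im (\<integral>\<omega>. g (Y \<omega>, Z \<omega>) \<partial>M) = Im (\<integral>\<omega>. \<integral>z. g (Y \<omega>, z) \<partial>\<kappa> (Y \<omega>) \<partial>M)"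
      using int2 by simp
  qed
qed


lemma randomized_INAR1_input:
  assumes "randomized_INAR1 M lam \<alpha> X"
  obtains Z where "has_cond_distr M \<alpha> inar_input_space Z (inar_input_law lam)"
    and "\<And>k \<omega>. \<omega> \<in> space M \<Longrightarrow> X k \<omega> = inar_path (inar_coord (Z \<omega>)) k"
proof -
  obtain \<xi> \<epsilon> where cd: "has_cond_distr M \<alpha> inar_input_space
      (\<lambda>\<omega>. (X 0 \<omega>, \<lambda>(k, i)\<in>{1..} \<times> {1..}. \<xi> k i \<omega>, \<lambda>k\<in>{1..}. \<epsilon> k \<omega>)) (inar_input_law lam)"
    and rec: "\<And>k \<omega>. 1 \<le> k \<Longrightarrow> \<omega> \<in> space M \<Longrightarrow> X k \<omega> = (\<Sum>i = 1..X (k - 1) \<omega>. \<xi> k i \<omega>) + \<epsilon> k \<omega>"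
    using assms unfolding randomized_INAR1_def by auto
  define Z where "Z \<omega> = (X 0 \<omega>, \<lambda>(k, i)\<in>{1..} \<times> {1..}. \<xi> k i \<omega>, \<lambda>k\<in>{1..}. \<epsilon> k \<omega>)" for \<omega>
  have path: "X k \<omega> = inar_path (inar_coord (Z \<omega>)) k" if \<omega>: "\<omega> \<in> space M" for k \<omega>
  proof (induction k)
    case 0
    show ?case by (simp add: inar_coord_def Z_def)
  next
    case (Suc k)
    have "inar_coord (Z \<omega>) (Suc k, i) = \<xi> (Suc k) i \<omega>" if "1 \<le> i" for i
      using that by (simp add: inar_coord_def Z_def)
    moreover have "inar_coord (Z \<omega>) (Suc k, 0) = \<epsilon> (Suc k) \<omega>"
      by (simp add: inar_coord_def Z_def)
    ultimately show ?case using rec[OF _ \<omega>, of "Suc k"] Suc by simp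
  qed
  have "Z = (\<lambda>\<omega>. (X 0 \<omega>, \<lambda>(k, i)\<in>{1..} \<times> {1..}. \<xi> k i \<omega>, \<lambda>k\<in>{1..}. \<epsilon> k \<omega>))"
    by (rule ext) (rule Z_def)
  with cd have "has_cond_distr M \<alpha> inar_input_space Z (inar_input_law lam)" by (simp only:)
  then show thesis using path by (rule that)
qed

abbreviation path_space :: "(real \<times> (nat \<Rightarrow> nat)) measure" where
  "path_space \<equiv> borel \<Otimes>\<^sub>M (\<Pi>\<^sub>M k\<in>UNIV. count_space UNIV)"

lemma measurable_inar_path_process:
  "(\<lambda>z k. inar_path (inar_coord z) k) \<in> inar_input_space \<rightarrow>\<^sub>M (\<Pi>\<^sub>M k\<in>UNIV. count_space UNIV)"
proof (rule measurable_PiM_single')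
  show "(\<lambda>z. inar_path (inar_coord z) k) \<in> inar_input_space \<rightarrow>\<^sub>M count_space UNIV" for k
    using inar_path_measurable_law measurable_cong_sets[OF sets_inar_input_law refl] by blast
qed (auto simp: space_PiM)

context
  fixes M :: "'w measure" and lam :: real and \<alpha> :: "'w \<Rightarrow> real" and X :: "nat \<Rightarrow> 'w \<Rightarrow> nat"
  assumes lam: "0 < lam" and INAR: "randomized_INAR1 M lam \<alpha> X"
begin

lemma INAR_alpha: "\<omega> \<in> space M \<Longrightarrow> 0 < \<alpha> \<omega> \<and> \<alpha> \<omega> < 1"
  using INAR unfolding randomized_INAR1_def by auto

lemma INAR_kernel: "\<omega> \<in> space M \<Longrightarrow> inar_input_law lam (\<alpha> \<omega>) = inar_kernel lam (\<alpha> \<omega>)"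
  using INAR_alpha by (simp add: inar_kernel_def)

lemma INAR_prob_space: "prob_space M"
  using INAR unfolding randomized_INAR1_def by auto

lemma INAR_integral:
  fixes g :: "real \<times> (nat \<Rightarrow> nat) \<Rightarrow> complex"
  assumes g: "g \<in> borel_measurable path_space" and B: "\<And>x. norm (g x) \<le> B"
  shows "(\<integral>\<omega>. g (\<alpha> \<omega>, \<lambda>k. X k \<omega>) \<partial>M) = (\<integral>\<omega>. \<integral>z. g (\<alpha> \<omega>, inar_path (inar_coord z)) \<partial>inar_input_law lam (\<alpha> \<omega>) \<partial>M)"
    and "(\<lambda>\<omega>. \<integral>z. g (\<alpha> \<omega>, inar_path (inar_coord z)) \<partial>inar_input_law lam (\<alpha> \<omega>)) \<in> borel_measurable M"
proof -
  obtain Z where cd: "has_cond_distr M \<alpha> inar_input_space Z (inar_input_law lam)"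
    and X: "\<And>k \<omega>. \<omega> \<in> space M \<Longrightarrow> X k \<omega> = inar_path (inar_coord (Z \<omega>)) k"
    using randomized_INAR1_input[OF INAR] by blast
  define h where "h x = g (fst x, inar_path (inar_coord (snd x)))" for x
  have hm: "h \<in> borel_measurable (borel \<Otimes>\<^sub>M inar_input_space)"
    unfolding h_def[abs_def]
    by (rule measurable_compose[OF measurable_Pair[OF measurable_fst measurable_compose[OF measurable_snd measurable_inar_path_process]] g])
  have hB: "norm (h x) \<le> B" for x unfolding h_def by (rule B)
  have "(\<integral>\<omega>. g (\<alpha> \<omega>, \<lambda>k. X k \<omega>) \<partial>M) = (\<integral>\<omega>. h (\<alpha> \<omega>, Z \<omega>) \<partial>M)"
    by (intro Bochner_Integration.integral_cong refl) (simp add: h_def X)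
  also have "\<dots> = (\<integral>\<omega>. \<integral>z. h (\<alpha> \<omega>, z) \<partial>inar_input_law lam (\<alpha> \<omega>) \<partial>M)"
    by (rule integral_disintegrate_complex(1)[OF INAR_prob_space cd measurable_inar_kernel[OF lam] INAR_kernel hm hB])
  finally show "(\<integral>\<omega>. g (\<alpha> \<omega>, \<lambda>k. X k \<omega>) \<partial>M) = (\<integral>\<omega>. \<integral>z. g (\<alpha> \<omega>, inar_path (inar_coord z)) \<partial>inar_input_law lam (\<alpha> \<omega>) \<partial>M)"
    by (simp add: h_def)
  have "(\<lambda>\<omega>. \<integral>z. h (\<alpha> \<omega>, z) \<partial>inar_input_law lam (\<alpha> \<omega>)) \<in> borel_measurable M"
    by (rule integral_disintegrate_complex(2)[OF INAR_prob_space cd measurable_inar_kernel[OF lam] INAR_kernel hm hB])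
  then show "(\<lambda>\<omega>. \<integral>z. g (\<alpha> \<omega>, inar_path (inar_coord z)) \<partial>inar_input_law lam (\<alpha> \<omega>)) \<in> borel_measurable M"
    by (simp add: h_def)
qed

text \<open>The integrated form of \<open>E(X\<^sub>k | \<alpha>) = \<lambda> / (1 - \<alpha>)\<close>. Nonnegative integrals are used because
integrability of \<open>X\<^sub>k\<close> is a consequence.\<close>

lemma INAR_conditional_mean:
  assumes S: "S \<in> sets borel"
  shows "(\<integral>\<^sup>+\<omega>. indicator S (\<alpha> \<omega>) * ennreal (real (X k \<omega>)) \<partial>M) = (\<integral>\<^sup>+\<omega>. indicator S (\<alpha> \<omega>) * ennreal (lam / (1 - \<alpha> \<omega>)) \<partial>M)"
proof -
  obtain Z where cd: "has_cond_distr M \<alpha> inar_input_space Z (inar_input_law lam)"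
    and X: "\<And>k \<omega>. \<omega> \<in> space M \<Longrightarrow> X k \<omega> = inar_path (inar_coord (Z \<omega>)) k"
    using randomized_INAR1_input[OF INAR] by blast
  define h where "h x = indicator S (fst x) * ennreal (real (inar_path (inar_coord (snd x)) k))" for x :: "real \<times> nat \<times> (nat \<times> nat \<Rightarrow> nat) \<times> (nat \<Rightarrow> nat)"
  have pm: "(\<lambda>z. inar_path (inar_coord z) k) \<in> inar_input_space \<rightarrow>\<^sub>M count_space UNIV"
    using inar_path_measurable_law measurable_cong_sets[OF sets_inar_input_law refl] by blast
  have hm: "h \<in> borel_measurable (borel \<Otimes>\<^sub>M inar_input_space)"
  proof -
    have [measurable]: "(\<lambda>x. ennreal (real (inar_path (inar_coord (snd x)) k))) \<in> borel_measurable (borel \<Otimes>\<^sub>M inar_input_space)"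
      by (rule measurable_compose[OF measurable_compose[OF measurable_snd pm]]) simp
    show ?thesis unfolding h_def[abs_def] using S by measurable
  qed
  have "(\<integral>\<^sup>+\<omega>. indicator S (\<alpha> \<omega>) * ennreal (real (X k \<omega>)) \<partial>M) = (\<integral>\<^sup>+\<omega>. h (\<alpha> \<omega>, Z \<omega>) \<partial>M)"
    by (intro nn_integral_cong) (simp add: h_def X)
  also have "\<dots> = (\<integral>\<^sup>+\<omega>. \<integral>\<^sup>+z. h (\<alpha> \<omega>, z) \<partial>inar_input_law lam (\<alpha> \<omega>) \<partial>M)"
    by (rule nn_integral_disintegrate[OF INAR_prob_space cd measurable_inar_kernel[OF lam] INAR_kernel hm])
  also have "\<dots> = (\<integral>\<^sup>+\<omega>. indicator S (\<alpha> \<omega>) * ennreal (lam / (1 - \<alpha> \<omega>)) \<partial>M)"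
  proof (rule nn_integral_cong)
    fix \<omega> assume \<omega>: "\<omega> \<in> space M"
    have "(\<lambda>z. ennreal (real (inar_path (inar_coord z) k))) \<in> borel_measurable (inar_input_law lam (\<alpha> \<omega>))"
      by (rule measurable_compose[OF inar_path_measurable_law]) simp
    then show "(\<integral>\<^sup>+z. h (\<alpha> \<omega>, z) \<partial>inar_input_law lam (\<alpha> \<omega>)) = indicator S (\<alpha> \<omega>) * ennreal (lam / (1 - \<alpha> \<omega>))"
      using inar_mean[OF lam, of "\<alpha> \<omega>" k] INAR_alpha[OF \<omega>] by (simp add: h_def nn_integral_cmult)
  qed
  finally show ?thesis .
qed

end

definition centered_sum :: "real \<Rightarrow> nat \<Rightarrow> real \<Rightarrow> real \<times> (nat \<Rightarrow> nat) \<Rightarrow> real" where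
  "centered_sum lam n t x = (\<Sum>k=1..nat \<lfloor>real n * t\<rfloor>. real (snd x k) - lam / (1 - fst x))"

definition long_run_variance :: "real \<Rightarrow> real \<Rightarrow> real" where
  "long_run_variance lam a = lam * (1 + a) / (1 - a)\<^sup>2"

lemma measurable_centered_sum[measurable]:
  "centered_sum lam n t \<in> borel_measurable path_space"
proof -
  have [measurable]: "(\<lambda>x. real (snd x k)) \<in> borel_measurable path_space" for k
  proof -
    have "(\<lambda>y. y k) \<in> (\<Pi>\<^sub>M k\<in>UNIV. count_space UNIV) \<rightarrow>\<^sub>M count_space (UNIV :: nat set)"
      by (rule measurable_component_singleton) simp
    from measurable_compose[OF measurable_snd this]
    have "(\<lambda>x. snd x k) \<in> path_space \<rightarrow>\<^sub>M count_space (UNIV :: nat set)" .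
    then show ?thesis by (rule measurable_compose) simp
  qed
  show ?thesis unfolding centered_sum_def[abs_def] by measurable
qed

lemma sum_centered_sum_eq:
  assumes T: "finite T" and R: "\<And>t. t \<in> T \<Longrightarrow> t \<le> real R"
  shows "(\<Sum>t\<in>T. u t * (c * centered_sum lam n t (a, x)))
    = (\<Sum>k=1..n * R. (c * step_weight T u (\<lambda>t. nat \<lfloor>real n * t\<rfloor>) k) * (real (x k) - lam / (1 - a)))"
proof -
  have p: "nat \<lfloor>real n * t\<rfloor> \<le> n * R" if "t \<in> T" for t
  proof -
    have "real n * t \<le> real n * real R" using R[OF that] by (intro mult_left_mono) auto
    then show ?thesis by (metis floor_mono floor_of_nat nat_int nat_mono of_nat_mult)
  qed
  have "centered_sum lam n t (a, x) = (\<Sum>k=1..n * R. of_bool (k \<le> nat \<lfloor>real n * t\<rfloor>) * (real (x k) - lam / (1 - a)))" if "t \<in> T" for t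
    unfolding centered_sum_def using p[OF that] by (intro sum.mono_neutral_cong_left) auto
  then have "(\<Sum>t\<in>T. u t * (c * centered_sum lam n t (a, x)))
    = (\<Sum>t\<in>T. \<Sum>k=1..n * R. u t * (c * (of_bool (k \<le> nat \<lfloor>real n * t\<rfloor>) * (real (x k) - lam / (1 - a)))))"
    by (intro sum.cong refl) (simp only: sum_distrib_left)
  also have "\<dots> = (\<Sum>k=1..n * R. \<Sum>t\<in>T. u t * (c * (of_bool (k \<le> nat \<lfloor>real n * t\<rfloor>) * (real (x k) - lam / (1 - a)))))"
    by (rule sum.swap)
  also have "\<dots> = (\<Sum>k=1..n * R. (c * step_weight T u (\<lambda>t. nat \<lfloor>real n * t\<rfloor>) k) * (real (x k) - lam / (1 - a)))"
    by (intro sum.cong refl) (simp only: step_weight_def sum_distrib_left sum_distrib_right mult.assoc mult.left_commute)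
  finally show ?thesis .
qed

text \<open>Conditionally on \<open>\<alpha>\<close> the exponent converges by \<open>log_cf_limit\<close>. Characteristic functions are bounded by
\<open>1\<close>, so dominated convergence allows integration over \<open>\<alpha>\<close>, even though the limiting variance may have
infinite mean.\<close>

lemma INAR_char_limit:
  assumes lam: "0 < lam" and INAR: "randomized_INAR1 M lam \<alpha> X" and T: "finite T" "T \<subseteq> {0..}"
  shows "(\<lambda>n. \<integral>\<omega>. iexp (\<Sum>t\<in>T. u t * (\<theta> / sqrt (real n) * centered_sum lam n t (\<alpha> \<omega>, \<lambda>k. X k \<omega>))) \<partial>M)
    \<longlonglongrightarrow> (\<integral>\<omega>. complex_of_real (exp (- (\<theta>\<^sup>2 * quad_min T u / 2 * long_run_variance lam (\<alpha> \<omega>)))) \<partial>M)"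
proof -
  interpret prob_space M by (rule INAR_prob_space[OF lam INAR])
  have \<alpha>m[measurable]: "\<alpha> \<in> borel_measurable M"
    using randomized_INAR1_input[OF INAR] unfolding has_cond_distr_def by blast
  obtain R :: nat where R: "\<And>t. t \<in> T \<Longrightarrow> t \<le> real R"
  proof -
    obtain R :: nat where "Max (insert 0 T) \<le> real R" using real_arch_simple by blast
    then show thesis using that[of R] T(1) by simp
  qed
  define g where "g n x = iexp (\<Sum>t\<in>T. u t * (\<theta> / sqrt (real n) * centered_sum lam n t x))" for n x
  have gm: "g n \<in> borel_measurable path_space" for n
  proof -
    have [measurable]: "(\<lambda>x. \<Sum>t\<in>T. u t * (\<theta> / sqrt (real n) * centered_sum lam n t x)) \<in> borel_measurable path_space"
      by (intro borel_measurable_sum borel_measurable_times borel_measurable_const measurable_centered_sum)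
    show ?thesis unfolding g_def[abs_def] by measurable
  qed
  have gB: "norm (g n x) \<le> 1" for n x unfolding g_def by simp
  define I where "I n a = (\<integral>z. g n (a, inar_path (inar_coord z)) \<partial>inar_input_law lam a)" for n a
  have I: "I n a = exp (complex_of_real (lam / (1 - a)) * log_cf a (\<lambda>m. \<theta> / sqrt (real n) * step_weight T u (\<lambda>t. nat \<lfloor>real n * t\<rfloor>) (n * R - m)) (n * R))"
    if a: "0 < a" "a < 1" for n a
  proof -
    have "(\<Sum>t\<in>T. u t * (\<theta> / sqrt (real n) * centered_sum lam n t (a, x)))
      = (\<Sum>k=1..n * R. (\<theta> / sqrt (real n) * step_weight T u (\<lambda>t. nat \<lfloor>real n * t\<rfloor>) k) * (real (x k) - lam / (1 - a)))" for x
      by (rule sum_centered_sum_eq[OF T(1) R])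
    then show ?thesis unfolding I_def g_def by (simp only: inar_char_function[OF lam a])
  qed
  have "(\<lambda>n. \<integral>\<omega>. I n (\<alpha> \<omega>) \<partial>M) \<longlonglongrightarrow> (\<integral>\<omega>. complex_of_real (exp (- (\<theta>\<^sup>2 * quad_min T u / 2 * long_run_variance lam (\<alpha> \<omega>)))) \<partial>M)"
  proof (rule integral_dominated_convergence[where w="\<lambda>_. 1"])
    show "(\<lambda>\<omega>. complex_of_real (exp (- (\<theta>\<^sup>2 * quad_min T u / 2 * long_run_variance lam (\<alpha> \<omega>))))) \<in> borel_measurable M"
      unfolding long_run_variance_def by measurable
    show "(\<lambda>\<omega>. I n (\<alpha> \<omega>)) \<in> borel_measurable M" for n
      unfolding I_def by (rule INAR_integral(2)[OF lam INAR gm gB])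
    show "AE \<omega> in M. norm (I n (\<alpha> \<omega>)) \<le> 1" for n
    proof (rule AE_I2)
      fix \<omega> assume \<omega>: "\<omega> \<in> space M"
      interpret P: prob_space "inar_input_law lam (\<alpha> \<omega>)" by (rule prob_space_inar_input_law)
      have "norm (I n (\<alpha> \<omega>)) \<le> (\<integral>z. norm (g n (\<alpha> \<omega>, inar_path (inar_coord z))) \<partial>inar_input_law lam (\<alpha> \<omega>))"
        unfolding I_def by (rule integral_norm_bound)
      also have "\<dots> = 1" unfolding g_def by (simp add: P.prob_space)
      finally show "norm (I n (\<alpha> \<omega>)) \<le> 1" .
    qed
    show "AE \<omega> in M. (\<lambda>n. I n (\<alpha> \<omega>)) \<longlonglongrightarrow> complex_of_real (exp (- (\<theta>\<^sup>2 * quad_min T u / 2 * long_run_variance lam (\<alpha> \<omega>))))"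
    proof (rule AE_I2)
      fix \<omega> assume "\<omega> \<in> space M"
      then have a: "0 < \<alpha> \<omega>" "\<alpha> \<omega> < 1" using INAR_alpha[OF lam INAR] by auto
      define a where "a = \<alpha> \<omega>"
      have "(\<lambda>n. I n a) \<longlonglongrightarrow> exp (complex_of_real (lam / (1 - a)) * complex_of_real (- ((1 + a) / (1 - a)) * (\<theta>\<^sup>2 * quad_min T u) / 2))"
        unfolding I[OF a[folded a_def]]
        by (intro tendsto_exp tendsto_mult tendsto_const log_cf_limit[OF a[folded a_def] T R])
      also have "exp (complex_of_real (lam / (1 - a)) * complex_of_real (- ((1 + a) / (1 - a)) * (\<theta>\<^sup>2 * quad_min T u) / 2))
        = complex_of_real (exp (lam / (1 - a) * (- ((1 + a) / (1 - a)) * (\<theta>\<^sup>2 * quad_min T u) / 2)))"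
        by (simp only: of_real_mult[symmetric] exp_of_real)
      also have "lam / (1 - a) * (- ((1 + a) / (1 - a)) * (\<theta>\<^sup>2 * quad_min T u) / 2) = - (\<theta>\<^sup>2 * quad_min T u / 2 * long_run_variance lam a)"
      proof -
        have "lam / x * (- ((1 + a) / x) * q / 2) = - (q / 2 * (lam * (1 + a) / x\<^sup>2))" for x q
          by (simp add: power2_eq_square mult_ac)
        then show ?thesis unfolding long_run_variance_def .
      qed
      finally show "(\<lambda>n. I n (\<alpha> \<omega>)) \<longlonglongrightarrow> complex_of_real (exp (- (\<theta>\<^sup>2 * quad_min T u / 2 * long_run_variance lam (\<alpha> \<omega>))))"
        by (simp only: a_def)
    qed
  qed simp
  moreover have "(\<integral>\<omega>. g n (\<alpha> \<omega>, \<lambda>k. X k \<omega>) \<partial>M) = (\<integral>\<omega>. I n (\<alpha> \<omega>) \<partial>M)" for n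
    unfolding I_def by (rule INAR_integral(1)[OF lam INAR gm gB])
  ultimately show ?thesis by (simp only: g_def)
qed

section \<open>Small-parameter asymptotics of a Laplace transform\<close>

lemma one_minus_exp_bounds:
  fixes u :: real
  assumes "0 \<le> u"
  shows "u - u\<^sup>2 / 2 \<le> 1 - exp (- u)" "1 - exp (- u) \<le> u" "0 \<le> 1 - exp (- u)" "1 - exp (- u) \<le> 1"
proof -
  have "(\<lambda>x. exp (- x) - 1 + x - x\<^sup>2 / 2) u \<le> (\<lambda>x. exp (- x) - 1 + x - x\<^sup>2 / 2) 0"
  proof (rule DERIV_nonpos_imp_nonincreasing[OF assms])
    fix x :: real assume "0 \<le> x"
    have "((\<lambda>x. exp (- x) - 1 + x - x\<^sup>2 / 2) has_real_derivative (- exp (- x) + 1 - x)) (at x)"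
      by (auto intro!: derivative_eq_intros)
    moreover have "- exp (- x) + 1 - x \<le> 0" using exp_ge_add_one_self[of "-x"] by simp
    ultimately show "\<exists>y. ((\<lambda>x. exp (- x) - 1 + x - x\<^sup>2 / 2) has_real_derivative y) (at x) \<and> y \<le> 0" by blast
  qed
  then show "u - u\<^sup>2 / 2 \<le> 1 - exp (- u)" by simp
  show "1 - exp (- u) \<le> u" using exp_ge_add_one_self[of "-u"] by simp
qed (use assms in auto)

text \<open>The contribution of a neighbourhood of \<open>1\<close> to \<open>1 - E exp (- c / (1 - \<alpha>)\<^sup>2)\<close> when \<open>\<alpha>\<close> has density \<open>1 - x\<close> there.\<close>

definition trunc_moment :: "real \<Rightarrow> real \<Rightarrow> real" where
  "trunc_moment \<delta> c = (\<integral>x. (1 - exp (- (c / (1 - x)\<^sup>2))) * (1 - x) * indicator {1 - \<delta><..<1} x \<partial>lborel)"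

lemma integrable_trunc_moment:
  fixes c \<delta> :: real
  assumes "0 \<le> c" "\<delta> \<le> 1"
  shows "integrable lborel (\<lambda>x::real. (1 - exp (- (c / (1 - x)\<^sup>2))) * (1 - x) * indicator {1 - \<delta><..<1} x)"
proof (rule Bochner_Integration.integrable_bound)
  show "integrable lborel (indicat_real {1 - \<delta><..<1})" using emeasure_bounded_finite[of "{1 - \<delta><..<1}"] by (intro integrable_real_indicator) auto
  show "AE x in lborel. norm ((1 - exp (- (c / (1 - x)\<^sup>2))) * (1 - x) * indicator {1 - \<delta><..<1} x) \<le> norm (indicat_real {1 - \<delta><..<1} x)"
  proof (rule AE_I2)
    fix x :: real
    have "\<bar>1 - exp (- (c / (1 - x)\<^sup>2))\<bar> \<le> 1" using one_minus_exp_bounds[of "c / (1 - x)\<^sup>2"] assms by simp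
    then show "norm ((1 - exp (- (c / (1 - x)\<^sup>2))) * (1 - x) * indicator {1 - \<delta><..<1} x) \<le> norm (indicat_real {1 - \<delta><..<1} x)"
      using assms by (auto simp: abs_mult indicator_def intro!: mult_le_one)
  qed
qed measurable

text \<open>The integrand behaves like \<open>c / (1 - x)\<close> for \<open>1 - x > \<surd>c\<close> and is at most \<open>1 - x\<close> closer to \<open>1\<close>. The first
range contributes \<open>c (log \<delta> - log c / 2)\<close>, the source of the logarithm; the second only \<open>O(c)\<close>.\<close>

lemma trunc_moment_bounds:
  assumes c: "0 < c" and \<delta>: "sqrt c < \<delta>" "\<delta> \<le> 1"
  shows "c * (ln \<delta> - ln c / 2 - 1 / 4) \<le> trunc_moment \<delta> c"
    and "trunc_moment \<delta> c \<le> c * (ln \<delta> - ln c / 2 + 1 / 2)"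
proof -
  \<comment> \<open>The scale at which the exponent \<open>c / (1 - x)\<^sup>2\<close> equals \<open>1\<close>.\<close>
  define r where "r = sqrt c"
  have r: "0 < r" "r < \<delta>" "r\<^sup>2 = c" "ln r = ln c / 2" using c \<delta> by (auto simp: r_def ln_sqrt)
  let ?G = "\<lambda>x. (1 - exp (- (c / (1 - x)\<^sup>2))) * (1 - x) * indicator {1 - \<delta><..<1} x"
  have G: "integrable lborel ?G" by (rule integrable_trunc_moment) (use c \<delta> in auto)
  have 1: "has_bochner_integral lborel (\<lambda>x. c / (1 - x) * indicator {1 - \<delta>..1 - r} x) (- c * ln r - (- c * ln \<delta>))"
  proof -
    have "((\<lambda>x. - c * ln (1 - x)) has_real_derivative c / (1 - x)) (at x)" if "x \<le> 1 - r" for x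
      using that r by (auto intro!: derivative_eq_intros)
    then show ?thesis
      using has_bochner_integral_FTC_Icc_real[of "1 - \<delta>" "1 - r" "\<lambda>x. - c * ln (1 - x)" "\<lambda>x. c / (1 - x)"] r(1,2)
      by (auto intro!: continuous_intros)
  qed
  have 2: "has_bochner_integral lborel (\<lambda>x. (1 - x) * indicator {1 - r..1} x) (r\<^sup>2 / 2)"
  proof -
    have "((\<lambda>x. - (1 - x)\<^sup>2 / 2) has_real_derivative 1 - x) (at x)" for x :: real
      by (auto intro!: derivative_eq_intros simp: field_simps)
    then show ?thesis
      using has_bochner_integral_FTC_Icc_real[of "1 - r" 1 "\<lambda>x. - (1 - x)\<^sup>2 / 2" "\<lambda>x. 1 - x"] r(1)
      by (auto intro!: continuous_intros)
  qed
  have 3: "has_bochner_integral lborel (\<lambda>x. c\<^sup>2 / (2 * (1 - x) ^ 3) * indicator {1 - \<delta>..1 - r} x)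
    (c\<^sup>2 / (4 * r\<^sup>2) - c\<^sup>2 / (4 * \<delta>\<^sup>2))"
  proof -
    have "((\<lambda>x. c\<^sup>2 / (4 * (1 - x)\<^sup>2)) has_real_derivative c\<^sup>2 / (2 * (1 - x) ^ 3)) (at x)" if "x \<le> 1 - r" for x
    proof (rule DERIV_cong)
      show "((\<lambda>x. c\<^sup>2 / (4 * (1 - x)\<^sup>2)) has_real_derivative
          (0 * (4 * (1 - x)\<^sup>2) - c\<^sup>2 * (4 * (2 * (1 - x) * (- 1)))) / ((4 * (1 - x)\<^sup>2) * (4 * (1 - x)\<^sup>2))) (at x)"
        using that r by (intro DERIV_divide) (auto intro!: derivative_eq_intros)
      have eq: "(0 * (4 * y\<^sup>2) - c\<^sup>2 * (4 * (2 * y * (- 1)))) / ((4 * y\<^sup>2) * (4 * y\<^sup>2)) = c\<^sup>2 / (2 * y ^ 3)" if "y \<noteq> 0" for y :: real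
        using that by (simp add: field_simps power2_eq_square power3_eq_cube)
      show "(0 * (4 * (1 - x)\<^sup>2) - c\<^sup>2 * (4 * (2 * (1 - x) * (- 1)))) / ((4 * (1 - x)\<^sup>2) * (4 * (1 - x)\<^sup>2)) = c\<^sup>2 / (2 * (1 - x) ^ 3)"
        by (rule eq) (use that r in \<open>simp\<close>)
    qed
    then show ?thesis
      using has_bochner_integral_FTC_Icc_real[of "1 - \<delta>" "1 - r" "\<lambda>x. c\<^sup>2 / (4 * (1 - x)\<^sup>2)" "\<lambda>x. c\<^sup>2 / (2 * (1 - x) ^ 3)"] r
      by (auto intro!: continuous_intros)
  qed
  have "(- c * ln r - (- c * ln \<delta>)) - (c\<^sup>2 / (4 * r\<^sup>2) - c\<^sup>2 / (4 * \<delta>\<^sup>2))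
    = (\<integral>x. c / (1 - x) * indicator {1 - \<delta>..1 - r} x - c\<^sup>2 / (2 * (1 - x) ^ 3) * indicator {1 - \<delta>..1 - r} x \<partial>lborel)"
    using has_bochner_integral_diff[OF 1 3] by (simp add: has_bochner_integral_iff)
  also have "\<dots> \<le> (\<integral>x. ?G x \<partial>lborel)"
  proof (rule integral_mono_AE)
    show "integrable lborel (\<lambda>x. c / (1 - x) * indicator {1 - \<delta>..1 - r} x - c\<^sup>2 / (2 * (1 - x) ^ 3) * indicator {1 - \<delta>..1 - r} x)"
      using has_bochner_integral_diff[OF 1 3] by (simp add: has_bochner_integral_iff)
    have "AE x in lborel. x \<noteq> 1 - \<delta>" by (rule AE_lborel_singleton)
    then show "AE x in lborel. c / (1 - x) * indicator {1 - \<delta>..1 - r} x - c\<^sup>2 / (2 * (1 - x) ^ 3) * indicator {1 - \<delta>..1 - r} x \<le> ?G x"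
    proof eventually_elim
      fix x assume ne: "x \<noteq> 1 - \<delta>"
      show "c / (1 - x) * indicator {1 - \<delta>..1 - r} x - c\<^sup>2 / (2 * (1 - x) ^ 3) * indicator {1 - \<delta>..1 - r} x \<le> ?G x"
      proof (cases "x \<in> {1 - \<delta>..1 - r}")
        case True
        define y where "y = 1 - x"
        have y: "0 < y" using True r by (auto simp: y_def)
        have "c / y - c\<^sup>2 / (2 * y ^ 3) = (c / y\<^sup>2 - (c / y\<^sup>2)\<^sup>2 / 2) * y"
          using y by (simp add: field_simps power2_eq_square power3_eq_cube)
        also have "\<dots> \<le> (1 - exp (- (c / y\<^sup>2))) * y"
          using y c by (intro mult_right_mono one_minus_exp_bounds) auto
        finally show ?thesis using True ne r by (simp add: y_def)
      next
        case False
        have "0 \<le> ?G x" using c one_minus_exp_bounds(3)[of "c / (1 - x)\<^sup>2"] by (auto simp: indicator_def)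
        then show ?thesis using False by simp
      qed
    qed
  qed (rule G)
  also have "\<dots> = trunc_moment \<delta> c" by (simp add: trunc_moment_def)
  finally have "c * (ln \<delta> - ln r) - c\<^sup>2 / (4 * r\<^sup>2) + c\<^sup>2 / (4 * \<delta>\<^sup>2) \<le> trunc_moment \<delta> c" by (simp add: algebra_simps)
  moreover have "c\<^sup>2 / (4 * r\<^sup>2) = c / 4" using c by (simp add: r(3)) (simp add: power2_eq_square)
  moreover have "0 \<le> c\<^sup>2 / (4 * \<delta>\<^sup>2)" by simp
  ultimately have "c * (ln \<delta> - ln r) - c / 4 \<le> trunc_moment \<delta> c" by linarith
  then show "c * (ln \<delta> - ln c / 2 - 1 / 4) \<le> trunc_moment \<delta> c"
    by (simp add: algebra_simps r(4))
  have "trunc_moment \<delta> c = (\<integral>x. ?G x \<partial>lborel)" by (simp add: trunc_moment_def)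
  also have "\<dots> \<le> (\<integral>x. c / (1 - x) * indicator {1 - \<delta>..1 - r} x + (1 - x) * indicator {1 - r..1} x \<partial>lborel)"
  proof (rule integral_mono[OF G])
    show "integrable lborel (\<lambda>x. c / (1 - x) * indicator {1 - \<delta>..1 - r} x + (1 - x) * indicator {1 - r..1} x)"
      using has_bochner_integral_add[OF 1 2] by (simp add: has_bochner_integral_iff)
    fix x :: real
    have nn: "0 \<le> c / (1 - x) * indicator {1 - \<delta>..1 - r} x" "0 \<le> (1 - x) * indicator {1 - r..1} x"
      using c r by (auto simp: indicator_def)
    show "?G x \<le> c / (1 - x) * indicator {1 - \<delta>..1 - r} x + (1 - x) * indicator {1 - r..1} x"
    proof (cases "x \<in> {1 - \<delta><..<1}")
      case True
      show ?thesis
      proof (cases "x \<le> 1 - r")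
        case le: True
        have "(1 - exp (- (c / (1 - x)\<^sup>2))) * (1 - x) \<le> c / (1 - x)\<^sup>2 * (1 - x)"
          using True c by (intro mult_right_mono one_minus_exp_bounds) auto
        also have "\<dots> = c / (1 - x)" using True by (simp add: power2_eq_square)
        finally have "?G x \<le> c / (1 - x) * indicator {1 - \<delta>..1 - r} x" using True le by simp
        then show ?thesis using nn(2) by linarith
      next
        case False
        have "(1 - exp (- (c / (1 - x)\<^sup>2))) * (1 - x) \<le> 1 * (1 - x)"
          using True c by (intro mult_right_mono one_minus_exp_bounds) auto
        then have "?G x \<le> (1 - x) * indicator {1 - r..1} x" using True False by simp
        then show ?thesis using nn(1) by linarith
      qed
    next
      case False
      then show ?thesis using nn by simp
    qed
  qed
  also have "\<dots> = (- c * ln r - (- c * ln \<delta>)) + r\<^sup>2 / 2"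
    using has_bochner_integral_add[OF 1 2] by (simp add: has_bochner_integral_iff)
  finally show "trunc_moment \<delta> c \<le> c * (ln \<delta> - ln c / 2 + 1 / 2)" by (simp add: r algebra_simps)
qed

lemma trunc_moment_asymp:
  assumes a: "0 < a" and \<delta>: "0 < \<delta>" "\<delta> \<le> 1"
  shows "((\<lambda>s. trunc_moment \<delta> (a * s) / (s * ln (1 / s))) \<longlongrightarrow> a / 2) (at_right 0)"
proof (rule real_tendsto_sandwich)
  have "((\<lambda>s. sqrt (a * s)) \<longlongrightarrow> 0) (at_right 0)" using a by real_asymp
  from order_tendstoD(2)[OF this \<delta>(1)]
  have ev: "\<forall>\<^sub>F s in at_right 0. sqrt (a * s) < \<delta>" .
  have pos: "\<forall>\<^sub>F s in at_right (0::real). 0 < s \<and> s < 1"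
    by (rule eventually_conj) real_asymp+
  show "\<forall>\<^sub>F s in at_right 0. (a * s) * (ln \<delta> - ln (a * s) / 2 - 1 / 4) / (s * ln (1 / s)) \<le> trunc_moment \<delta> (a * s) / (s * ln (1 / s))"
    using ev pos
  proof eventually_elim
    case (elim s)
    then show ?case using a \<delta> by (intro divide_right_mono trunc_moment_bounds) (auto simp: field_simps ln_div intro!: mult_nonneg_nonpos)
  qed
  show "\<forall>\<^sub>F s in at_right 0. trunc_moment \<delta> (a * s) / (s * ln (1 / s)) \<le> (a * s) * (ln \<delta> - ln (a * s) / 2 + 1 / 2) / (s * ln (1 / s))"
    using ev pos
  proof eventually_elim
    case (elim s)
    then show ?case using a \<delta> by (intro divide_right_mono trunc_moment_bounds) (auto simp: field_simps ln_div intro!: mult_nonneg_nonpos)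
  qed
  show "((\<lambda>s. (a * s) * (ln \<delta> - ln (a * s) / 2 - 1 / 4) / (s * ln (1 / s))) \<longlongrightarrow> a / 2) (at_right 0)"
    using a by real_asymp
  show "((\<lambda>s. (a * s) * (ln \<delta> - ln (a * s) / 2 + 1 / 2) / (s * ln (1 / s))) \<longlongrightarrow> a / 2) (at_right 0)"
    using a by real_asymp
qed


text \<open>Near \<open>1\<close> the function \<open>\<psi>\<close> is close to \<open>\<psi>\<^sub>1\<close> and \<open>\<lambda> (1 + x)\<close> is close to \<open>2 \<lambda>\<close>, so the integral is squeezed
between multiples of \<open>trunc_moment\<close>; away from \<open>1\<close> the exponent is \<open>O(s)\<close> and the contribution is negligible
against \<open>s log (1 / s)\<close>.\<close>

lemma laplace_asymp:
  fixes lam \<psi>1 :: real and \<psi> :: "real \<Rightarrow> real"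
  assumes lam: "0 < lam" and int: "set_integrable lborel {0<..<1} \<psi>"
    and nn: "AE x in lborel. x \<in> {0<..<1} \<longrightarrow> 0 \<le> \<psi> x"
    and lim: "(\<psi> \<longlongrightarrow> \<psi>1) (at_left 1)" and \<psi>1: "0 < \<psi>1"
  shows "((\<lambda>s. (\<integral>x. (1 - exp (- (s * (lam * (1 + x) / (1 - x)\<^sup>2)))) * (indicator {0<..<1} x * (\<psi> x * (1 - x))) \<partial>lborel)
    / (s * ln (1 / s))) \<longlongrightarrow> lam * \<psi>1) (at_right 0)"
proof -
  define V where "V x = lam * (1 + x) / (1 - x)\<^sup>2" for x
  define F where "F s x = (1 - exp (- (s * V x))) * (indicator {0<..<1} x * (\<psi> x * (1 - x)))" for s x
  define I where "I s = (\<integral>x. F s x \<partial>lborel)" for s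
  have V: "0 \<le> V x" if "x \<in> {0<..<1}" for x using that lam by (simp add: V_def)
  have abs_int: "integrable lborel (\<lambda>x. indicator {0<..<1} x * \<bar>\<psi> x\<bar>)"
    using set_integrable_abs[OF int] by (simp add: set_integrable_def)
  have mF: "F s \<in> borel_measurable lborel" for s
  proof -
    have m: "(\<lambda>x. indicator {0<..<1} x * \<psi> x) \<in> borel_measurable lborel"
      using int by (simp add: set_integrable_def)
    have "F s = (\<lambda>x. (1 - exp (- (s * V x))) * ((indicator {0<..<1} x * \<psi> x) * (1 - x)))"
      by (simp add: F_def fun_eq_iff)
    then show ?thesis unfolding V_def using m by simp
  qed
  have F_le: "\<bar>F s x\<bar> \<le> indicator {0<..<1} x * \<bar>\<psi> x\<bar>" if "0 \<le> s" for s x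
  proof (cases "x \<in> {0<..<1}")
    case True
    have "\<bar>1 - exp (- (s * V x))\<bar> \<le> 1" using one_minus_exp_bounds[of "s * V x"] V[OF True] that by simp
    moreover have "\<bar>\<psi> x * (1 - x)\<bar> \<le> \<bar>\<psi> x\<bar>" using True by (simp add: abs_mult mult_left_le)
    ultimately have "\<bar>1 - exp (- (s * V x))\<bar> * \<bar>\<psi> x * (1 - x)\<bar> \<le> 1 * \<bar>\<psi> x\<bar>" by (intro mult_mono) auto
    then show ?thesis using True by (simp add: F_def abs_mult)
  qed (simp add: F_def)
  have intF: "integrable lborel (F s)" if "0 \<le> s" for s
    by (rule Bochner_Integration.integrable_bound[OF abs_int mF]) (use F_le[OF that] in auto)
  have bounds: "(\<psi>1 - \<epsilon>) * trunc_moment \<delta> (lam * (2 - \<delta>) * s) \<le> I s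
     \<and> I s \<le> (\<psi>1 + \<epsilon>) * trunc_moment \<delta> (2 * lam * s) + s * (2 * lam / \<delta>\<^sup>2 * (\<integral>x. indicator {0<..<1} x * \<bar>\<psi> x\<bar> \<partial>lborel))"
    if \<epsilon>: "0 < \<epsilon>" "\<epsilon> < \<psi>1" and \<delta>: "0 < \<delta>" "\<delta> < 1" and near: "\<And>x. x \<in> {1 - \<delta><..<1} \<Longrightarrow> \<bar>\<psi> x - \<psi>1\<bar> < \<epsilon>"
      and s: "0 < s" for \<epsilon> \<delta> s
  proof
    have sub: "x \<in> {0<..<1}" if "x \<in> {1 - \<delta><..<1}" for x using that \<delta> by auto
    let ?G = "\<lambda>c x. (1 - exp (- (c / (1 - x)\<^sup>2))) * (1 - x) * indicator {1 - \<delta><..<1} x"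
    have G: "integrable lborel (?G c)" if "0 \<le> c" for c
      by (rule integrable_trunc_moment) (use that \<delta> in auto)
    have "(\<psi>1 - \<epsilon>) * trunc_moment \<delta> (lam * (2 - \<delta>) * s) = (\<integral>x. (\<psi>1 - \<epsilon>) * ?G (lam * (2 - \<delta>) * s) x \<partial>lborel)"
      by (simp add: trunc_moment_def)
    also have "\<dots> \<le> I s"
      unfolding I_def
    proof (rule integral_mono_AE)
      show "integrable lborel (\<lambda>x. (\<psi>1 - \<epsilon>) * ?G (lam * (2 - \<delta>) * s) x)"
        using G lam \<delta> s by (intro integrable_mult_right) auto
      show "AE x in lborel. (\<psi>1 - \<epsilon>) * ?G (lam * (2 - \<delta>) * s) x \<le> F s x"
        using nn
      proof eventually_elim
        case (elim x)
        show ?case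
        proof (cases "x \<in> {1 - \<delta><..<1}")
          case True
          have "lam * (2 - \<delta>) * s / (1 - x)\<^sup>2 \<le> s * V x"
            using True lam s \<delta> by (auto simp: V_def divide_right_mono mult.commute)
          then have 1: "1 - exp (- (lam * (2 - \<delta>) * s / (1 - x)\<^sup>2)) \<le> 1 - exp (- (s * V x))" by simp
          have 2: "\<psi>1 - \<epsilon> \<le> \<psi> x" using near[OF True] by simp
          have "(\<psi>1 - \<epsilon>) * (1 - exp (- (lam * (2 - \<delta>) * s / (1 - x)\<^sup>2))) \<le> \<psi> x * (1 - exp (- (s * V x)))"
            using 1 2 \<epsilon> lam \<delta> s by (intro mult_mono) auto
          then have "(\<psi>1 - \<epsilon>) * (1 - exp (- (lam * (2 - \<delta>) * s / (1 - x)\<^sup>2))) * (1 - x) \<le> \<psi> x * (1 - exp (- (s * V x))) * (1 - x)"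
            using True by (intro mult_right_mono) auto
          then show ?thesis using True sub[OF True] by (simp add: F_def mult_ac)
        next
          case False
          have "0 \<le> F s x" using elim V[of x] s by (auto simp: F_def indicator_def)
          then show ?thesis using False by simp
        qed
      qed
    qed (use intF s in auto)
    finally show "(\<psi>1 - \<epsilon>) * trunc_moment \<delta> (lam * (2 - \<delta>) * s) \<le> I s" .
    have "I s \<le> (\<integral>x. (\<psi>1 + \<epsilon>) * ?G (2 * lam * s) x + s * (2 * lam / \<delta>\<^sup>2 * (indicator {0<..<1} x * \<bar>\<psi> x\<bar>)) \<partial>lborel)"
      unfolding I_def
    proof (rule integral_mono_AE)
      show "integrable lborel (\<lambda>x. (\<psi>1 + \<epsilon>) * ?G (2 * lam * s) x + s * (2 * lam / \<delta>\<^sup>2 * (indicator {0<..<1} x * \<bar>\<psi> x\<bar>)))"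
        using G lam s abs_int by (intro Bochner_Integration.integrable_add integrable_mult_right) auto
      show "AE x in lborel. F s x \<le> (\<psi>1 + \<epsilon>) * ?G (2 * lam * s) x + s * (2 * lam / \<delta>\<^sup>2 * (indicator {0<..<1} x * \<bar>\<psi> x\<bar>))"
        using nn
      proof eventually_elim
        case (elim x)
        have nonneg2: "0 \<le> s * (2 * lam / \<delta>\<^sup>2 * (indicator {0<..<1} x * \<bar>\<psi> x\<bar>))" using s lam by simp
        show ?case
        proof (cases "x \<in> {1 - \<delta><..<1}")
          case True
          have "s * V x \<le> 2 * lam * s / (1 - x)\<^sup>2"
            using True lam s by (auto simp: V_def divide_right_mono mult.commute)
          then have 1: "1 - exp (- (s * V x)) \<le> 1 - exp (- (2 * lam * s / (1 - x)\<^sup>2))" by simp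
          have 2: "\<psi> x \<le> \<psi>1 + \<epsilon>" using near[OF True] by simp
          have "\<psi> x * (1 - exp (- (s * V x))) \<le> (\<psi>1 + \<epsilon>) * (1 - exp (- (2 * lam * s / (1 - x)\<^sup>2)))"
            using 1 2 \<epsilon> s V[OF sub[OF True]] by (intro mult_mono) auto
          then have "\<psi> x * (1 - exp (- (s * V x))) * (1 - x) \<le> (\<psi>1 + \<epsilon>) * (1 - exp (- (2 * lam * s / (1 - x)\<^sup>2))) * (1 - x)"
            using True by (intro mult_right_mono) auto
          moreover have "F s x = \<psi> x * (1 - exp (- (s * V x))) * (1 - x)"
            using sub[OF True] by (simp add: F_def)
          moreover have "(\<psi>1 + \<epsilon>) * ?G (2 * lam * s) x = (\<psi>1 + \<epsilon>) * (1 - exp (- (2 * lam * s / (1 - x)\<^sup>2))) * (1 - x)"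
            using True by simp
          ultimately show ?thesis using nonneg2 by linarith
        next
          case False
          show ?thesis
          proof (cases "x \<in> {0<..<1}")
            case True
            with False have x: "\<delta> \<le> 1 - x" by auto
            have "1 - exp (- (s * V x)) \<le> s * V x" using one_minus_exp_bounds(2)[of "s * V x"] s V[OF True] by simp
            also have "V x \<le> 2 * lam / \<delta>\<^sup>2"
              unfolding V_def using True x \<delta> lam by (intro frac_le power_mono mult_pos_pos) auto
            finally have "1 - exp (- (s * V x)) \<le> s * (2 * lam / \<delta>\<^sup>2)" using s by simp
            moreover have "\<psi> x * (1 - x) \<le> \<bar>\<psi> x\<bar>" using True elim by (simp add: mult_left_le)
            ultimately have "(1 - exp (- (s * V x))) * (\<psi> x * (1 - x)) \<le> s * (2 * lam / \<delta>\<^sup>2) * \<bar>\<psi> x\<bar>"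
              using True elim s lam by (intro mult_mono) auto
            then show ?thesis using True False by (simp add: F_def mult_ac)
          next
            case False
            then have "x \<notin> {1 - \<delta><..<1}" using sub by blast
            with False show ?thesis using nonneg2 by (simp add: F_def)
          qed
        qed
      qed
    qed (use intF s in auto)
    also have "\<dots> = (\<psi>1 + \<epsilon>) * trunc_moment \<delta> (2 * lam * s) + s * (2 * lam / \<delta>\<^sup>2 * (\<integral>x. indicator {0<..<1} x * \<bar>\<psi> x\<bar> \<partial>lborel))"
      using G lam s abs_int by (simp add: trunc_moment_def)
    finally show "I s \<le> (\<psi>1 + \<epsilon>) * trunc_moment \<delta> (2 * lam * s) + s * (2 * lam / \<delta>\<^sup>2 * (\<integral>x. indicator {0<..<1} x * \<bar>\<psi> x\<bar> \<partial>lborel))" .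
  qed
  \<comment> \<open>First \<open>\<epsilon>\<close>, then \<open>\<delta>\<close> is chosen so small that the limits of both bounds stay between \<open>l\<close> and \<open>u\<close>.\<close>
  have ev: "\<forall>\<^sub>F s in at_right 0. l < I s / (s * ln (1 / s)) \<and> I s / (s * ln (1 / s)) < u"
    if l: "l < lam * \<psi>1" and u: "lam * \<psi>1 < u" for l u
  proof -
    have "((\<lambda>\<epsilon>. lam * (\<psi>1 - \<epsilon>) * (1 - \<epsilon> / 2)) \<longlongrightarrow> lam * (\<psi>1 - 0) * (1 - 0 / 2)) (at_right 0)"
      "((\<lambda>\<epsilon>. lam * (\<psi>1 + \<epsilon>)) \<longlongrightarrow> lam * (\<psi>1 + 0)) (at_right 0)"
      by (intro tendsto_intros; simp)+
    then have "\<forall>\<^sub>F \<epsilon> in at_right 0. l < lam * (\<psi>1 - \<epsilon>) * (1 - \<epsilon> / 2)" "\<forall>\<^sub>F \<epsilon> in at_right 0. lam * (\<psi>1 + \<epsilon>) < u"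
      using l u by (auto intro: order_tendstoD)
    moreover have "\<forall>\<^sub>F \<epsilon> in at_right 0. 0 < \<epsilon> \<and> \<epsilon> < \<psi>1 \<and> \<epsilon> < 1"
      using eventually_at_right_real[of 0 "min \<psi>1 1"] \<psi>1 by (auto elim: eventually_mono)
    ultimately have "\<forall>\<^sub>F \<epsilon> in at_right 0. l < lam * (\<psi>1 - \<epsilon>) * (1 - \<epsilon> / 2) \<and> lam * (\<psi>1 + \<epsilon>) < u \<and> 0 < \<epsilon> \<and> \<epsilon> < \<psi>1 \<and> \<epsilon> < 1"
      by eventually_elim auto
    from eventually_happens'[OF _ this] obtain \<epsilon> where \<epsilon>: "l < lam * (\<psi>1 - \<epsilon>) * (1 - \<epsilon> / 2)" "lam * (\<psi>1 + \<epsilon>) < u" "0 < \<epsilon>" "\<epsilon> < \<psi>1" "\<epsilon> < 1"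
      by auto
    from tendstoD[OF lim \<epsilon>(3)] obtain b where b: "b < 1" "\<And>x. b < x \<Longrightarrow> x < 1 \<Longrightarrow> \<bar>\<psi> x - \<psi>1\<bar> < \<epsilon>"
      unfolding eventually_at_left_field dist_real_def by auto
    define \<delta> where "\<delta> = min \<epsilon> (1 - b)"
    have \<delta>: "0 < \<delta>" "\<delta> < 1" "\<delta> \<le> \<epsilon>" using \<epsilon> b by (auto simp: \<delta>_def)
    have near: "\<bar>\<psi> x - \<psi>1\<bar> < \<epsilon>" if "x \<in> {1 - \<delta><..<1}" for x using b(2)[of x] that by (auto simp: \<delta>_def)
    define C where "C = 2 * lam / \<delta>\<^sup>2 * (\<integral>x. indicator {0<..<1} x * \<bar>\<psi> x\<bar> \<partial>lborel)"
    have lo: "((\<lambda>s. (\<psi>1 - \<epsilon>) * (trunc_moment \<delta> (lam * (2 - \<delta>) * s) / (s * ln (1 / s)))) \<longlongrightarrow> (\<psi>1 - \<epsilon>) * (lam * (2 - \<delta>) / 2)) (at_right 0)"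
      using lam \<delta> by (intro tendsto_mult_left trunc_moment_asymp) auto
    have "((\<lambda>s. s * C / (s * ln (1 / s))) \<longlongrightarrow> 0) (at_right 0)" by real_asymp
    then have hi: "((\<lambda>s. (\<psi>1 + \<epsilon>) * (trunc_moment \<delta> (2 * lam * s) / (s * ln (1 / s))) + s * C / (s * ln (1 / s))) \<longlongrightarrow> (\<psi>1 + \<epsilon>) * (2 * lam / 2) + 0) (at_right 0)"
      using lam \<delta> by (intro tendsto_add tendsto_mult_left trunc_moment_asymp) auto
    have "lam * (\<psi>1 - \<epsilon>) * (1 - \<epsilon> / 2) \<le> lam * (\<psi>1 - \<epsilon>) * (1 - \<delta> / 2)"
      using lam \<epsilon> \<delta> by (intro mult_left_mono) auto
    then have "l < (\<psi>1 - \<epsilon>) * (lam * (2 - \<delta>) / 2)" using \<epsilon>(1) by (simp add: field_simps)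
    from order_tendstoD(1)[OF lo this]
    have ev1: "\<forall>\<^sub>F s in at_right 0. l < (\<psi>1 - \<epsilon>) * (trunc_moment \<delta> (lam * (2 - \<delta>) * s) / (s * ln (1 / s)))" .
    have "(\<psi>1 + \<epsilon>) * (2 * lam / 2) + 0 < u" using \<epsilon>(2) by (simp add: mult.commute)
    from order_tendstoD(2)[OF hi this]
    have ev2: "\<forall>\<^sub>F s in at_right 0. (\<psi>1 + \<epsilon>) * (trunc_moment \<delta> (2 * lam * s) / (s * ln (1 / s))) + s * C / (s * ln (1 / s)) < u" .
    have pos: "\<forall>\<^sub>F s in at_right (0::real). 0 < s \<and> s < 1"
      by (rule eventually_conj) real_asymp+
    from ev1 ev2 pos show ?thesis
    proof eventually_elim
      case (elim s)
      have p: "0 < s * ln (1 / s)" using elim by simp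
      have b: "(\<psi>1 - \<epsilon>) * trunc_moment \<delta> (lam * (2 - \<delta>) * s) \<le> I s" "I s \<le> (\<psi>1 + \<epsilon>) * trunc_moment \<delta> (2 * lam * s) + s * C"
        using bounds[OF \<epsilon>(3,4) \<delta>(1,2) near, of s] elim by (auto simp: C_def)
      have "(\<psi>1 - \<epsilon>) * (trunc_moment \<delta> (lam * (2 - \<delta>) * s) / (s * ln (1 / s))) \<le> I s / (s * ln (1 / s))"
        using divide_right_mono[OF b(1) less_imp_le[OF p]] by simp
      moreover have "I s / (s * ln (1 / s)) \<le> (\<psi>1 + \<epsilon>) * (trunc_moment \<delta> (2 * lam * s) / (s * ln (1 / s))) + s * C / (s * ln (1 / s))"
        using divide_right_mono[OF b(2) less_imp_le[OF p]] by (simp add: add_divide_distrib)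
      ultimately show ?case using elim by linarith
    qed
  qed
  have "((\<lambda>s. I s / (s * ln (1 / s))) \<longlongrightarrow> lam * \<psi>1) (at_right 0)"
  proof (rule order_tendstoI)
    fix a assume "a < lam * \<psi>1"
    from ev[OF this, of "lam * \<psi>1 + 1"] show "\<forall>\<^sub>F s in at_right 0. a < I s / (s * ln (1 / s))"
      by (auto elim: eventually_mono)
  next
    fix a assume "lam * \<psi>1 < a"
    from ev[OF _ this, of "lam * \<psi>1 - 1"] show "\<forall>\<^sub>F s in at_right 0. I s / (s * ln (1 / s)) < a"
      by (auto elim: eventually_mono)
  qed
  then show ?thesis by (simp only: I_def F_def V_def)
qed

text \<open>Squeezed by \<open>exp (- x - 2 x\<^sup>2) \<le> 1 - x \<le> exp (- x)\<close> for small \<open>x \<ge> 0\<close>.\<close>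

lemma power_tendsto_exp_minus:
  fixes a :: "nat \<Rightarrow> real"
  assumes nn: "\<And>n. 0 \<le> a n" and lim: "(\<lambda>n. real n * a n) \<longlonglongrightarrow> A"
  shows "(\<lambda>n. (1 - a n) ^ n) \<longlonglongrightarrow> exp (- A)"
proof -
  have "(\<lambda>n. (real n * a n) * (1 / real n)) \<longlonglongrightarrow> A * 0"
    by (intro tendsto_mult lim) real_asymp
  moreover have "\<forall>\<^sub>F n in sequentially. (real n * a n) * (1 / real n) = a n"
    using eventually_gt_at_top[of 0] by eventually_elim simp
  ultimately have a0: "a \<longlonglongrightarrow> 0" by (simp add: tendsto_cong)
  have small: "\<forall>\<^sub>F n in sequentially. a n \<le> 1 / 2"
    using order_tendstoD(2)[OF a0, of "1/2"] by (auto elim: eventually_mono)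
  show ?thesis
  proof (rule real_tendsto_sandwich)
    show "\<forall>\<^sub>F n in sequentially. exp (- (real n * a n) - 2 * (real n * a n) * a n) \<le> (1 - a n) ^ n"
      using small
    proof eventually_elim
      case (elim n)
      have "- a n - 2 * (a n)\<^sup>2 \<le> ln (1 - a n)" using ln_one_minus_pos_lower_bound[OF nn elim] .
      then have "exp (- a n - 2 * (a n)\<^sup>2) \<le> 1 - a n"
        using elim by (subst ln_ge_iff[symmetric]) auto
      then have "exp (- a n - 2 * (a n)\<^sup>2) ^ n \<le> (1 - a n) ^ n" by (intro power_mono) auto
      then show ?case by (simp add: exp_of_nat_mult[symmetric] algebra_simps power2_eq_square)
    qed
    show "\<forall>\<^sub>F n in sequentially. (1 - a n) ^ n \<le> exp (- (real n * a n))"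
      using small
    proof eventually_elim
      case (elim n)
      have "(1 - a n) ^ n \<le> exp (- a n) ^ n"
        using elim exp_ge_add_one_self[of "- a n"] by (intro power_mono) auto
      then show ?case by (simp add: exp_of_nat_mult[symmetric])
    qed
    have "(\<lambda>n. exp (- (real n * a n) - 2 * (real n * a n) * a n)) \<longlonglongrightarrow> exp (- A - 2 * A * 0)"
      by (intro tendsto_intros lim a0)
    then show "(\<lambda>n. exp (- (real n * a n) - 2 * (real n * a n) * a n)) \<longlonglongrightarrow> exp (- A)" by simp
    show "(\<lambda>n. exp (- (real n * a n))) \<longlonglongrightarrow> exp (- A)"
      by (intro tendsto_intros lim)
  qed
qed

section \<open>Independent copies and the iterated limit\<close>

lemma long_run_variance_nonneg: "0 < lam \<Longrightarrow> 0 < a \<Longrightarrow> 0 \<le> long_run_variance lam a"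
  by (simp add: long_run_variance_def)

lemma measurable_long_run_variance[measurable]: "long_run_variance lam \<in> borel_measurable borel"
  unfolding long_run_variance_def[abs_def] by measurable

lemma
  fixes \<psi> :: "real \<Rightarrow> real"
  assumes M: "prob_space M" and D: "has_real_density M Y (\<lambda>x. indicator {0<..<1} x * (\<psi> x * (1 - x) powr 1))"
    and int: "set_integrable lborel {0<..<1} \<psi>"
  shows psi_nonneg: "AE x in lborel. x \<in> {0<..<1} \<longrightarrow> 0 \<le> \<psi> x"
    and psi_density_integral: "\<And>g :: real \<Rightarrow> real. g \<in> borel_measurable borel \<Longrightarrow>
        (\<integral>\<omega>. g (Y \<omega>) \<partial>M) = (\<integral>x. g x * (indicator {0<..<1} x * (\<psi> x * (1 - x))) \<partial>lborel)"
    and psi_density_nn_integral: "\<And>g :: real \<Rightarrow> ennreal. g \<in> borel_measurable borel \<Longrightarrow>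
        (\<integral>\<^sup>+\<omega>. g (Y \<omega>) \<partial>M) = (\<integral>\<^sup>+x. ennreal (indicator {0<..<1} x * (\<psi> x * (1 - x))) * g x \<partial>lborel)"
proof -
  define f where "f x = indicator {0<..<1} x * (\<psi> x * (1 - x))" for x :: real
  have "(\<lambda>x. indicator {0<..<1} x * (\<psi> x * (1 - x) powr 1)) = f"
    by (auto simp: f_def fun_eq_iff indicator_def)
  with D have nn: "AE x in lborel. 0 \<le> f x" and dist: "distributed M lborel Y (\<lambda>x. ennreal (f x))"
    unfolding has_real_density_def by auto
  show "AE x in lborel. x \<in> {0<..<1} \<longrightarrow> 0 \<le> \<psi> x"
    using nn
  proof eventually_elim
    case (elim x)
    then show ?case by (auto simp: f_def zero_le_mult_iff)
  qed
  \<comment> \<open>The positive part is a version of the density that is nonnegative everywhere.\<close>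
  have dist': "distributed M lborel Y (\<lambda>x. ennreal (max 0 (f x)))"
    using dist by (simp add: ennreal_max_0)
  fix g :: "real \<Rightarrow> real" assume g: "g \<in> borel_measurable borel"
  have "(\<integral>\<omega>. g (Y \<omega>) \<partial>M) = (\<integral>x. max 0 (f x) * g x \<partial>lborel)"
    by (rule distributed_integral[OF dist', symmetric]) (use g in auto)
  also have "\<dots> = (\<integral>x. g x * f x \<partial>lborel)"
  proof (rule integral_cong_AE)
    have m: "(\<lambda>x. max 0 (f x)) \<in> borel_measurable lborel"
      using distributed_real_measurable[OF _ dist'] by simp
    then show "(\<lambda>x. max 0 (f x) * g x) \<in> borel_measurable lborel" using g by simp
    show "(\<lambda>x. g x * f x) \<in> borel_measurable lborel"
    proof -
      have "f = (\<lambda>x. (indicator {0<..<1} x * \<psi> x) * (1 - x))" by (simp add: f_def fun_eq_iff)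
      moreover have "(\<lambda>x. indicator {0<..<1} x * \<psi> x) \<in> borel_measurable lborel"
        using int by (simp add: set_integrable_def)
      ultimately show ?thesis using g by simp
    qed
    show "AE x in lborel. max 0 (f x) * g x = g x * f x"
      using nn by eventually_elim simp
  qed
  finally show "(\<integral>\<omega>. g (Y \<omega>) \<partial>M) = (\<integral>x. g x * (indicator {0<..<1} x * (\<psi> x * (1 - x))) \<partial>lborel)"
    by (simp only: f_def)
next
  fix g :: "real \<Rightarrow> ennreal" assume g: "g \<in> borel_measurable borel"
  have eq: "(\<lambda>x. indicator {0<..<1} x * (\<psi> x * (1 - x) powr 1)) = (\<lambda>x. indicator {0<..<1} x * (\<psi> x * (1 - x)))"
    by (auto simp: fun_eq_iff indicator_def)
  with D have "has_real_density M Y (\<lambda>x. indicator {0<..<1} x * (\<psi> x * (1 - x)))" by (simp only:)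
  then have "distributed M lborel Y (\<lambda>x. ennreal (indicator {0<..<1} x * (\<psi> x * (1 - x))))"
    unfolding has_real_density_def by blast
  from distributed_nn_integral[OF this] g
  show "(\<integral>\<^sup>+\<omega>. g (Y \<omega>) \<partial>M) = (\<integral>\<^sup>+x. ennreal (indicator {0<..<1} x * (\<psi> x * (1 - x))) * g x \<partial>lborel)"
    by simp
qed

text \<open>Otherwise the characteristic function of a Wiener process would exceed \<open>1\<close>.\<close>

lemma quad_min_nonneg:
  assumes B: "standard_wiener M B" and T: "finite T" "T \<subseteq> {0..}"
  shows "0 \<le> quad_min T u"
proof -
  interpret prob_space M using B by (simp add: standard_wiener_def real_process_def)
  have "norm (complex_of_real (exp (- quad_min T u / 2))) \<le> (\<integral>\<omega>. norm (iexp (\<Sum>t\<in>T. u t * B t \<omega>)) \<partial>M)"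
    unfolding wiener_char[OF B T, symmetric] by (rule integral_norm_bound)
  also have "\<dots> = 1" by (simp only: norm_exp_i_times) (simp add: prob_space)
  finally show ?thesis by simp
qed

text \<open>The weak law of large numbers for \<open>\<sigma>\<^sup>2(\<alpha>)\<close> in terms of Laplace transforms. For \<open>s = q / (N log N)\<close> one has
\<open>N s log (1 / s) \<rightarrow> q\<close>, because \<open>log (1 / s) \<sim> log N\<close>.\<close>

lemma laplace_power_limit:
  assumes lam: "0 < lam" and M: "prob_space M"
    and Ym: "Y \<in> borel_measurable M" and Y01: "\<And>\<omega>. \<omega> \<in> space M \<Longrightarrow> 0 < Y \<omega> \<and> Y \<omega> < 1"
    and D: "has_real_density M Y (\<lambda>x. indicator {0<..<1} x * (\<psi> x * (1 - x) powr 1))"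
    and int: "set_integrable lborel {0<..<1} \<psi>" and lim: "(\<psi> \<longlongrightarrow> \<psi>1) (at_left 1)" and \<psi>1: "0 < \<psi>1"
    and q: "0 \<le> q"
  shows "(\<lambda>N. (\<integral>\<omega>. exp (- (q / (real N * ln (real N)) * long_run_variance lam (Y \<omega>))) \<partial>M) ^ N) \<longlonglongrightarrow> exp (- (q * (lam * \<psi>1)))"
proof -
  interpret prob_space M by fact
  note [measurable] = Ym
  define s where "s N = q / (real N * ln (real N))" for N :: nat
  have s0: "0 \<le> s N" for N unfolding s_def using q by (cases "N = 0") auto
  define a where "a N = (\<integral>\<omega>. 1 - exp (- (s N * long_run_variance lam (Y \<omega>))) \<partial>M)" for N
  have bnd: "0 \<le> 1 - exp (- (s N * long_run_variance lam (Y \<omega>)))" if "\<omega> \<in> space M" for N \<omega>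
    using s0[of N] long_run_variance_nonneg[OF lam] Y01[OF that] by simp
  have int_exp: "integrable M (\<lambda>\<omega>. exp (- (s N * long_run_variance lam (Y \<omega>))))" for N
  proof (rule integrable_const_bound[where B=1])
    show "AE \<omega> in M. norm (exp (- (s N * long_run_variance lam (Y \<omega>)))) \<le> 1"
      using bnd by (intro AE_I2) auto
  qed measurable
  have a_eq: "(\<integral>\<omega>. exp (- (s N * long_run_variance lam (Y \<omega>))) \<partial>M) = 1 - a N" for N
    unfolding a_def using int_exp[of N] by (simp add: prob_space)
  have a0: "0 \<le> a N" for N unfolding a_def using bnd by (intro Bochner_Integration.integral_nonneg) auto
  have "(\<lambda>N. real N * a N) \<longlonglongrightarrow> q * (lam * \<psi>1)"
  proof (cases "q = 0")
    case True
    then have "a N = 0" for N by (simp add: a_def s_def)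
    then show ?thesis using True by simp
  next
    case False
    with q have qpos: "0 < q" by simp
    define I where "I s = (\<integral>x. (1 - exp (- (s * (lam * (1 + x) / (1 - x)\<^sup>2)))) * (indicator {0<..<1} x * (\<psi> x * (1 - x))) \<partial>lborel)" for s
    have aI: "a N = I (s N)" for N
      unfolding a_def I_def long_run_variance_def
      by (rule psi_density_integral[OF M D int]) measurable
    have as: "((\<lambda>s. I s / (s * ln (1 / s))) \<longlongrightarrow> lam * \<psi>1) (at_right 0)"
      unfolding I_def by (rule laplace_asymp[OF lam int psi_nonneg[OF M D int] lim \<psi>1])
    have "filterlim s (at_right 0) sequentially"
      unfolding s_def[abs_def] using qpos by real_asymp
    from filterlim_compose[OF as this]
    have 1: "(\<lambda>N. I (s N) / (s N * ln (1 / s N))) \<longlonglongrightarrow> lam * \<psi>1" .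
    have 2: "(\<lambda>N. real N * (s N * ln (1 / s N))) \<longlonglongrightarrow> q"
      unfolding s_def[abs_def] using qpos by real_asymp
    have "(\<lambda>N. real N * (s N * ln (1 / s N)) * (I (s N) / (s N * ln (1 / s N)))) \<longlonglongrightarrow> q * (lam * \<psi>1)"
      by (intro tendsto_mult 1 2)
    moreover have "\<forall>\<^sub>F N in sequentially. s N * ln (1 / s N) \<noteq> 0"
    proof -
      have "\<forall>\<^sub>F N in sequentially. 0 < s N * ln (1 / s N)"
        unfolding s_def[abs_def] using qpos by real_asymp
      then show ?thesis by eventually_elim (metis less_irrefl)
    qed
    then have "\<forall>\<^sub>F N in sequentially. real N * (s N * ln (1 / s N)) * (I (s N) / (s N * ln (1 / s N))) = real N * a N"
      by eventually_elim (simp add: aI)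
    ultimately show ?thesis by (rule Lim_transform_eventually)
  qed
  from power_tendsto_exp_minus[OF a0 this] show ?thesis
    by (simp only: a_eq[symmetric] s_def)
qed


text \<open>The factor \<open>1 - x\<close> of the density cancels the singularity, leaving the integral of \<open>\<psi>\<close>.\<close>

lemma inverse_one_minus_finite_mean:
  assumes lam: "0 < lam" and M: "prob_space M" and D: "has_real_density M Y (\<lambda>x. indicator {0<..<1} x * (\<psi> x * (1 - x) powr 1))"
    and int: "set_integrable lborel {0<..<1} \<psi>"
  shows "(\<integral>\<^sup>+\<omega>. ennreal (lam / (1 - Y \<omega>)) \<partial>M) < \<infinity>"
proof -
  have "(\<integral>\<^sup>+\<omega>. ennreal (lam / (1 - Y \<omega>)) \<partial>M)
      = (\<integral>\<^sup>+x. ennreal (indicator {0<..<1} x * (\<psi> x * (1 - x))) * ennreal (lam / (1 - x)) \<partial>lborel)"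
    by (rule psi_density_nn_integral[OF M D int]) measurable
  also have "\<dots> \<le> (\<integral>\<^sup>+x. ennreal (norm (lam * (indicator {0<..<1} x *\<^sub>R \<psi> x))) \<partial>lborel)"
  proof (rule nn_integral_mono)
    fix x :: real
    have "indicator {0<..<1} x * (\<psi> x * (1 - x)) * (lam / (1 - x)) \<le> norm (lam * (indicator {0<..<1} x *\<^sub>R \<psi> x))"
    proof (cases "x \<in> {0<..<1}")
      case True
      then have "indicator {0<..<1} x * (\<psi> x * (1 - x)) * (lam / (1 - x)) = lam * \<psi> x" by simp
      also have "\<dots> \<le> \<bar>lam * \<psi> x\<bar>" by simp
      finally show ?thesis using True by simp
    qed simp
    moreover have "ennreal (indicator {0<..<1} x * (\<psi> x * (1 - x))) * ennreal (lam / (1 - x))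
       = ennreal (indicator {0<..<1} x * (\<psi> x * (1 - x)) * (lam / (1 - x)))"
    proof (cases "x \<in> {0<..<1}")
      case True
      then show ?thesis using lam by (intro ennreal_mult''[symmetric]) simp
    qed simp
    ultimately show "ennreal (indicator {0<..<1} x * (\<psi> x * (1 - x))) * ennreal (lam / (1 - x))
       \<le> ennreal (norm (lam * (indicator {0<..<1} x *\<^sub>R \<psi> x)))"
      by (simp only: ennreal_leI)
  qed
  also have "\<dots> < \<infinity>"
  proof -
    have "integrable lborel (\<lambda>x. lam * (indicator {0<..<1} x *\<^sub>R \<psi> x))"
      using int unfolding set_integrable_def by (rule integrable_mult_right)
    then show ?thesis unfolding integrable_iff_bounded by simp
  qed
  finally show ?thesis .
qed

context
  fixes M0 :: "'v measure" and M :: "'w measure" and lam :: real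
    and \<alpha> :: "'v \<Rightarrow> real" and X :: "nat \<Rightarrow> 'v \<Rightarrow> nat"
    and \<alpha>c :: "nat \<Rightarrow> 'w \<Rightarrow> real" and Xc :: "nat \<Rightarrow> nat \<Rightarrow> 'w \<Rightarrow> nat"
  assumes lam: "0 < lam" and INAR: "randomized_INAR1 M0 lam \<alpha> X"
    and cop: "independent_copies M {1..} (borel \<Otimes>\<^sub>M (\<Pi>\<^sub>M k\<in>UNIV. count_space UNIV))
           (\<lambda>j \<omega>. (\<alpha>c j \<omega>, \<lambda>k. Xc j k \<omega>)) M0 (\<lambda>\<omega>. (\<alpha> \<omega>, \<lambda>k. X k \<omega>))"
begin

abbreviation original :: "'v \<Rightarrow> real \<times> (nat \<Rightarrow> nat)" where
  "original \<equiv> \<lambda>\<omega>. (\<alpha> \<omega>, \<lambda>k. X k \<omega>)"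

abbreviation copy :: "nat \<Rightarrow> 'w \<Rightarrow> real \<times> (nat \<Rightarrow> nat)" where
  "copy \<equiv> \<lambda>j \<omega>. (\<alpha>c j \<omega>, \<lambda>k. Xc j k \<omega>)"

lemma copies_prob_space: "prob_space M" "prob_space M0"
  using cop by (auto simp: independent_copies_def)

lemma copies_original_measurable: "original \<in> M0 \<rightarrow>\<^sub>M path_space"
  using cop by (auto simp: independent_copies_def)

lemma copies_indep:
  "prob_space.indep_vars M (\<lambda>_. path_space) copy {1..}"
  using cop by (auto simp: independent_copies_def)

lemma copies_measurable:
  "1 \<le> j \<Longrightarrow> (copy j) \<in> M \<rightarrow>\<^sub>M path_space"
  using copies_indep by (auto simp: prob_space.indep_vars_def2[OF copies_prob_space(1)])

lemma copies_distr:
  "1 \<le> j \<Longrightarrow> distr M path_space (copy j)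
    = distr M0 path_space original"
  using cop by (auto simp: independent_copies_def)

lemma copies_integral:
  fixes h :: "real \<times> (nat \<Rightarrow> nat) \<Rightarrow> 'b::{banach, second_countable_topology}"
  assumes j: "1 \<le> j" and h: "h \<in> borel_measurable path_space"
  shows "(\<integral>\<omega>. h (copy j \<omega>) \<partial>M) = (\<integral>\<omega>. h (original \<omega>) \<partial>M0)"
  using integral_distr[OF copies_measurable[OF j] h] integral_distr[OF copies_original_measurable h] copies_distr[OF j]
  by simp

lemma copies_nn_integral:
  assumes j: "1 \<le> j" and h: "h \<in> borel_measurable path_space"
  shows "(\<integral>\<^sup>+\<omega>. h (copy j \<omega>) \<partial>M) = (\<integral>\<^sup>+\<omega>. h (original \<omega>) \<partial>M0)"
  using nn_integral_distr[OF copies_measurable[OF j], of h] nn_integral_distr[OF copies_original_measurable, of h] copies_distr[OF j] h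
  by simp

lemma copies_alpha_measurable: "1 \<le> j \<Longrightarrow> \<alpha>c j \<in> borel_measurable M"
  using measurable_compose[OF copies_measurable measurable_fst, of j] by simp

lemma measurable_path_coordinate:
  "(\<lambda>x. snd x k) \<in> path_space \<rightarrow>\<^sub>M count_space UNIV"
  by (rule measurable_compose[OF measurable_snd measurable_component_singleton]) simp

lemma copies_X_measurable: "1 \<le> j \<Longrightarrow> (\<lambda>\<omega>. real (Xc j k \<omega>)) \<in> borel_measurable M"
  using measurable_compose[OF measurable_compose[OF copies_measurable measurable_path_coordinate], of j real borel k] by simp

lemma copies_alpha_AE: "1 \<le> j \<Longrightarrow> AE \<omega> in M. 0 < \<alpha>c j \<omega> \<and> \<alpha>c j \<omega> < 1"
proof -
  assume j: "1 \<le> j"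
  let ?L = "path_space"
  have meas: "{x \<in> space ?L. 0 < fst x \<and> fst x < (1::real)} \<in> sets ?L" by measurable
  have "AE x in distr M0 ?L original. 0 < fst x \<and> fst x < (1::real)"
    by (subst AE_distr_iff[OF copies_original_measurable meas]) (auto intro!: AE_I2 simp: INAR_alpha[OF lam INAR])
  then have "AE x in distr M ?L (copy j). 0 < fst x \<and> fst x < (1::real)"
    by (simp only: copies_distr[OF j])
  then show ?thesis
    by (subst (asm) AE_distr_iff[OF copies_measurable[OF j] meas]) simp
qed

text \<open>The law of the pair of parameter and path determines \<open>E(X\<^sub>k | \<alpha>)\<close>, so the conditional mean of each
copy is found from that of the original process.\<close>

lemma copies_conditional_mean:
  assumes fin: "(\<integral>\<^sup>+\<omega>. ennreal (lam / (1 - \<alpha> \<omega>)) \<partial>M0) < \<infinity>" and j: "1 \<le> j"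
  shows "AE \<omega> in M. real_cond_exp M (sigma_gen M (\<alpha>c j)) (\<lambda>\<omega>. real (Xc j k \<omega>)) \<omega> = lam / (1 - \<alpha>c j \<omega>)"
proof -
  interpret prob_space M by (rule copies_prob_space)
  note am[measurable] = copies_alpha_measurable[OF j] and Xm[measurable] = copies_X_measurable[OF j]
  have subalg: "subalgebra M (sigma_gen M (\<alpha>c j))"
    unfolding subalgebra_def sigma_gen_def using am by (auto simp: sets_vimage_algebra2 dest: measurable_sets)
  have YF: "\<alpha>c j \<in> borel_measurable (sigma_gen M (\<alpha>c j))"
    unfolding sigma_gen_def by (rule measurable_vimage_algebra1) auto
  interpret F: finite_measure_subalgebra M "sigma_gen M (\<alpha>c j)"
    by unfold_locales (rule subalg)
  have gm: "(\<lambda>x. lam / (1 - fst x)) \<in> borel_measurable path_space"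
    by measurable
  have nn: "(\<integral>\<^sup>+\<omega>. indicator S (\<alpha>c j \<omega>) * ennreal (real (Xc j k \<omega>)) \<partial>M) = (\<integral>\<^sup>+\<omega>. indicator S (\<alpha>c j \<omega>) * ennreal (lam / (1 - \<alpha>c j \<omega>)) \<partial>M)"
    if S[measurable]: "S \<in> sets borel" for S
  proof -
    have [measurable]: "(\<lambda>x. real (snd x k)) \<in> borel_measurable path_space"
      by (rule measurable_compose[OF measurable_path_coordinate]) simp
    have "(\<integral>\<^sup>+\<omega>. indicator S (\<alpha>c j \<omega>) * ennreal (real (Xc j k \<omega>)) \<partial>M) = (\<integral>\<^sup>+\<omega>. indicator S (\<alpha> \<omega>) * ennreal (real (X k \<omega>)) \<partial>M0)"
      using copies_nn_integral[OF j, of "\<lambda>x. indicator S (fst x) * ennreal (real (snd x k))"] by simp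
    also have "\<dots> = (\<integral>\<^sup>+\<omega>. indicator S (\<alpha> \<omega>) * ennreal (lam / (1 - \<alpha> \<omega>)) \<partial>M0)"
      by (rule INAR_conditional_mean[OF lam INAR S])
    also have "\<dots> = (\<integral>\<^sup>+\<omega>. indicator S (\<alpha>c j \<omega>) * ennreal (lam / (1 - \<alpha>c j \<omega>)) \<partial>M)"
      using copies_nn_integral[OF j, of "\<lambda>x. indicator S (fst x) * ennreal (lam / (1 - fst x))"] by simp
    finally show ?thesis .
  qed
  have pos: "AE \<omega> in M. 0 \<le> lam / (1 - \<alpha>c j \<omega>)"
    using copies_alpha_AE[OF j] by eventually_elim (use lam in simp)
  have fin2: "(\<integral>\<^sup>+\<omega>. ennreal (lam / (1 - \<alpha>c j \<omega>)) \<partial>M) < \<infinity>"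
    using fin copies_nn_integral[OF j, of "\<lambda>x. ennreal (lam / (1 - fst x))"] by simp
  have int2: "integrable M (\<lambda>\<omega>. lam / (1 - \<alpha>c j \<omega>))"
    by (rule integrableI_nonneg[OF _ pos fin2]) measurable
  have int1: "integrable M (\<lambda>\<omega>. real (Xc j k \<omega>))"
    using nn[of UNIV] fin2 by (intro integrableI_nonneg) auto
  show ?thesis
  proof (rule F.real_cond_exp_charact[OF _ int1 int2])
    show "(\<lambda>\<omega>. lam / (1 - \<alpha>c j \<omega>)) \<in> borel_measurable (sigma_gen M (\<alpha>c j))"
      using YF by measurable
    fix A assume "A \<in> sets (sigma_gen M (\<alpha>c j))"
    then obtain S where S[measurable]: "S \<in> sets borel" and A: "A = \<alpha>c j -` S \<inter> space M"
      unfolding sigma_gen_def by (subst (asm) sets_vimage_algebra2) auto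
    have rew: "(LINT \<omega>:A|M. f \<omega>) = (\<integral>\<omega>. indicator S (\<alpha>c j \<omega>) * f \<omega> \<partial>M)" for f :: "'w \<Rightarrow> real"
      unfolding set_lebesgue_integral_def A by (intro Bochner_Integration.integral_cong refl) (auto simp: indicator_def)
    have en: "(\<integral>\<omega>. indicator S (\<alpha>c j \<omega>) * f \<omega> \<partial>M) = enn2real (\<integral>\<^sup>+\<omega>. indicator S (\<alpha>c j \<omega>) * ennreal (f \<omega>) \<partial>M)"
      if [measurable]: "f \<in> borel_measurable M" and "AE \<omega> in M. 0 \<le> f \<omega>" for f :: "'w \<Rightarrow> real"
    proof -
      have "(\<integral>\<omega>. indicator S (\<alpha>c j \<omega>) * f \<omega> \<partial>M) = enn2real (\<integral>\<^sup>+\<omega>. ennreal (indicator S (\<alpha>c j \<omega>) * f \<omega>) \<partial>M)"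
      proof (rule integral_eq_nn_integral)
        show "AE \<omega> in M. 0 \<le> indicator S (\<alpha>c j \<omega>) * f \<omega>"
          using that(2) by eventually_elim simp
      qed measurable
      also have "(\<integral>\<^sup>+\<omega>. ennreal (indicator S (\<alpha>c j \<omega>) * f \<omega>) \<partial>M) = (\<integral>\<^sup>+\<omega>. indicator S (\<alpha>c j \<omega>) * ennreal (f \<omega>) \<partial>M)"
        by (intro nn_integral_cong) (auto simp: indicator_def)
      finally show ?thesis .
    qed
    show "(LINT \<omega>:A|M. real (Xc j k \<omega>)) = (LINT \<omega>:A|M. lam / (1 - \<alpha>c j \<omega>))"
    proof -
      have "(\<integral>\<omega>. indicator S (\<alpha>c j \<omega>) * real (Xc j k \<omega>) \<partial>M)
          = enn2real (\<integral>\<^sup>+\<omega>. indicator S (\<alpha>c j \<omega>) * ennreal (real (Xc j k \<omega>)) \<partial>M)"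
        by (rule en) auto
      also have "\<dots> = enn2real (\<integral>\<^sup>+\<omega>. indicator S (\<alpha>c j \<omega>) * ennreal (lam / (1 - \<alpha>c j \<omega>)) \<partial>M)"
        by (simp only: nn[OF S])
      also have "\<dots> = (\<integral>\<omega>. indicator S (\<alpha>c j \<omega>) * (lam / (1 - \<alpha>c j \<omega>)) \<partial>M)"
        by (rule en[OF _ pos, symmetric]) measurable
      finally show ?thesis unfolding rew .
    qed
  qed
qed

lemma aggregated_sum_AE:
  assumes fin: "(\<integral>\<^sup>+\<omega>. ennreal (lam / (1 - \<alpha> \<omega>)) \<partial>M0) < \<infinity>"
  shows "AE \<omega> in M. \<forall>N n t. aggregated_sum M \<alpha>c Xc N n t \<omega> = (\<Sum>j=1..N. centered_sum lam n t (copy j \<omega>))"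
proof -
  have "AE \<omega> in M. \<forall>j k. 1 \<le> j \<longrightarrow> real_cond_exp M (sigma_gen M (\<alpha>c j)) (\<lambda>\<omega>. real (Xc j k \<omega>)) \<omega> = lam / (1 - \<alpha>c j \<omega>)"
    unfolding AE_all_countable using copies_conditional_mean[OF fin] by auto
  then show ?thesis
    by eventually_elim (auto simp: aggregated_sum_def centered_sum_def intro!: sum.cong)
qed

lemma aggregated_sum_measurable: "aggregated_sum M \<alpha>c Xc N n t \<in> borel_measurable M"
proof -
  have "(\<lambda>\<omega>. real (Xc j k \<omega>) - real_cond_exp M (sigma_gen M (\<alpha>c j)) (\<lambda>\<omega>'. real (Xc j k \<omega>')) \<omega>) \<in> borel_measurable M" if "1 \<le> j" for j k
    using copies_X_measurable[OF that] by (intro borel_measurable_diff borel_measurable_cond_exp2)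
  then show ?thesis unfolding aggregated_sum_def[abs_def] by (intro borel_measurable_sum) auto
qed

lemma copies_prod_integral:
  fixes h :: "real \<times> (nat \<Rightarrow> nat) \<Rightarrow> complex"
  assumes h: "h \<in> borel_measurable path_space"
    and B: "AE \<omega> in M0. norm (h (original \<omega>)) \<le> B"
  shows "(\<integral>\<omega>. (\<Prod>j=1..N. h (copy j \<omega>)) \<partial>M) = (\<integral>\<omega>. h (original \<omega>) \<partial>M0) ^ N"
proof -
  interpret prob_space M by (rule copies_prob_space)
  interpret M0: prob_space M0 by (rule copies_prob_space)
  let ?L = "path_space"
  have i0: "integrable M0 (\<lambda>\<omega>. h (original \<omega>))"
    by (rule M0.integrable_const_bound[OF B measurable_compose[OF copies_original_measurable h]])
  have "(\<integral>\<omega>. (\<Prod>j=1..N. h (copy j \<omega>)) \<partial>M) = (\<Prod>j=1..N. \<integral>\<omega>. h (copy j \<omega>) \<partial>M)"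
  proof (rule indep_vars_lebesgue_integral)
    have "indep_vars (\<lambda>_. ?L) copy {1..N}"
      by (rule indep_vars_subset[OF copies_indep]) auto
    then show "indep_vars (\<lambda>_. borel) (\<lambda>j \<omega>. h (copy j \<omega>)) {1..N}"
      by (rule indep_vars_compose2) (rule h)
    fix j assume "j \<in> {1..N}"
    then have j: "1 \<le> j" by simp
    have "integrable (distr M ?L (copy j)) h"
      unfolding copies_distr[OF j] using i0 by (simp add: integrable_distr_eq[OF copies_original_measurable h])
    then show "integrable M (\<lambda>\<omega>. h (copy j \<omega>))"
      by (simp add: integrable_distr_eq[OF copies_measurable[OF j] h])
  qed simp
  also have "\<dots> = (\<Prod>j=1..N. \<integral>\<omega>. h (original \<omega>) \<partial>M0)"
    by (intro prod.cong refl copies_integral h) auto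
  finally show ?thesis by simp
qed

lemma INAR_alpha_measurable: "\<alpha> \<in> borel_measurable M0"
  using measurable_compose[OF copies_original_measurable measurable_fst] by simp

text \<open>Conditionally on the parameters, the sum of \<open>N\<close> independent Brownian motions is one Brownian motion
with the added variances. A single Wiener process, independent of the parameters, therefore
suffices to realise the limit.\<close>

definition inner_limit_law :: "'u measure \<Rightarrow> (real \<Rightarrow> 'u \<Rightarrow> real) \<Rightarrow> nat \<Rightarrow> (real \<Rightarrow> real) measure" where
  "inner_limit_law M1 B N = distr (M \<Otimes>\<^sub>M M1) (\<Pi>\<^sub>M t\<in>{0..}. borel)
     (\<lambda>x. \<lambda>t\<in>{0..}. sqrt ((\<Sum>j=1..N. long_run_variance lam (\<alpha>c j (fst x))) / (real N * ln (real N))) * B t (snd x))"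

lemma inner_limit_map_measurable:
  assumes B: "standard_wiener M1 B"
  shows "(\<lambda>x. \<lambda>t\<in>{0..}. sqrt ((\<Sum>j=1..N. long_run_variance lam (\<alpha>c j (fst x))) / (real N * ln (real N))) * B t (snd x))
    \<in> M \<Otimes>\<^sub>M M1 \<rightarrow>\<^sub>M (\<Pi>\<^sub>M t\<in>{0..}. borel)"
proof (rule measurable_restrict)
  fix t :: real assume "t \<in> {0..}"
  then have [measurable]: "B t \<in> borel_measurable M1" using B by (simp add: standard_wiener_def real_process_def)
  have [measurable]: "(\<lambda>\<omega>. \<Sum>j=1..N. long_run_variance lam (\<alpha>c j \<omega>)) \<in> borel_measurable M"
    by (intro borel_measurable_sum measurable_compose[OF copies_alpha_measurable measurable_long_run_variance]) auto
  have "(\<lambda>x. \<Sum>j=1..N. long_run_variance lam (\<alpha>c j (fst x))) \<in> borel_measurable (M \<Otimes>\<^sub>M M1)"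
    by (rule measurable_compose[OF measurable_fst, where g="\<lambda>\<omega>. \<Sum>j=1..N. long_run_variance lam (\<alpha>c j \<omega>)"]) measurable
  then show "(\<lambda>x. sqrt ((\<Sum>j=1..N. long_run_variance lam (\<alpha>c j (fst x))) / (real N * ln (real N))) * B t (snd x)) \<in> borel_measurable (M \<Otimes>\<^sub>M M1)"
    by measurable
qed

lemma inner_limit_law_process:
  assumes B: "standard_wiener M1 B"
  shows "real_process (inner_limit_law M1 B N) (\<lambda>t w. w t)"
proof -
  have "prob_space M1" using B by (simp add: standard_wiener_def real_process_def)
  then have "prob_space (M \<Otimes>\<^sub>M M1)" by (intro prob_space_pair copies_prob_space)
  then show ?thesis
    unfolding real_process_def inner_limit_law_def
    using inner_limit_map_measurable[OF B] by (auto intro!: prob_space.prob_space_distr)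
qed

lemma inner_limit_law_char:
  assumes B: "standard_wiener M1 B" and T: "finite T" "T \<subseteq> {0..}"
  shows "(\<integral>w. iexp (\<Sum>t\<in>T. u t * w t) \<partial>inner_limit_law M1 B N)
    = complex_of_real ((\<integral>\<omega>. exp (- (quad_min T u / 2 / (real N * ln (real N)) * long_run_variance lam (\<alpha> \<omega>))) \<partial>M0) ^ N)"
proof -
  interpret M: prob_space M by (rule copies_prob_space)
  interpret M0: prob_space M0 by (rule copies_prob_space)
  interpret M1: prob_space M1 using B by (simp add: standard_wiener_def real_process_def)
  interpret P: pair_prob_space M M1 ..
  have Q: "0 \<le> quad_min T u" by (rule quad_min_nonneg[OF B T])
  define d where "d = real N * ln (real N)"
  have d: "0 \<le> d" unfolding d_def by (cases "N = 0") auto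
  define S where "S \<omega> = (\<Sum>j=1..N. long_run_variance lam (\<alpha>c j \<omega>)) / d" for \<omega>
  define h where "h x = complex_of_real (exp (- (quad_min T u / 2 / d * long_run_variance lam (fst x))))" for x :: "real \<times> (nat \<Rightarrow> nat)"
  have hm: "h \<in> borel_measurable path_space"
    unfolding h_def[abs_def] by measurable
  have hB: "AE \<omega> in M0. norm (h (original \<omega>)) \<le> 1"
    using INAR_alpha[OF lam INAR] long_run_variance_nonneg[OF lam] Q d by (intro AE_I2) (auto simp: h_def)
  let ?F = "\<lambda>x. \<lambda>t\<in>{0..}. sqrt ((\<Sum>j=1..N. long_run_variance lam (\<alpha>c j (fst x))) / (real N * ln (real N))) * B t (snd x)"
  have Fm: "?F \<in> M \<Otimes>\<^sub>M M1 \<rightarrow>\<^sub>M (\<Pi>\<^sub>M t\<in>{0..}. borel)" by (rule inner_limit_map_measurable[OF B])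
  have em: "(\<lambda>w. iexp (\<Sum>t\<in>T. u t * w t)) \<in> borel_measurable (\<Pi>\<^sub>M t\<in>{0..}. borel)"
  proof -
    have [measurable]: "(\<lambda>w. \<Sum>t\<in>T. u t * w t) \<in> borel_measurable (\<Pi>\<^sub>M t\<in>{0..}. borel)"
      using T by (intro borel_measurable_sum borel_measurable_times borel_measurable_const measurable_component_singleton) auto
    show ?thesis by measurable
  qed
  have Fx: "iexp (\<Sum>t\<in>T. u t * ?F (\<omega>, \<omega>') t) = iexp (\<Sum>t\<in>T. (sqrt (S \<omega>) * u t) * B t \<omega>')" for \<omega> \<omega>'
  proof -
    have "(\<Sum>t\<in>T. u t * ?F (\<omega>, \<omega>') t) = (\<Sum>t\<in>T. (sqrt (S \<omega>) * u t) * B t \<omega>')"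
      using T by (intro sum.cong) (auto simp: S_def d_def)
    then show ?thesis by (simp only:)
  qed
  have qm: "quad_min T (\<lambda>t. r * u t) = r\<^sup>2 * quad_min T u" for r
    by (simp add: quad_min_def sum_distrib_left power2_eq_square mult_ac)
  have intp: "integrable (M \<Otimes>\<^sub>M M1) (\<lambda>x. iexp (\<Sum>t\<in>T. u t * ?F x t))"
    by (rule P.integrable_const_bound[where B=1, OF _ measurable_compose[OF Fm em]]) simp
  have "(\<integral>w. iexp (\<Sum>t\<in>T. u t * w t) \<partial>inner_limit_law M1 B N) = (\<integral>x. iexp (\<Sum>t\<in>T. u t * ?F x t) \<partial>(M \<Otimes>\<^sub>M M1))"
    unfolding inner_limit_law_def by (rule integral_distr[OF Fm em])
  also have "\<dots> = (\<integral>\<omega>. \<integral>\<omega>'. iexp (\<Sum>t\<in>T. u t * ?F (\<omega>, \<omega>') t) \<partial>M1 \<partial>M)"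
    by (rule P.integral_fst'[OF intp, symmetric])
  also have "\<dots> = (\<integral>\<omega>. complex_of_real (exp (- ((sqrt (S \<omega>))\<^sup>2 * quad_min T u) / 2)) \<partial>M)"
    unfolding Fx wiener_char[OF B T] qm ..
  also have "\<dots> = (\<integral>\<omega>. (\<Prod>j=1..N. h (copy j \<omega>)) \<partial>M)"
  proof (rule integral_cong_AE)
    have [measurable]: "(\<lambda>\<omega>. long_run_variance lam (\<alpha>c j \<omega>)) \<in> borel_measurable M" if "j \<in> {1..N}" for j
      by (rule measurable_compose[OF copies_alpha_measurable measurable_long_run_variance]) (use that in auto)
    have [measurable]: "S \<in> borel_measurable M" unfolding S_def[abs_def] by measurable
    show "(\<lambda>\<omega>. complex_of_real (exp (- ((sqrt (S \<omega>))\<^sup>2 * quad_min T u) / 2))) \<in> borel_measurable M" by measurable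
    show "(\<lambda>\<omega>. \<Prod>j=1..N. h (copy j \<omega>)) \<in> borel_measurable M"
      by (intro borel_measurable_prod measurable_compose[OF copies_measurable hm]) auto
    have "AE \<omega> in M. \<forall>j\<in>{1..N}. 0 < \<alpha>c j \<omega> \<and> \<alpha>c j \<omega> < 1"
      by (rule AE_finite_allI[OF finite_atLeastAtMost], rule copies_alpha_AE) simp
    then show "AE \<omega> in M. complex_of_real (exp (- ((sqrt (S \<omega>))\<^sup>2 * quad_min T u) / 2)) = (\<Prod>j=1..N. h (copy j \<omega>))"
    proof eventually_elim
      case (elim \<omega>)
      have "0 \<le> S \<omega>" unfolding S_def using elim d by (intro divide_nonneg_nonneg sum_nonneg long_run_variance_nonneg lam) auto
      then have "- ((sqrt (S \<omega>))\<^sup>2 * quad_min T u) / 2 = (\<Sum>j=1..N. - (quad_min T u / 2 / d * long_run_variance lam (\<alpha>c j \<omega>)))"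
        by (simp add: S_def sum_distrib_left sum_negf sum_divide_distrib mult_ac)
      then show ?case unfolding h_def by (simp only: exp_sum[OF finite_atLeastAtMost] of_real_prod fst_conv)
    qed
  qed
  also have "\<dots> = (\<integral>\<omega>. h (original \<omega>) \<partial>M0) ^ N"
    by (rule copies_prod_integral[OF hm hB])
  also have "\<dots> = complex_of_real ((\<integral>\<omega>. exp (- (quad_min T u / 2 / d * long_run_variance lam (\<alpha> \<omega>))) \<partial>M0) ^ N)"
    unfolding h_def by (simp only: integral_complex_of_real of_real_power fst_conv)
  finally show ?thesis by (simp only: d_def)
qed

text \<open>By independence the characteristic function factorises over the copies, and the limit is taken in
each factor. The statement holds for \<open>N < 2\<close> as well, where the normalisation is \<open>1 / 0 = 0\<close>.\<close>

lemma inner_fdd_limit: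
  assumes B: "standard_wiener M1 B"
    and fin: "(\<integral>\<^sup>+\<omega>. ennreal (lam / (1 - \<alpha> \<omega>)) \<partial>M0) < \<infinity>"
  shows "fdd_limit (\<lambda>_. M) (\<lambda>n t \<omega>. 1 / sqrt (real n * real N * ln (real N)) * aggregated_sum M \<alpha>c Xc N n t \<omega>)
    (inner_limit_law M1 B N) (\<lambda>t w. w t)"
proof (rule fdd_limitI_char)
  let ?Y = "\<lambda>n t \<omega>. 1 / sqrt (real n * real N * ln (real N)) * aggregated_sum M \<alpha>c Xc N n t \<omega>"
  interpret M: prob_space M by (rule copies_prob_space)
  show "real_process M (\<lambda>t \<omega>. ?Y n t \<omega>)" for n
    unfolding real_process_def
    by (intro conjI allI impI M.prob_space_axioms borel_measurable_times borel_measurable_const aggregated_sum_measurable)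
  show "real_process (inner_limit_law M1 B N) (\<lambda>t w. w t)" by (rule inner_limit_law_process[OF B])
  fix T :: "real set" and u assume T: "finite T" "T \<subseteq> {0..}"
  define d where "d = real N * ln (real N)"
  have d: "0 \<le> d" unfolding d_def by (cases "N = 0") auto
  define \<theta> where "\<theta> = 1 / sqrt d"
  have \<theta>2: "\<theta>\<^sup>2 = 1 / d" using d by (simp add: \<theta>_def power_divide)
  define g where "g n x = iexp (\<Sum>t\<in>T. u t * (\<theta> / sqrt (real n) * centered_sum lam n t x))" for n x
  have gm: "g n \<in> borel_measurable path_space" for n
  proof -
    have [measurable]: "(\<lambda>x. \<Sum>t\<in>T. u t * (\<theta> / sqrt (real n) * centered_sum lam n t x)) \<in> borel_measurable path_space"
      by (intro borel_measurable_sum borel_measurable_times borel_measurable_const measurable_centered_sum)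
    show ?thesis unfolding g_def[abs_def] by measurable
  qed
  have cf: "(\<integral>\<omega>. iexp (\<Sum>t\<in>T. u t * ?Y n t \<omega>) \<partial>M)
    = (\<integral>\<omega>. g n (original \<omega>) \<partial>M0) ^ N" for n
  proof -
    have "(\<integral>\<omega>. iexp (\<Sum>t\<in>T. u t * ?Y n t \<omega>) \<partial>M)
      = (\<integral>\<omega>. (\<Prod>j=1..N. g n (copy j \<omega>)) \<partial>M)"
    proof (rule integral_cong_AE)
      have [measurable]: "(\<lambda>\<omega>. \<Sum>t\<in>T. u t * ?Y n t \<omega>) \<in> borel_measurable M"
        by (intro borel_measurable_sum borel_measurable_times borel_measurable_const aggregated_sum_measurable)
      show "(\<lambda>\<omega>. iexp (\<Sum>t\<in>T. u t * ?Y n t \<omega>)) \<in> borel_measurable M"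
        by measurable
      show "(\<lambda>\<omega>. \<Prod>j=1..N. g n (copy j \<omega>)) \<in> borel_measurable M"
        by (intro borel_measurable_prod measurable_compose[OF copies_measurable gm]) auto
      show "AE \<omega> in M. iexp (\<Sum>t\<in>T. u t * ?Y n t \<omega>)
         = (\<Prod>j=1..N. g n (copy j \<omega>))"
        using aggregated_sum_AE[OF fin]
      proof eventually_elim
        case (elim \<omega>)
        have sq: "1 / sqrt (real n * real N * ln (real N)) = \<theta> / sqrt (real n)"
          by (simp add: \<theta>_def d_def real_sqrt_mult)
        have "(\<Sum>t\<in>T. u t * ?Y n t \<omega>)
          = (\<Sum>t\<in>T. \<Sum>j=1..N. u t * (\<theta> / sqrt (real n) * centered_sum lam n t (copy j \<omega>)))"
          unfolding sq elim[rule_format] by (simp only: sum_distrib_left)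
        also have "\<dots> = (\<Sum>j=1..N. \<Sum>t\<in>T. u t * (\<theta> / sqrt (real n) * centered_sum lam n t (copy j \<omega>)))"
          by (rule sum.swap)
        finally have "iexp (\<Sum>t\<in>T. u t * ?Y n t \<omega>)
          = exp (\<Sum>j=1..N. \<i> * complex_of_real (\<Sum>t\<in>T. u t * (\<theta> / sqrt (real n) * centered_sum lam n t (copy j \<omega>))))"
          by (simp only: of_real_sum[of _ "{1..N}"] sum_distrib_left[of \<i>])
        then show ?case unfolding g_def by (simp only: exp_sum[OF finite_atLeastAtMost])
      qed
    qed
    also have "\<dots> = (\<integral>\<omega>. g n (original \<omega>) \<partial>M0) ^ N"
      by (rule copies_prod_integral[OF gm, where B=1]) (simp add: g_def)
    finally show ?thesis .
  qed
  have "(\<lambda>n. (\<integral>\<omega>. g n (original \<omega>) \<partial>M0) ^ N)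
    \<longlonglongrightarrow> (\<integral>\<omega>. complex_of_real (exp (- (\<theta>\<^sup>2 * quad_min T u / 2 * long_run_variance lam (\<alpha> \<omega>)))) \<partial>M0) ^ N"
    unfolding g_def by (intro tendsto_power INAR_char_limit[OF lam INAR T])
  also have "(\<integral>\<omega>. complex_of_real (exp (- (\<theta>\<^sup>2 * quad_min T u / 2 * long_run_variance lam (\<alpha> \<omega>)))) \<partial>M0) ^ N
    = (\<integral>w. iexp (\<Sum>t\<in>T. u t * w t) \<partial>inner_limit_law M1 B N)"
    unfolding inner_limit_law_char[OF B T] \<theta>2 d_def integral_complex_of_real of_real_power by (simp add: mult_ac)
  finally show "(\<lambda>n. \<integral>\<omega>. iexp (\<Sum>t\<in>T. u t * ?Y n t \<omega>) \<partial>M)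
    \<longlonglongrightarrow> (\<integral>w. iexp (\<Sum>t\<in>T. u t * w t) \<partial>inner_limit_law M1 B N)"
    unfolding cf .
qed

end

theorem theorem2p4:
  fixes M0 :: "'v measure" and M :: "'w measure" and M1 :: "'u measure"
    and lam \<beta> \<psi>1 :: real and \<psi> :: "real \<Rightarrow> real"
    and \<alpha> :: "'v \<Rightarrow> real" and X :: "nat \<Rightarrow> 'v \<Rightarrow> nat"
    and \<alpha>c :: "nat \<Rightarrow> 'w \<Rightarrow> real" and Xc :: "nat \<Rightarrow> nat \<Rightarrow> 'w \<Rightarrow> nat"
    and B :: "real \<Rightarrow> 'u \<Rightarrow> real"
  assumes "0 < lam"
    and "randomized_INAR1 M0 lam \<alpha> X"
    and "has_real_density M0 \<alpha> (\<lambda>x. indicator {0<..<1} x * (\<psi> x * (1 - x) powr \<beta>))"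
    and "set_integrable lborel {0<..<1} \<psi>"
    and "(\<psi> \<longlongrightarrow> \<psi>1) (at_left 1)" and "0 < \<psi>1"
    and "independent_copies M {1..} (borel \<Otimes>\<^sub>M (\<Pi>\<^sub>M k\<in>UNIV. count_space UNIV))
           (\<lambda>j \<omega>. (\<alpha>c j \<omega>, \<lambda>k. Xc j k \<omega>)) M0 (\<lambda>\<omega>. (\<alpha> \<omega>, \<lambda>k. X k \<omega>))"
    and "standard_wiener M1 B"
    and "\<beta> = 1"
  shows "iterated_fdd_limit M
           (\<lambda>N n t \<omega>. 1 / sqrt (real n * real N * ln (real N)) * aggregated_sum M \<alpha>c Xc N n t \<omega>)
           M1 (\<lambda>t \<omega>. sqrt (lam * \<psi>1) * B t \<omega>)"
proof -
  note lam = assms(1) and INAR = assms(2) and int = assms(4) and lim = assms(5) and \<psi>1 = assms(6)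
    and cop = assms(7) and B = assms(8)
  have D: "has_real_density M0 \<alpha> (\<lambda>x. indicator {0<..<1} x * (\<psi> x * (1 - x) powr 1))"
    using assms(3) by (simp only: assms(9))
  have P0: "prob_space M0" using cop by (simp add: independent_copies_def)
  have RB: "real_process M1 B" using B by (simp add: standard_wiener_def)
  define L where "L = inner_limit_law M lam \<alpha>c M1 B"
  have sets: "sets (L N) = sets (\<Pi>\<^sub>M t\<in>{0..}. borel)" for N
    unfolding L_def inner_limit_law_def[OF lam INAR cop] by simp
  have inner: "fdd_limit (\<lambda>_. M) (\<lambda>n t \<omega>. 1 / sqrt (real n * real N * ln (real N)) * aggregated_sum M \<alpha>c Xc N n t \<omega>) (L N) (\<lambda>t w. w t)" for N
    unfolding L_def
    by (rule inner_fdd_limit[OF lam INAR cop B inverse_one_minus_finite_mean[OF lam P0 D int]])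
  have outer: "fdd_limit L (\<lambda>_ t w. w t) M1 (\<lambda>t \<omega>. sqrt (lam * \<psi>1) * B t \<omega>)"
  proof (rule fdd_limitI_char)
    show "real_process (L N) (\<lambda>t w. w t)" for N
      unfolding L_def by (rule inner_limit_law_process[OF lam INAR cop B])
    show "real_process M1 (\<lambda>t \<omega>. sqrt (lam * \<psi>1) * B t \<omega>)"
      using RB unfolding real_process_def by auto
    fix T :: "real set" and u assume T: "finite T" "T \<subseteq> {0..}"
    have "0 \<le> quad_min T u / 2" using quad_min_nonneg[OF B T] by simp
    from laplace_power_limit[OF lam P0 INAR_alpha_measurable[OF lam INAR cop] INAR_alpha[OF lam INAR] D int lim \<psi>1 this]
    have "(\<lambda>N. complex_of_real ((\<integral>\<omega>. exp (- (quad_min T u / 2 / (real N * ln (real N)) * long_run_variance lam (\<alpha> \<omega>))) \<partial>M0) ^ N))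
      \<longlonglongrightarrow> complex_of_real (exp (- (quad_min T u / 2 * (lam * \<psi>1))))"
      by (rule tendsto_of_real)
    moreover have "(\<integral>\<omega>. iexp (\<Sum>t\<in>T. u t * (sqrt (lam * \<psi>1) * B t \<omega>)) \<partial>M1) = complex_of_real (exp (- (quad_min T u / 2 * (lam * \<psi>1))))"
    proof -
      have "quad_min T (\<lambda>t. u t * sqrt (lam * \<psi>1)) = (sqrt (lam * \<psi>1))\<^sup>2 * quad_min T u"
        by (simp only: quad_min_def sum_distrib_left power2_eq_square mult_ac)
      also have "(sqrt (lam * \<psi>1))\<^sup>2 = lam * \<psi>1" using lam \<psi>1 by simp
      finally have "- quad_min T (\<lambda>t. u t * sqrt (lam * \<psi>1)) / 2 = - (quad_min T u / 2 * (lam * \<psi>1))" by simp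
      then show ?thesis using wiener_char[OF B T, of "\<lambda>t. u t * sqrt (lam * \<psi>1)"]
        by (simp only: mult.assoc)
    qed
    ultimately show "(\<lambda>N. \<integral>w. iexp (\<Sum>t\<in>T. u t * w t) \<partial>L N) \<longlonglongrightarrow> (\<integral>\<omega>. iexp (\<Sum>t\<in>T. u t * (sqrt (lam * \<psi>1) * B t \<omega>)) \<partial>M1)"
      unfolding L_def inner_limit_law_char[OF lam INAR cop B T] by simp
  qed
  show ?thesis
    unfolding iterated_fdd_limit_def using sets inner outer by (intro exI[of _ L]) simp
qed

end
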